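(* There is a universal constant $C>0$ such that for every integer $N\ge2$, every $\gamma\in[1/\sqrt N,1]$ and every $\delta>0$ there is a quantum algorithm that uses at most $C/\gamma^2$ copies of the advice state, and solves $\mathsf{maxQPE}_{N,\delta}$ with advice states of overlap at least $\gamma$ in the unknown-eigenbasis case (and hence also in the known-eigenbasis case) with cost at most $C\,\frac{\max\{1,\log(1/\gamma)\}}{\gamma\delta}$.
   Context: Model of computation. The input is an unknown $N$-dimensional unitary $U$. The state space is $\mathbb{C}^N\otimes W$, where the first register is $N$-dimensional with computational basis $|0\rangle,\dots,|N-1\rangle$ and $W$ is an arbitrarily large (finite-dimensional) workspace. The algorithm may apply $U$ and $U^{-1}$ to the first register (possibly controlled by a qubit of the workspace), and arbitrary unitaries independent of $U$ to the whole space; at the end it performs a POVM (independent of $U$) which determines the classical output. The starting state is the all-zero state together with the given copies of the advice state. The cost of the algorithm is the total number of applications of $U$ and $U^{-1}$ (including controlled versions); all other operations are free. Logarithms are base 2. The task $\mathsf{maxQPE}_{N,\delta}$ with advice states of overlap at least $\gamma$. Let $U=\sum_{j=0}^{N-1}e^{i\theta_j}|u_j\rangle\langle u_j|$ with orthonormal eigenbasis $(|u_j\rangle)$ and $\theta_j\in[0,2\pi)$, let $\theta_{\max}=\max_j\theta_j$, and let $S$ be the span of all eigenstates with eigenphase $\theta_{\max}$. Input promise: $\theta_{\max}\in[0,2\pi-2\delta)$. In the known-eigenbasis case $U$ is moreover promised to be diagonal in the computational basis; in the unknown-eigenbasis case the eigenbasis is arbitrary and unknown. Advice: the algorithm is given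 some number of copies of a state $|\alpha\rangle\in\mathbb{C}^N$ with $\|P_S|\alpha\rangle\|^2\ge\gamma^2$, where $P_S$ is the orthogonal projection onto $S$. Output: with probability at least $2/3$, a value in $[\theta_{\max}-\delta,\theta_{\max}+\delta]$ modulo $2\pi$. The algorithm (which may depend on $N,\delta,\gamma$) must be correct for every $U$ satisfying the promise and every valid $|\alpha\rangle$. *)

theory Defs
  imports Complex_Main "Jordan_Normal_Form.Schur_Decomposition" "Jordan_Normal_Form.VS_Connect"
begin

section \<open>Tensor products, unitaries, POVMs\<close>

definition tensor_mat :: "complex mat \<Rightarrow> complex mat \<Rightarrow> complex mat" (infixr "\<otimes>\<^sub>m" 73) where
  "A \<otimes>\<^sub>m B = mat (dim_row A * dim_row B) (dim_col A * dim_col B)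
     (\<lambda>(i, j). A $$ (i div dim_row B, j div dim_col B) * B $$ (i mod dim_row B, j mod dim_col B))"

definition tensor_vec :: "complex vec \<Rightarrow> complex vec \<Rightarrow> complex vec" (infixr "\<otimes>\<^sub>v" 73) where
  "v \<otimes>\<^sub>v w = vec (dim_vec v * dim_vec w) (\<lambda>i. v $ (i div dim_vec w) * w $ (i mod dim_vec w))"

fun tensor_power :: "complex vec \<Rightarrow> nat \<Rightarrow> complex vec" where
  "tensor_power v 0 = unit_vec 1 0"
| "tensor_power v (Suc k) = v \<otimes>\<^sub>v tensor_power v k"

definition unitary_mat :: "nat \<Rightarrow> complex mat \<Rightarrow> bool" where
  "unitary_mat d V \<longleftrightarrow>
     V \<in> carrier_mat d d \<and> V * mat_adjoint V = 1\<^sub>m d \<and> mat_adjoint V * V = 1\<^sub>m d"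

(* The order on complex numbers is the one of HOL-Library.Complex_Order: 0 \<le> z means that z is
   real and nonnegative. The inner product \<bullet>c is conjugate-linear in its second argument. *)
definition psd_mat :: "nat \<Rightarrow> complex mat \<Rightarrow> bool" where
  "psd_mat d E \<longleftrightarrow> E \<in> carrier_mat d d \<and> (\<forall>v \<in> carrier_vec d. 0 \<le> (E *\<^sub>v v) \<bullet>c v)"

definition sq_norm_cvec :: "complex vec \<Rightarrow> real" where
  "sq_norm_cvec v = Re (v \<bullet>c v)"

(* A POVM with finitely many outcomes; each effect is paired with the classical output that is
   returned when it occurs. Different effects may carry the same output. *)
type_synonym povm = "(real \<times> complex mat) list"

definition valid_povm :: "nat \<Rightarrow> povm \<Rightarrow> bool" where
  "valid_povm d P \<longleftrightarrow> (\<forall>(x, E) \<in> set P. psd_mat d E) \<and> foldr (\<lambda>(x, E) M. E + M) P (0\<^sub>m d d) = 1\<^sub>m d"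

definition povm_prob :: "povm \<Rightarrow> complex vec \<Rightarrow> real set \<Rightarrow> real" where
  "povm_prob P \<psi> G = (\<Sum>(x, E) \<leftarrow> P. if x \<in> G then Re ((E *\<^sub>v \<psi>) \<bullet>c \<psi>) else 0)"

section \<open>Query algorithms with advice\<close>

(* The constructor Free carries a unitary on the whole space that is independent of the input U. *)
datatype gate = Free "complex mat" | ApplyU | ApplyUinv | CtrlU | CtrlUinv

(* The total space is C^N \<otimes> W with workspace W = C^2 \<otimes> C^ancilla \<otimes> (C^N)^(\<otimes> copies). The qubit C^2
   serves as the control of the controlled queries: any other control qubit can be exchanged with
   it by a free unitary. The last factor of W initially holds the copies of the advice state.
   Gates are applied in list order. *)
record qalg =
  copies :: nat
  ancilla :: nat
  gates :: "gate list"
  measurement :: povm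

definition rest_dim :: "nat \<Rightarrow> qalg \<Rightarrow> nat" where
  "rest_dim N A = ancilla A * N ^ copies A"

definition total_dim :: "nat \<Rightarrow> qalg \<Rightarrow> nat" where
  "total_dim N A = N * (2 * rest_dim N A)"

definition valid_qalg :: "nat \<Rightarrow> qalg \<Rightarrow> bool" where
  "valid_qalg N A \<longleftrightarrow>
     0 < ancilla A \<and>
     (\<forall>V. Free V \<in> set (gates A) \<longrightarrow> unitary_mat (total_dim N A) V) \<and>
     valid_povm (total_dim N A) (measurement A)"

definition qubit_proj :: "nat \<Rightarrow> complex mat" where
  "qubit_proj b = mat 2 2 (\<lambda>(i, j). if i = b \<and> j = b then 1 else 0)"

definition on_first :: "nat \<Rightarrow> complex mat \<Rightarrow> complex mat" where
  "on_first r V = V \<otimes>\<^sub>m 1\<^sub>m (2 * r)"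

definition controlled :: "nat \<Rightarrow> nat \<Rightarrow> complex mat \<Rightarrow> complex mat" where
  "controlled N r V =
     (1\<^sub>m N \<otimes>\<^sub>m qubit_proj 0 \<otimes>\<^sub>m 1\<^sub>m r) + (V \<otimes>\<^sub>m qubit_proj 1 \<otimes>\<^sub>m 1\<^sub>m r)"

(* The input U is unitary, so its inverse is its adjoint. *)
fun gate_op :: "nat \<Rightarrow> nat \<Rightarrow> complex mat \<Rightarrow> gate \<Rightarrow> complex mat" where
  "gate_op N r U (Free V) = V"
| "gate_op N r U ApplyU = on_first r U"
| "gate_op N r U ApplyUinv = on_first r (mat_adjoint U)"
| "gate_op N r U CtrlU = controlled N r U"
| "gate_op N r U CtrlUinv = controlled N r (mat_adjoint U)"

fun is_query :: "gate \<Rightarrow> bool" where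
  "is_query (Free V) = False"
| "is_query g = True"

definition cost :: "qalg \<Rightarrow> nat" where
  "cost A = length (filter is_query (gates A))"

definition start_state :: "nat \<Rightarrow> qalg \<Rightarrow> complex vec \<Rightarrow> complex vec" where
  "start_state N A \<alpha> =
     unit_vec N 0 \<otimes>\<^sub>v unit_vec 2 0 \<otimes>\<^sub>v unit_vec (ancilla A) 0 \<otimes>\<^sub>v tensor_power \<alpha> (copies A)"

definition final_state :: "nat \<Rightarrow> qalg \<Rightarrow> complex mat \<Rightarrow> complex vec \<Rightarrow> complex vec" where
  "final_state N A U \<alpha> =
     foldl (\<lambda>\<psi> g. gate_op N (rest_dim N A) U g *\<^sub>v \<psi>) (start_state N A \<alpha>) (gates A)"

definition output_prob :: "nat \<Rightarrow> qalg \<Rightarrow> complex mat \<Rightarrow> complex vec \<Rightarrow> real set \<Rightarrow> real" where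
  "output_prob N A U \<alpha> G = povm_prob (measurement A) (final_state N A U \<alpha>) G"

section \<open>The task maxQPE with advice\<close>

(* U is the sum over j < N of exp (i theta_j) |u_j><u_j|, written entrywise. *)
definition spectral_decomp ::
    "nat \<Rightarrow> complex mat \<Rightarrow> (nat \<Rightarrow> real) \<Rightarrow> (nat \<Rightarrow> complex vec) \<Rightarrow> bool" where
  "spectral_decomp N U \<theta> u \<longleftrightarrow>
     (\<forall>j<N. 0 \<le> \<theta> j \<and> \<theta> j < 2 * pi) \<and>
     (\<forall>j<N. u j \<in> carrier_vec N) \<and>
     (\<forall>j<N. \<forall>k<N. u j \<bullet>c u k = (if j = k then 1 else 0)) \<and>
     U = mat N N (\<lambda>(a, b). \<Sum>j<N. cis (\<theta> j) * u j $ a * cnj (u j $ b))"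

definition theta_max :: "nat \<Rightarrow> (nat \<Rightarrow> real) \<Rightarrow> real" where
  "theta_max N \<theta> = Max (\<theta> ` {..<N})"

definition top_space :: "nat \<Rightarrow> (nat \<Rightarrow> real) \<Rightarrow> (nat \<Rightarrow> complex vec) \<Rightarrow> complex vec set" where
  "top_space N \<theta> u =
     LinearCombinations.module.span class_ring (module_vec TYPE(complex) N)
       {u j |j. j < N \<and> \<theta> j = theta_max N \<theta>}"

definition orth_proj :: "complex vec set \<Rightarrow> complex vec \<Rightarrow> complex vec" where
  "orth_proj S v = (THE p. p \<in> S \<and> (\<forall>s \<in> S. (v - p) \<bullet>c s = 0))"

definition advice_state ::
    "nat \<Rightarrow> real \<Rightarrow> (nat \<Rightarrow> real) \<Rightarrow> (nat \<Rightarrow> complex vec) \<Rightarrow> complex vec \<Rightarrow> bool" where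
  "advice_state N \<gamma> \<theta> u \<alpha> \<longleftrightarrow>
     \<alpha> \<in> carrier_vec N \<and> sq_norm_cvec \<alpha> = 1 \<and>
     sq_norm_cvec (orth_proj (top_space N \<theta> u) \<alpha>) \<ge> \<gamma>\<^sup>2"

definition within_mod_2pi :: "real \<Rightarrow> real \<Rightarrow> real set" where
  "within_mod_2pi t \<delta> = {x. \<exists>k :: int. t - \<delta> \<le> x + 2 * pi * of_int k \<and> x + 2 * pi * of_int k \<le> t + \<delta>}"

definition solves_maxQPE_for ::
    "(complex mat \<Rightarrow> bool) \<Rightarrow> nat \<Rightarrow> real \<Rightarrow> real \<Rightarrow> qalg \<Rightarrow> bool" where
  "solves_maxQPE_for promise N \<delta> \<gamma> A \<longleftrightarrow>
     (\<forall>U \<theta> u \<alpha>. promise U \<longrightarrow> spectral_decomp N U \<theta> u \<longrightarrow>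
        0 \<le> theta_max N \<theta> \<longrightarrow> theta_max N \<theta> < 2 * pi - 2 * \<delta> \<longrightarrow> advice_state N \<gamma> \<theta> u \<alpha> \<longrightarrow>
        output_prob N A U \<alpha> (within_mod_2pi (theta_max N \<theta>) \<delta>) \<ge> 2 / 3)"

definition solves_maxQPE_unknown_basis :: "nat \<Rightarrow> real \<Rightarrow> real \<Rightarrow> qalg \<Rightarrow> bool" where
  "solves_maxQPE_unknown_basis = solves_maxQPE_for (\<lambda>U. True)"

definition solves_maxQPE_known_basis :: "nat \<Rightarrow> real \<Rightarrow> real \<Rightarrow> qalg \<Rightarrow> bool" where
  "solves_maxQPE_known_basis = solves_maxQPE_for diagonal_mat"

end

theory Submission
  imports Defs
begin

text \<open>
  Expand the \<open>m = O(1 / \<gamma>\<^sup>2)\<close> copies of the advice state in products of eigenvectors. The algorithm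
  applies \<open>U\<close> only to the copies. It therefore preserves every such product, and acts on the ancilla
  like a circuit with oracle access to the \<open>m\<close> eigenphases of the factors. With constant probability a
  factor lies in the top eigenspace, so it suffices to estimate the largest of \<open>m\<close> phases with
  \<open>O(sqrt m * log m / \<delta>)\<close> queries and constant error.

  Whether some phase exceeds a threshold, up to resolution \<open>\<kappa>\<close>, is tested by amplitude amplification
  over the indices on top of phase estimation. The window of the phase estimation has exponentially
  small tails, so that at the price of a factor \<open>log m\<close> the \<open>m\<close> phases cause no false positive.
  The thresholds come from a search whose resolution changes by factors of \<open>3 / 2\<close>. The costs are
  dominated by the finest scale \<open>\<delta>\<close>, and the error probabilities are chosen geometrically smaller at
  the coarser scales, where further repetitions are cheap.
\<close>

section \<open>Matrices, tensor products and block diagonal matrices\<close>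

text \<open>Why \<open>log m\<close>: amplification can multiply an unwanted acceptance probability
  by \<open>O(m)\<close>, so phase estimation must err with probability \<open>O(1 / m)\<close> on
  each phase, and a window made of \<open>O(log m)\<close> convolved boxes achieves this. It stays a
  single logarithm because the costs of the different numbers of amplification rounds form a
  geometric series. At scale \<open>k\<close>, with resolution about
  \<open>\<delta> * (3 / 2) ^ k\<close>, an error of \<open>1 / 2 ^ (k + 5)\<close> costs a factor
  polynomial in \<open>k\<close>, against an exponential gain from the coarser resolution. The
  levels therefore sum to a constant multiple of the finest one, and no
  \<open>log (1 / \<delta>)\<close> appears. The obstacle to starting coarsely is the circle: a test
  of resolution \<open>\<kappa>\<close> needs all phases to stay \<open>2 * \<kappa>\<close> below
  \<open>2 * pi\<close>, while the promise only gives \<open>2 * \<delta>\<close>. Hence the search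
  first moves from fine to coarse scales, where each rejection widens the known margin by
  \<open>3 / 2\<close>, and then back to fine ones.\<close>

lemma mat_adjoint_index [simp]:
  "i < dim_col A \<Longrightarrow> j < dim_row A \<Longrightarrow> mat_adjoint A $$ (i, j) = cnj (A $$ (j, i))"
  for A :: "complex mat"
  by (simp add: mat_adjoint_def mat_of_rows_index)

lemma mat_adjoint_dim [simp]:
  "dim_row (mat_adjoint A) = dim_col A" "dim_col (mat_adjoint A) = dim_row A"
  for A :: "complex mat"
  by (simp_all add: mat_adjoint_def)

lemma mat_adjoint_carrier [simp, intro]:
  "A \<in> carrier_mat n m \<Longrightarrow> mat_adjoint A \<in> carrier_mat m n" for A :: "complex mat"
  by auto

lemma mult_mat_index_sum:
  "i < dim_row A \<Longrightarrow> j < dim_col B \<Longrightarrow> dim_col A = dim_row B \<Longrightarrow>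
    (A * B) $$ (i, j) = (\<Sum>k<dim_row B. A $$ (i, k) * B $$ (k, j))"
  by (simp add: scalar_prod_def atLeast0LessThan)

lemma mult_mat_vec_index_sum:
  "i < dim_row A \<Longrightarrow> dim_col A = dim_vec v \<Longrightarrow> (A *\<^sub>v v) $ i = (\<Sum>k<dim_vec v. A $$ (i, k) * v $ k)"
  by (simp add: scalar_prod_def atLeast0LessThan)

lemma mat_adjoint_mult:
  fixes A B :: "complex mat"
  assumes "A \<in> carrier_mat n m" "B \<in> carrier_mat m k"
  shows "mat_adjoint (A * B) = mat_adjoint B * mat_adjoint A"
  using assms by (intro eq_matI) (auto simp: mult_mat_index_sum ac_simps simp del: index_mult_mat(1))

lemma mat_adjoint_adjoint [simp]: "mat_adjoint (mat_adjoint A) = A" for A :: "complex mat"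
  by (intro eq_matI) auto

lemma mat_adjoint_one [simp]: "mat_adjoint (1\<^sub>m n :: complex mat) = 1\<^sub>m n"
  by (intro eq_matI) auto

lemma mult_less_bound: "i < a \<Longrightarrow> j < b \<Longrightarrow> i * b + j < a * (b :: nat)"
proof -
  assume "i < a" "j < b"
  then have "i * b + j < Suc i * b" "Suc i * b \<le> a * b" by (simp_all only: mult_le_mono1 Suc_leI) simp
  then show ?thesis by linarith
qed

text \<open>Mixed-radix splitting of an index. The computations with tensor products and registers
  below reduce to it.\<close>

lemma sum_lessThan_times:
  "(\<Sum>k<a * b. f k) = (\<Sum>i<a. \<Sum>j<b. f (i * b + j))" for f :: "nat \<Rightarrow> 'a::comm_monoid_add"
proof (induction a)
  case (Suc a)
  have "(\<Sum>k<n + b. f k) = (\<Sum>k<n. f k) + (\<Sum>j<b. f (n + j))" for n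
    by (induction b) (auto simp: add.assoc)
  from this[of "a * b"] show ?case using Suc by (simp add: add.commute)
qed simp

lemma divmod_nat_less [simp]: "k < a * b \<Longrightarrow> k div b < a" "k < a * b \<Longrightarrow> k mod b < (b :: nat)"
  by (cases "b = 0"; simp add: less_mult_imp_div_less)+

lemma divmod_nat_eqs [simp]: "j < b \<Longrightarrow> (i * b + j) div b = i" "j < b \<Longrightarrow> (i * b + j) mod b = (j :: nat)"
  by simp_all

lemma divmod_nat_eq_iff: "i = j \<longleftrightarrow> i div b = j div b \<and> i mod b = j mod (b :: nat)"
  using div_mult_mod_eq[of i b] div_mult_mod_eq[of j b] by metis

section \<open>Tensor products, computed on pairs of indices\<close>

lemma tensor_mat_dim [simp]:
  "dim_row (A \<otimes>\<^sub>m B) = dim_row A * dim_row B" "dim_col (A \<otimes>\<^sub>m B) = dim_col A * dim_col B"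
  by (simp_all add: tensor_mat_def)

lemma tensor_vec_dim [simp]: "dim_vec (v \<otimes>\<^sub>v w) = dim_vec v * dim_vec w"
  by (simp add: tensor_vec_def)

lemma tensor_mat_carrier [simp, intro]:
  "A \<in> carrier_mat n m \<Longrightarrow> B \<in> carrier_mat k l \<Longrightarrow> A \<otimes>\<^sub>m B \<in> carrier_mat (n * k) (m * l)"
  unfolding carrier_mat_def by simp

lemma tensor_vec_carrier [simp, intro]:
  "v \<in> carrier_vec n \<Longrightarrow> w \<in> carrier_vec m \<Longrightarrow> v \<otimes>\<^sub>v w \<in> carrier_vec (n * m)"
  unfolding carrier_vec_def by simp

lemma tensor_mat_index [simp]:
  "i < dim_row A * dim_row B \<Longrightarrow> j < dim_col A * dim_col B \<Longrightarrow>
    (A \<otimes>\<^sub>m B) $$ (i, j) = A $$ (i div dim_row B, j div dim_col B) * B $$ (i mod dim_row B, j mod dim_col B)"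
  by (simp add: tensor_mat_def)

lemma tensor_vec_index [simp]:
  "i < dim_vec v * dim_vec w \<Longrightarrow> (v \<otimes>\<^sub>v w) $ i = v $ (i div dim_vec w) * w $ (i mod dim_vec w)"
  by (simp add: tensor_vec_def)

lemma tensor_mat_mult:
  assumes "A \<in> carrier_mat n m" "B \<in> carrier_mat k l" "C \<in> carrier_mat m m'" "D \<in> carrier_mat l l'"
  shows "(A \<otimes>\<^sub>m B) * (C \<otimes>\<^sub>m D) = (A * C) \<otimes>\<^sub>m (B * D)"
proof (intro eq_matI)
  fix i j assume "i < dim_row ((A * C) \<otimes>\<^sub>m (B * D))" "j < dim_col ((A * C) \<otimes>\<^sub>m (B * D))"
  then have ij: "i < n * k" "j < m' * l'" using assms by auto
  have "((A \<otimes>\<^sub>m B) * (C \<otimes>\<^sub>m D)) $$ (i, j) =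
     (\<Sum>x<m. \<Sum>y<l. A $$ (i div k, x) * B $$ (i mod k, y) * (C $$ (x, j div l') * D $$ (y, j mod l')))"
    using assms ij
    by (subst mult_mat_index_sum) (auto simp: sum_lessThan_times mult_less_bound intro!: sum.cong)
  also have "\<dots> = ((A * C) \<otimes>\<^sub>m (B * D)) $$ (i, j)"
    using assms ij by (auto simp: mult_mat_index_sum sum_product ac_simps simp del: index_mult_mat(1)
        intro!: sum.cong)
  finally show "((A \<otimes>\<^sub>m B) * (C \<otimes>\<^sub>m D)) $$ (i, j) = ((A * C) \<otimes>\<^sub>m (B * D)) $$ (i, j)" .
qed (use assms in auto)

lemma tensor_mat_vec_mult:
  assumes "A \<in> carrier_mat n m" "B \<in> carrier_mat k l" "v \<in> carrier_vec m" "w \<in> carrier_vec l"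
  shows "(A \<otimes>\<^sub>m B) *\<^sub>v (v \<otimes>\<^sub>v w) = (A *\<^sub>v v) \<otimes>\<^sub>v (B *\<^sub>v w)"
proof (intro eq_vecI)
  fix i assume "i < dim_vec ((A *\<^sub>v v) \<otimes>\<^sub>v (B *\<^sub>v w))"
  then have i: "i < n * k" using assms by auto
  have "((A \<otimes>\<^sub>m B) *\<^sub>v (v \<otimes>\<^sub>v w)) $ i =
     (\<Sum>x<m. \<Sum>y<l. A $$ (i div k, x) * B $$ (i mod k, y) * (v $ x * w $ y))"
    using assms i
    by (subst mult_mat_vec_index_sum) (auto simp: sum_lessThan_times mult_less_bound intro!: sum.cong)
  also have "\<dots> = ((A *\<^sub>v v) \<otimes>\<^sub>v (B *\<^sub>v w)) $ i"
    using assms i by (auto simp: mult_mat_vec_index_sum sum_product ac_simps simp del: index_mult_mat_vec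
        intro!: sum.cong)
  finally show "((A \<otimes>\<^sub>m B) *\<^sub>v (v \<otimes>\<^sub>v w)) $ i = ((A *\<^sub>v v) \<otimes>\<^sub>v (B *\<^sub>v w)) $ i" .
qed (use assms in auto)

lemma tensor_mat_adjoint: "mat_adjoint (A \<otimes>\<^sub>m B) = mat_adjoint A \<otimes>\<^sub>m mat_adjoint B"
  by (intro eq_matI) auto

lemma tensor_mat_one [simp]: "1\<^sub>m n \<otimes>\<^sub>m 1\<^sub>m m = 1\<^sub>m (n * m)"
proof (intro eq_matI)
  fix i j assume "i < dim_row (1\<^sub>m (n * m) :: complex mat)" "j < dim_col (1\<^sub>m (n * m) :: complex mat)"
  then show "(1\<^sub>m n \<otimes>\<^sub>m 1\<^sub>m m) $$ (i, j) = 1\<^sub>m (n * m) $$ (i, j)"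
    using divmod_nat_eq_iff[of i j m] by (auto simp del: mod_less div_less)
qed auto

text \<open>A right inverse of a square matrix is also a left inverse, so orthonormal rows
  suffice.\<close>

lemma unitary_matI:
  assumes "V \<in> carrier_mat d d"
    "\<And>i j. i < d \<Longrightarrow> j < d \<Longrightarrow> (\<Sum>k<d. V $$ (i, k) * cnj (V $$ (j, k))) = (if i = j then 1 else 0)"
  shows "unitary_mat d V"
proof -
  have *: "V * mat_adjoint V = 1\<^sub>m d"
    using assms by (intro eq_matI) (auto simp: mult_mat_index_sum simp del: index_mult_mat(1))
  then have "mat_adjoint V * V = 1\<^sub>m d"
    using mat_mult_left_right_inverse[OF assms(1) mat_adjoint_carrier[OF assms(1)]] by simp
  with * assms(1) show ?thesis by (simp add: unitary_mat_def)
qed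

lemma unitary_mat_carrier [simp]: "unitary_mat d V \<Longrightarrow> V \<in> carrier_mat d d"
  by (simp add: unitary_mat_def)

lemma unitary_mat_one [simp]: "unitary_mat d (1\<^sub>m d)"
  by (simp add: unitary_mat_def)

lemma unitary_mat_adjoint [simp]: "unitary_mat d V \<Longrightarrow> unitary_mat d (mat_adjoint V)"
  by (simp add: unitary_mat_def)

lemma unitary_mat_mult:
  assumes "unitary_mat d V" "unitary_mat d W"
  shows "unitary_mat d (V * W)"
proof -
  have c [simp]: "V \<in> carrier_mat d d" "W \<in> carrier_mat d d"
    "mat_adjoint V \<in> carrier_mat d d" "mat_adjoint W \<in> carrier_mat d d"
    using assms by auto
  have adj: "mat_adjoint (V * W) = mat_adjoint W * mat_adjoint V"
    by (rule mat_adjoint_mult) (rule c)+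
  have "V * W * (mat_adjoint W * mat_adjoint V) = V * (W * (mat_adjoint W * mat_adjoint V))"
    by (rule assoc_mult_mat[of _ d d _ d _ d]; (rule c mult_carrier_mat)+)
  also have "\<dots> = V * (W * mat_adjoint W * mat_adjoint V)"
    by (subst assoc_mult_mat[of W d d _ d _ d]; (rule c refl)+)
  finally have 1: "V * W * mat_adjoint (V * W) = 1\<^sub>m d"
    using assms c unfolding adj unitary_mat_def by simp
  have "mat_adjoint W * mat_adjoint V * (V * W) = mat_adjoint W * (mat_adjoint V * (V * W))"
    by (rule assoc_mult_mat[of _ d d _ d _ d]; (rule c mult_carrier_mat)+)
  also have "\<dots> = mat_adjoint W * (mat_adjoint V * V * W)"
    by (subst assoc_mult_mat[of "mat_adjoint V" d d _ d _ d]; (rule c refl)+)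
  finally have 2: "mat_adjoint (V * W) * (V * W) = 1\<^sub>m d"
    using assms c unfolding adj unitary_mat_def by simp
  show ?thesis using 1 2 mult_carrier_mat[OF c(1,2)] unfolding unitary_mat_def by simp
qed

lemma unitary_mat_cols:
  assumes "unitary_mat d V" "i < d" "j < d"
  shows "(\<Sum>k<d. cnj (V $$ (k, i)) * V $$ (k, j)) = (if i = j then 1 else 0)"
proof -
  have V: "V \<in> carrier_mat d d" using assms by simp
  have "(mat_adjoint V * V) $$ (i, j) = (1\<^sub>m d :: complex mat) $$ (i, j)"
    using assms by (simp add: unitary_mat_def)
  then show ?thesis using V assms(2,3)
    by (simp add: mult_mat_index_sum carrier_matD[OF V] del: index_mult_mat(1))
qed

lemma unitary_mat_rows:
  assumes "unitary_mat d V" "i < d" "j < d"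
  shows "(\<Sum>k<d. V $$ (i, k) * cnj (V $$ (j, k))) = (if i = j then 1 else 0)"
  using unitary_mat_cols[OF unitary_mat_adjoint[OF assms(1)] assms(2,3)]
    carrier_matD[OF unitary_mat_carrier[OF assms(1)]] assms(2,3) by simp

lemma unitary_mat_col_norm:
  assumes "unitary_mat d V" "j < d"
  shows "(\<Sum>k<d. (cmod (V $$ (k, j)))\<^sup>2) = 1"
proof -
  have "(\<Sum>k<d. complex_of_real ((cmod (V $$ (k, j)))\<^sup>2)) = 1"
    using unitary_mat_cols[OF assms assms(2)] by (simp only: complex_norm_square mult.commute) simp
  then show ?thesis by (metis of_real_1 of_real_eq_iff of_real_sum)
qed

lemma unitary_mat_tensor:
  assumes "unitary_mat d V" "unitary_mat e W"
  shows "unitary_mat (d * e) (V \<otimes>\<^sub>m W)"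
proof -
  have "V \<in> carrier_mat d d" "W \<in> carrier_mat e e"
    "mat_adjoint V \<in> carrier_mat d d" "mat_adjoint W \<in> carrier_mat e e"
    using assms by auto
  then show ?thesis
    using assms by (auto simp: unitary_mat_def tensor_mat_adjoint tensor_mat_mult[of _ d d _ e e _ d _ e])
qed

text \<open>The controlled operation that applies \<open>B a\<close> to the second register when the
  first one is in basis state \<open>a\<close>. It lets a later circuit depend on an earlier outcome
  without an intermediate measurement.\<close>

definition block_diag :: "nat \<Rightarrow> nat \<Rightarrow> (nat \<Rightarrow> complex mat) \<Rightarrow> complex mat" where
  "block_diag d e B = mat (d * e) (d * e)
     (\<lambda>(i, j). if i div e = j div e then B (i div e) $$ (i mod e, j mod e) else 0)"

lemma block_diag_carrier [simp]: "block_diag d e B \<in> carrier_mat (d * e) (d * e)"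
  by (simp add: block_diag_def)

lemma block_diag_dim [simp]: "dim_row (block_diag d e B) = d * e" "dim_col (block_diag d e B) = d * e"
  by (simp_all add: block_diag_def)

lemma block_diag_mult:
  assumes "\<And>a. a < d \<Longrightarrow> B a \<in> carrier_mat e e" "\<And>a. a < d \<Longrightarrow> C a \<in> carrier_mat e e"
  shows "block_diag d e B * block_diag d e C = block_diag d e (\<lambda>a. B a * C a)"
proof (intro eq_matI)
  fix i j assume "i < dim_row (block_diag d e (\<lambda>a. B a * C a))" "j < dim_col (block_diag d e (\<lambda>a. B a * C a))"
  then have ij: "i < d * e" "j < d * e" by auto
  then have lt: "i div e < d" "i mod e < e" "j div e < d" "j mod e < e" by auto
  have B: "dim_row (B a) = e" "dim_col (B a) = e" and C: "dim_row (C a) = e" "dim_col (C a) = e"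
    if "a < d" for a using assms[OF that] by auto
  have "(block_diag d e B * block_diag d e C) $$ (i, j) =
     (\<Sum>x<d. \<Sum>y<e. (if i div e = x then B (i div e) $$ (i mod e, y) else 0) *
        (if x = j div e then C x $$ (y, j mod e) else 0))"
    using ij by (subst mult_mat_index_sum)
      (auto simp: sum_lessThan_times mult_less_bound block_diag_def intro!: sum.cong)
  also have "\<dots> = (\<Sum>x<d. if i div e = x then (\<Sum>y<e. B (i div e) $$ (i mod e, y) *
        (if x = j div e then C x $$ (y, j mod e) else 0)) else 0)"
    by (intro sum.cong) auto
  also have "\<dots> = (\<Sum>y<e. B (i div e) $$ (i mod e, y) *
        (if i div e = j div e then C (i div e) $$ (y, j mod e) else 0))"
    using lt by simp
  also have "\<dots> = block_diag d e (\<lambda>a. B a * C a) $$ (i, j)"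
    using ij lt B C by (auto simp: block_diag_def mult_mat_index_sum simp del: index_mult_mat(1))
  finally show "(block_diag d e B * block_diag d e C) $$ (i, j) = block_diag d e (\<lambda>a. B a * C a) $$ (i, j)" .
qed auto

lemma block_diag_adjoint:
  assumes "\<And>a. a < d \<Longrightarrow> B a \<in> carrier_mat e e"
  shows "mat_adjoint (block_diag d e B) = block_diag d e (\<lambda>a. mat_adjoint (B a))"
proof (intro eq_matI)
  fix i j assume "i < dim_row (block_diag d e (\<lambda>a. mat_adjoint (B a)))"
    "j < dim_col (block_diag d e (\<lambda>a. mat_adjoint (B a)))"
  then have ij: "i < d * e" "j < d * e" by auto
  then have lt: "i div e < d" "i mod e < e" "j div e < d" "j mod e < e" by auto
  have B: "dim_row (B a) = e" "dim_col (B a) = e" if "a < d" for a using assms[OF that] by auto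
  show "mat_adjoint (block_diag d e B) $$ (i, j) = block_diag d e (\<lambda>a. mat_adjoint (B a)) $$ (i, j)"
    using ij lt B by (auto simp: block_diag_def)
qed auto

lemma block_diag_cong: "(\<And>a. a < d \<Longrightarrow> B a = C a) \<Longrightarrow> block_diag d e B = block_diag d e C"
  unfolding block_diag_def by (intro cong_mat) auto

lemma block_diag_const: "B \<in> carrier_mat e e \<Longrightarrow> block_diag d e (\<lambda>_. B) = 1\<^sub>m d \<otimes>\<^sub>m B"
  by (intro eq_matI) (auto simp: block_diag_def)

lemma unitary_mat_block_diag:
  assumes "\<And>a. a < d \<Longrightarrow> unitary_mat e (B a)"
  shows "unitary_mat (d * e) (block_diag d e B)"
proof -
  have c: "B a \<in> carrier_mat e e" "mat_adjoint (B a) \<in> carrier_mat e e" if "a < d" for a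
    using assms[OF that] by auto
  have "block_diag d e (\<lambda>a. B a * mat_adjoint (B a)) = 1\<^sub>m (d * e)"
    "block_diag d e (\<lambda>a. mat_adjoint (B a) * B a) = 1\<^sub>m (d * e)"
    using assms block_diag_cong[of d "\<lambda>a. B a * mat_adjoint (B a)" "\<lambda>_. 1\<^sub>m e"]
      block_diag_cong[of d "\<lambda>a. mat_adjoint (B a) * B a" "\<lambda>_. 1\<^sub>m e"]
    by (simp_all add: unitary_mat_def block_diag_const)
  then show ?thesis
    using c by (simp add: unitary_mat_def block_diag_adjoint block_diag_mult)
qed

section \<open>Circuits with access to a phase oracle\<close>

definition cdiag :: "nat \<Rightarrow> (nat \<Rightarrow> complex) \<Rightarrow> complex mat" where
  "cdiag d f = mat d d (\<lambda>(i, j). if i = j then f i else 0)"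

lemma cdiag_carrier [simp]: "cdiag d f \<in> carrier_mat d d"
  by (simp add: cdiag_def)

lemma cdiag_dim [simp]: "dim_row (cdiag d f) = d" "dim_col (cdiag d f) = d"
  by (simp_all add: cdiag_def)

lemma cdiag_index: "i < d \<Longrightarrow> j < d \<Longrightarrow> cdiag d f $$ (i, j) = (if i = j then f i else 0)"
  by (simp add: cdiag_def)

lemma cdiag_one [simp]: "cdiag d (\<lambda>_. 1) = 1\<^sub>m d"
  by (intro eq_matI) (auto simp: cdiag_def)

lemma cdiag_mult_index:
  assumes "A \<in> carrier_mat d n" "i < d" "j < n"
  shows "(cdiag d f * A) $$ (i, j) = f i * A $$ (i, j)"
proof -
  have "(cdiag d f * A) $$ (i, j) = (\<Sum>k<d. cdiag d f $$ (i, k) * A $$ (k, j))"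
    using assms by (subst mult_mat_index_sum) auto
  also have "\<dots> = (\<Sum>k<d. if k = i then f i * A $$ (i, j) else 0)"
    using assms(2) by (intro sum.cong) (auto simp: cdiag_index)
  also have "\<dots> = f i * A $$ (i, j)" using assms(2) by simp
  finally show ?thesis .
qed

lemma cdiag_tensor_one: "cdiag d f \<otimes>\<^sub>m 1\<^sub>m e = cdiag (d * e) (\<lambda>k. f (k div e))"
proof (intro eq_matI)
  fix i j assume "i < dim_row (cdiag (d * e) (\<lambda>k. f (k div e)))" "j < dim_col (cdiag (d * e) (\<lambda>k. f (k div e)))"
  then show "(cdiag d f \<otimes>\<^sub>m 1\<^sub>m e) $$ (i, j) = cdiag (d * e) (\<lambda>k. f (k div e)) $$ (i, j)"
    using divmod_nat_eq_iff[of i j e] by (auto simp: cdiag_index simp del: mod_less div_less)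
qed simp_all

lemma block_diag_cdiag: "block_diag d e (\<lambda>a. cdiag e (f a)) = cdiag (d * e) (\<lambda>k. f (k div e) (k mod e))"
proof (intro eq_matI)
  fix i j assume "i < dim_row (cdiag (d * e) (\<lambda>k. f (k div e) (k mod e)))"
    "j < dim_col (cdiag (d * e) (\<lambda>k. f (k div e) (k mod e)))"
  then show "block_diag d e (\<lambda>a. cdiag e (f a)) $$ (i, j) = cdiag (d * e) (\<lambda>k. f (k div e) (k mod e)) $$ (i, j)"
    using divmod_nat_eq_iff[of i j e]
    by (auto simp: block_diag_def cdiag_index simp del: mod_less div_less)
qed simp_all

lemma cdiag_adjoint: "mat_adjoint (cdiag d f) = cdiag d (\<lambda>i. cnj (f i))"
  by (intro eq_matI) (auto simp: cdiag_index)

lemma cdiag_mult: "cdiag d f * cdiag d g = cdiag d (\<lambda>i. f i * g i)"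
proof (intro eq_matI)
  fix i j assume "i < dim_row (cdiag d (\<lambda>i. f i * g i))" "j < dim_col (cdiag d (\<lambda>i. f i * g i))"
  then show "(cdiag d f * cdiag d g) $$ (i, j) = cdiag d (\<lambda>i. f i * g i) $$ (i, j)"
    using cdiag_mult_index[of "cdiag d g" d d i j f] by (simp add: cdiag_index)
qed simp_all

lemma unitary_mat_cdiag: "(\<And>i. i < d \<Longrightarrow> cmod (f i) = 1) \<Longrightarrow> unitary_mat d (cdiag d f)"
proof (rule unitary_matI)
  fix i j assume "\<And>i. i < d \<Longrightarrow> cmod (f i) = 1" and ij: "i < d" "j < d"
  then have "f j * cnj (f j) = 1" using complex_norm_square[of "f j"] by simp
  then show "(\<Sum>k<d. cdiag d f $$ (i, k) * cnj (cdiag d f $$ (j, k))) = (if i = j then 1 else 0)"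
    using ij by (simp add: cdiag_index if_distrib[of cnj] if_distrib[of "\<lambda>x. _ * x"] cong: if_cong)
qed simp

definition phase_diag :: "nat \<Rightarrow> (nat \<Rightarrow> nat) \<Rightarrow> (nat \<Rightarrow> int) \<Rightarrow> (nat \<Rightarrow> real) \<Rightarrow> complex mat" where
  "phase_diag d i s \<phi> = cdiag d (\<lambda>a. cis (of_int (s a) * \<phi> (i a)))"

lemma phase_diag_carrier [simp]: "phase_diag d i s \<phi> \<in> carrier_mat d d"
  by (simp add: phase_diag_def)

lemma unitary_phase_diag [simp]: "unitary_mat d (phase_diag d i s \<phi>)"
  unfolding phase_diag_def by (rule unitary_mat_cdiag) simp

text \<open>A circuit on basis states \<open>0, \<dots>, d - 1\<close> may multiply the basis state \<open>a\<close> by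
  the phase of index \<open>i a < m\<close>, by its inverse, or by \<open>1\<close>. The number of such queries is \<open>T\<close>.\<close>
inductive phase_circuit :: "nat \<Rightarrow> nat \<Rightarrow> nat \<Rightarrow> ((nat \<Rightarrow> real) \<Rightarrow> complex mat) \<Rightarrow> bool"
  for m d :: nat where
  Free: "unitary_mat d V \<Longrightarrow> phase_circuit m d 0 (\<lambda>_. V)"
| Query: "phase_circuit m d T A \<Longrightarrow> unitary_mat d V \<Longrightarrow> (\<And>a. i a < m) \<Longrightarrow> (\<And>a. s a \<in> {-1, 0, 1}) \<Longrightarrow>
    phase_circuit m d (Suc T) (\<lambda>\<phi>. V * (phase_diag d i s \<phi> * A \<phi>))"

lemma phase_circuit_unitary: "phase_circuit m d T A \<Longrightarrow> unitary_mat d (A \<phi>)"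
  by (induction rule: phase_circuit.induct) (auto intro!: unitary_mat_mult)

lemma phase_circuit_carrier: "phase_circuit m d T A \<Longrightarrow> A \<phi> \<in> carrier_mat d d"
  using phase_circuit_unitary unitary_mat_carrier by blast

text \<open>The last factor applied in any circuit is a free unitary, and \<open>W\<close> merges
  into it.\<close>

lemma phase_circuit_left_mult:
  assumes "phase_circuit m d T A" "unitary_mat d W"
  shows "phase_circuit m d T (\<lambda>\<phi>. W * A \<phi>)"
  using assms(1)
proof cases
  case (Free V)
  then show ?thesis
    using phase_circuit.Free[OF unitary_mat_mult[OF assms(2), of V]] by simp
next
  case (Query T' A' V i s)
  have "W * A \<phi> = (W * V) * (phase_diag d i s \<phi> * A' \<phi>)" for \<phi>
    unfolding Query
    by (rule assoc_mult_mat[symmetric, of _ d d _ d _ d])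
      (use Query assms phase_circuit_carrier[OF Query(3), of \<phi>] in \<open>auto intro!: mult_carrier_mat\<close>)
  then show ?thesis
    using phase_circuit.Query[OF Query(3) unitary_mat_mult[OF assms(2) Query(4)] Query(5,6)] Query(1)
    by simp
qed

lemma phase_circuit_comp:
  assumes "phase_circuit m d T B" "phase_circuit m d T' A"
  shows "phase_circuit m d (T + T') (\<lambda>\<phi>. B \<phi> * A \<phi>)"
  using assms(1)
proof (induction rule: phase_circuit.induct)
  case (Free V)
  then show ?case using phase_circuit_left_mult[OF assms(2)] by simp
next
  case (Query T B V i s)
  have "V * (phase_diag d i s \<phi> * B \<phi>) * A \<phi> = V * (phase_diag d i s \<phi> * (B \<phi> * A \<phi>))" for \<phi>
  proof -
    have c: "B \<phi> \<in> carrier_mat d d" "A \<phi> \<in> carrier_mat d d" "V \<in> carrier_mat d d"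
      using phase_circuit_carrier Query assms by auto
    have "V * (phase_diag d i s \<phi> * B \<phi>) * A \<phi> = V * (phase_diag d i s \<phi> * B \<phi> * A \<phi>)"
      by (rule assoc_mult_mat[of _ d d _ d _ d]; (rule c mult_carrier_mat phase_diag_carrier)+)
    also have "phase_diag d i s \<phi> * B \<phi> * A \<phi> = phase_diag d i s \<phi> * (B \<phi> * A \<phi>)"
      by (rule assoc_mult_mat[of _ d d _ d _ d]; (rule c phase_diag_carrier)+)
    finally show ?thesis .
  qed
  then show ?case using phase_circuit.Query[OF Query(5,2,3,4)] by simp
qed

text \<open>Reversing the product and negating \<open>s\<close> gives a circuit again, because the
  set of allowed signs is symmetric. Amplitude amplification needs this.\<close>

lemma phase_circuit_adjoint:
  assumes "phase_circuit m d T A"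
  shows "phase_circuit m d T (\<lambda>\<phi>. mat_adjoint (A \<phi>))"
  using assms
proof (induction rule: phase_circuit.induct)
  case (Free V)
  then show ?case using phase_circuit.Free[of d "mat_adjoint V"] by simp
next
  case (Query T A V i s)
  have "mat_adjoint (V * (phase_diag d i s \<phi> * A \<phi>)) =
      mat_adjoint (A \<phi>) * (1\<^sub>m d * (phase_diag d i (\<lambda>a. - s a) \<phi> * mat_adjoint V))" for \<phi>
  proof -
    have c: "A \<phi> \<in> carrier_mat d d" "V \<in> carrier_mat d d"
      using phase_circuit_carrier Query by auto
    have p: "mat_adjoint (phase_diag d i s \<phi>) = phase_diag d i (\<lambda>a. - s a) \<phi>"
      by (simp add: phase_diag_def cdiag_adjoint cis_cnj)
    have "mat_adjoint (V * (phase_diag d i s \<phi> * A \<phi>)) =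
        mat_adjoint (phase_diag d i s \<phi> * A \<phi>) * mat_adjoint V"
      by (rule mat_adjoint_mult[of _ d d _ d]; (rule c mult_carrier_mat phase_diag_carrier)+)
    also have "mat_adjoint (phase_diag d i s \<phi> * A \<phi>) =
        mat_adjoint (A \<phi>) * phase_diag d i (\<lambda>a. - s a) \<phi>"
      unfolding p[symmetric] by (rule mat_adjoint_mult[of _ d d _ d]; (rule c phase_diag_carrier)+)
    also have "mat_adjoint (A \<phi>) * phase_diag d i (\<lambda>a. - s a) \<phi> * mat_adjoint V =
        mat_adjoint (A \<phi>) * (phase_diag d i (\<lambda>a. - s a) \<phi> * mat_adjoint V)"
      by (rule assoc_mult_mat[of _ d d _ d _ d]; (rule c mat_adjoint_carrier phase_diag_carrier)+)
    also have "phase_diag d i (\<lambda>a. - s a) \<phi> * mat_adjoint V \<in> carrier_mat d d"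
      by (rule c mult_carrier_mat mat_adjoint_carrier phase_diag_carrier)+
    note left_mult_one_mat[OF this, symmetric]
    finally show ?thesis .
  qed
  moreover have "phase_circuit m d 1 (\<lambda>\<phi>. 1\<^sub>m d * (phase_diag d i (\<lambda>a. - s a) \<phi> * mat_adjoint V))"
    using phase_circuit.Query[OF phase_circuit.Free[of d "mat_adjoint V" m] unitary_mat_one, of i "\<lambda>a. - s a"]
      Query by auto
  ultimately show ?case using phase_circuit_comp[OF Query(5)] by fastforce
qed

text \<open>Queries with \<open>s = 0\<close> are identities and serve as padding;
  \<open>0 < m\<close> provides an index for them. Padding gives two branches the same number of
  queries.\<close>

lemma phase_circuit_mono:
  assumes "phase_circuit m d T A" "T \<le> T'" "0 < m"
  shows "phase_circuit m d T' A"
  using assms(2)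
proof (induction T' rule: dec_induct)
  case (step T')
  have "phase_diag d (\<lambda>_. 0) (\<lambda>_. 0) \<phi> = 1\<^sub>m d" for \<phi>
    by (simp add: phase_diag_def)
  moreover have "1\<^sub>m d * (1\<^sub>m d * A \<phi>) = A \<phi>" for \<phi>
    by (simp add: left_mult_one_mat[OF phase_circuit_carrier[OF step(3)]])
  ultimately show ?case
    using phase_circuit.Query[OF step(3) unitary_mat_one, of "\<lambda>_. 0" "\<lambda>_. 0"] assms(3) by simp
qed (rule assms)

lemma phase_circuit_tensor_one:
  assumes "phase_circuit m d T A"
  shows "phase_circuit m (d * e) T (\<lambda>\<phi>. A \<phi> \<otimes>\<^sub>m 1\<^sub>m e)"
  using assms
proof (induction rule: phase_circuit.induct)
  case (Free V)
  then show ?case using phase_circuit.Free[OF unitary_mat_tensor] by simp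
next
  case (Query T A V i s)
  have p: "phase_diag d i s \<phi> \<otimes>\<^sub>m 1\<^sub>m e = phase_diag (d * e) (\<lambda>k. i (k div e)) (\<lambda>k. s (k div e)) \<phi>" for \<phi>
    by (simp add: phase_diag_def cdiag_tensor_one)
  have "(V * (phase_diag d i s \<phi> * A \<phi>)) \<otimes>\<^sub>m 1\<^sub>m e =
     (V \<otimes>\<^sub>m 1\<^sub>m e) * ((phase_diag d i s \<phi> \<otimes>\<^sub>m 1\<^sub>m e) * (A \<phi> \<otimes>\<^sub>m 1\<^sub>m e))" for \<phi>
  proof -
    have c: "A \<phi> \<in> carrier_mat d d" "V \<in> carrier_mat d d"
      using phase_circuit_carrier Query by auto
    then have "phase_diag d i s \<phi> * A \<phi> \<in> carrier_mat d d" by (meson mult_carrier_mat phase_diag_carrier)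
    then show ?thesis using c
      by (simp add: tensor_mat_mult[of _ d d _ e e _ d _ e])
  qed
  then show ?case
    using phase_circuit.Query[OF Query(5) unitary_mat_tensor[OF Query(2) unitary_mat_one[of e]],
        of "\<lambda>k. i (k div e)" "\<lambda>k. s (k div e)"] Query(3,4) by (simp add: p)
qed

text \<open>All blocks make the same number of queries, so their queries at the same position fuse
  into one whose index and sign also depend on the block. Branching therefore costs one branch and
  not the sum of all. The induction on \<open>T\<close> strips one query from every block at
  once.\<close>

lemma phase_circuit_block_diag:
  assumes "\<And>a. phase_circuit m e T (B a)"
  shows "phase_circuit m (d * e) T (\<lambda>\<phi>. block_diag d e (\<lambda>a. B a \<phi>))"
  using assms
proof (induction T arbitrary: B)
  case 0
  have "\<exists>V. B a = (\<lambda>_. V) \<and> unitary_mat e V" for a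
    using 0[of a] by cases auto
  then obtain V where "\<And>a. B a = (\<lambda>_. V a)" "\<And>a. unitary_mat e (V a)" by metis
  then show ?case using phase_circuit.Free[OF unitary_mat_block_diag[of d e V]] by simp
next
  case (Suc T)
  have "\<forall>a. \<exists>A V i s. B a = (\<lambda>\<phi>. V * (phase_diag e i s \<phi> * A \<phi>)) \<and> phase_circuit m e T A \<and>
     unitary_mat e V \<and> (\<forall>a. i a < m) \<and> (\<forall>a. s a \<in> {-1, 0, 1})"
  proof
    fix a
    show "\<exists>A V i s. B a = (\<lambda>\<phi>. V * (phase_diag e i s \<phi> * A \<phi>)) \<and> phase_circuit m e T A \<and>
       unitary_mat e V \<and> (\<forall>a. i a < m) \<and> (\<forall>a. s a \<in> {-1, 0, 1})"
      using Suc(2)[of a]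
    proof cases
      case (Query A V i s)
      then show ?thesis by (intro exI[of _ A] exI[of _ V] exI[of _ i] exI[of _ s]) simp
    qed
  qed
  then obtain A V i s where "\<forall>a. B a = (\<lambda>\<phi>. V a * (phase_diag e (i a) (s a) \<phi> * A a \<phi>)) \<and>
     phase_circuit m e T (A a) \<and> unitary_mat e (V a) \<and> (\<forall>k. i a k < m) \<and>
     (\<forall>k. s a k \<in> {-1, 0, 1 :: int})"
    unfolding choice_iff by (elim exE)
  then have B: "\<And>a. B a = (\<lambda>\<phi>. V a * (phase_diag e (i a) (s a) \<phi> * A a \<phi>))"
    "\<And>a. phase_circuit m e T (A a)" "\<And>a. unitary_mat e (V a)"
    "\<And>a k. i a k < m" "\<And>a k. s a k \<in> {-1, 0, 1 :: int}" by blast+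
  have p: "block_diag d e (\<lambda>a. phase_diag e (i a) (s a) \<phi>) =
      phase_diag (d * e) (\<lambda>k. i (k div e) (k mod e)) (\<lambda>k. s (k div e) (k mod e)) \<phi>" for \<phi>
    by (simp add: phase_diag_def block_diag_cdiag)
  have "block_diag d e (\<lambda>a. B a \<phi>) = block_diag d e V *
     (phase_diag (d * e) (\<lambda>k. i (k div e) (k mod e)) (\<lambda>k. s (k div e) (k mod e)) \<phi> *
       block_diag d e (\<lambda>a. A a \<phi>))" for \<phi>
  proof -
    have c: "A a \<phi> \<in> carrier_mat e e" "V a \<in> carrier_mat e e" for a
      using phase_circuit_carrier[OF B(2)] B(3) by simp_all
    then have "phase_diag e (i a) (s a) \<phi> * A a \<phi> \<in> carrier_mat e e" for a
      by (meson mult_carrier_mat phase_diag_carrier)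
    then show ?thesis using c unfolding p[symmetric]
      by (simp add: block_diag_mult B(1))
  qed
  then show ?case
    using phase_circuit.Query[OF Suc(1)[OF B(2)] unitary_mat_block_diag[of d e V],
        of "\<lambda>k. i (k div e) (k mod e)" "\<lambda>k. s (k div e) (k mod e)"] B by simp
qed

section \<open>Sampling from the measurement outcomes of a circuit\<close>

abbreviation weight :: "nat \<Rightarrow> complex mat \<Rightarrow> (nat \<Rightarrow> bool) \<Rightarrow> real" where
  "weight d V G \<equiv> \<Sum>a<d. if G a then (cmod (V $$ (a, 0)))\<^sup>2 else 0"

text \<open>The circuit starts in the basis state \<open>0\<close>, so that its final state is column \<open>0\<close>. Then
  \<open>P \<phi> S\<close> is the probability that the label of the measured basis state is in \<open>S\<close>.\<close>
definition samples :: "nat \<Rightarrow> nat \<Rightarrow> ((nat \<Rightarrow> real) \<Rightarrow> 'o set \<Rightarrow> real) \<Rightarrow> bool" where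
  "samples m T P \<longleftrightarrow> (\<exists>d A (val :: nat \<Rightarrow> 'o). 0 < d \<and> phase_circuit m d T A \<and>
     (\<forall>\<phi> S. P \<phi> S = weight d (A \<phi>) (\<lambda>a. val a \<in> S)))"

lemma samplesI:
  assumes "0 < d" "phase_circuit m d T A"
    "\<And>\<phi> S. P \<phi> S = weight d (A \<phi>) (\<lambda>a. val a \<in> S)"
  shows "samples m T P"
  unfolding samples_def using assms by blast

text \<open>Only the acceptance probability is kept, as a function of the phases, so that
  amplification and disjunction become operations on such functions.\<close>

definition tester :: "nat \<Rightarrow> nat \<Rightarrow> ((nat \<Rightarrow> real) \<Rightarrow> real) \<Rightarrow> bool" where
  "tester m T p \<longleftrightarrow> (\<exists>d A (G :: nat \<Rightarrow> bool). 0 < d \<and> phase_circuit m d T A \<and>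
     (\<forall>\<phi>. p \<phi> = weight d (A \<phi>) G))"

lemma testerI:
  assumes "0 < d" "phase_circuit m d T A"
    "\<And>\<phi>. p \<phi> = weight d (A \<phi>) G"
  shows "tester m T p"
  unfolding tester_def using assms by blast

lemma samples_mono: "samples m T P \<Longrightarrow> T \<le> T' \<Longrightarrow> 0 < m \<Longrightarrow> samples m T' P"
  unfolding samples_def using phase_circuit_mono by blast

lemma tester_cong: "tester m T p \<Longrightarrow> (\<And>\<phi>. p \<phi> = q \<phi>) \<Longrightarrow> tester m T q"
  unfolding tester_def by simp

lemma samples_tester: "samples m T P \<Longrightarrow> tester m T (\<lambda>\<phi>. P \<phi> S)"
proof -
  assume "samples m T P"
  then obtain d A val where "0 < d" "phase_circuit m d T A"
    "\<And>\<phi> S. P \<phi> S = weight d (A \<phi>) (\<lambda>a. val a \<in> S)"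
    unfolding samples_def by blast
  then show ?thesis by (intro testerI[of d m T A _ "\<lambda>a. val a \<in> S"]) simp_all
qed

lemma tester_range:
  assumes "tester m T p"
  shows "0 \<le> p \<phi>" "p \<phi> \<le> 1"
proof -
  from assms obtain d A G where d: "0 < d" "phase_circuit m d T A"
    "p \<phi> = weight d (A \<phi>) G"
    unfolding tester_def by blast
  then show "0 \<le> p \<phi>" by (auto intro!: sum_nonneg)
  have "p \<phi> \<le> (\<Sum>a<d. (cmod (A \<phi> $$ (a, 0)))\<^sup>2)" unfolding d(3) by (intro sum_mono) auto
  also have "\<dots> = 1" using d unitary_mat_col_norm phase_circuit_unitary by blast
  finally show "p \<phi> \<le> 1" .
qed

lemma samples_range:
  assumes "samples m T P"
  shows "0 \<le> P \<phi> S" "P \<phi> S \<le> 1"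
  using tester_range[OF samples_tester[OF assms, of S]] by auto

lemma samples_const:
  assumes "0 < m"
  shows "samples m T (\<lambda>\<phi> S. if x \<in> S then 1 else 0)"
  using phase_circuit_mono[OF phase_circuit.Free[OF unitary_mat_one[of 1]], of T m] assms
  by (intro samplesI[of 1 _ _ "\<lambda>_. 1\<^sub>m 1" _ "\<lambda>_. x"]) auto

text \<open>An idle register of dimension \<open>e\<close> stays in basis state \<open>0\<close>. It
  brings two branches to a common dimension.\<close>

lemma samples_dim_mult:
  fixes P :: "(nat \<Rightarrow> real) \<Rightarrow> 'o set \<Rightarrow> real"
  assumes "0 < d" "phase_circuit m d T A" "0 < e"
    "\<And>\<phi> S. P \<phi> S = weight d (A \<phi>) (\<lambda>a. val a \<in> S)"
  shows "phase_circuit m (d * e) T (\<lambda>\<phi>. A \<phi> \<otimes>\<^sub>m 1\<^sub>m e)"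
    "P \<phi> S = weight (d * e) (A \<phi> \<otimes>\<^sub>m 1\<^sub>m e) (\<lambda>k. val (k div e) \<in> S)"
proof -
  show "phase_circuit m (d * e) T (\<lambda>\<phi>. A \<phi> \<otimes>\<^sub>m 1\<^sub>m e)"
    using assms(2) by (rule phase_circuit_tensor_one)
  have A: "A \<phi> \<in> carrier_mat d d" using assms phase_circuit_carrier by blast
  have "weight (d * e) (A \<phi> \<otimes>\<^sub>m 1\<^sub>m e) (\<lambda>k. val (k div e) \<in> S) =
     (\<Sum>a<d. \<Sum>b<e. if b = 0 then (if val a \<in> S then (cmod (A \<phi> $$ (a, 0)))\<^sup>2 else 0) else 0)"
    unfolding sum_lessThan_times
    using assms A by (intro sum.cong refl) (auto simp: mult_less_bound)
  also have "\<dots> = P \<phi> S" using assms(3) by (simp add: assms(4))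
  finally show "P \<phi> S =
     (weight (d * e) (A \<phi> \<otimes>\<^sub>m 1\<^sub>m e) (\<lambda>k. val (k div e) \<in> S))" ..
qed

text \<open>Deferred measurement: after \<open>A\<close> the first register only controls, and the
  chosen branch acts on the second. An entry of the final state is thus a product of two amplitudes,
  and the probabilities are those of measuring the first register in between.\<close>

lemma samples_if:
  fixes P Q :: "(nat \<Rightarrow> real) \<Rightarrow> 'o set \<Rightarrow> real"
  assumes "tester m T p" "samples m T' P" "samples m T' Q"
  shows "samples m (T + T') (\<lambda>\<phi> S. p \<phi> * P \<phi> S + (1 - p \<phi>) * Q \<phi> S)"
proof -
  obtain d A G where A: "0 < d" "phase_circuit m d T A"
    "\<And>\<phi>. p \<phi> = weight d (A \<phi>) G"
    using assms(1) unfolding tester_def by blast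
  obtain d1 B1 v1 where B1: "0 < d1" "phase_circuit m d1 T' B1"
    "\<And>\<phi> S. P \<phi> S = weight d1 (B1 \<phi>) (\<lambda>a. v1 a \<in> S)"
    using assms(2) unfolding samples_def by blast
  obtain d2 B2 v2 where B2: "0 < d2" "phase_circuit m d2 T' B2"
    "\<And>\<phi> S. Q \<phi> S = weight d2 (B2 \<phi>) (\<lambda>a. v2 a \<in> S)"
    using assms(3) unfolding samples_def by blast
  define e where "e = d1 * d2"
  have e: "0 < e" using B1 B2 by (simp add: e_def)
  note C1 = samples_dim_mult[OF B1(1,2) B2(1) B1(3)]
  note C2 = samples_dim_mult[OF B2(1,2) B1(1) B2(3)]
  define C where "C a \<phi> = (if G a then B1 \<phi> \<otimes>\<^sub>m 1\<^sub>m d2 else B2 \<phi> \<otimes>\<^sub>m 1\<^sub>m d1)" for a \<phi>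
  define val where "val a b = (if G a then v1 (b div d2) else v2 (b div d1))" for a b
  have C: "phase_circuit m e T' (C a)" for a
    using C1(1) C2(1) by (cases "G a") (simp_all add: C_def[abs_def] e_def mult.commute)
  have C_out: "weight e (C a \<phi>) (\<lambda>b. val a b \<in> S) =
      (if G a then P \<phi> S else Q \<phi> S)" for a S \<phi>
    unfolding C1(2) C2(2) by (simp add: C_def val_def e_def mult.commute cong: if_cong)
  define D where "D \<phi> = block_diag d e (\<lambda>a. C a \<phi>) * (A \<phi> \<otimes>\<^sub>m 1\<^sub>m e)" for \<phi>
  have "phase_circuit m (d * e) (T' + T) D"
    unfolding D_def
    using phase_circuit_comp[OF phase_circuit_block_diag[OF C] phase_circuit_tensor_one[OF A(2)]] .
  moreover have D_index: "D \<phi> $$ (a * e + b, 0) = C a \<phi> $$ (b, 0) * A \<phi> $$ (a, 0)"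
    if "a < d" "b < e" for a b \<phi>
  proof -
    have cA: "A \<phi> \<in> carrier_mat d d" using A phase_circuit_carrier by blast
    have "D \<phi> $$ (a * e + b, 0) = (\<Sum>x<d. \<Sum>y<e. block_diag d e (\<lambda>a. C a \<phi>) $$ (a * e + b, x * e + y) *
        (A \<phi> \<otimes>\<^sub>m 1\<^sub>m e) $$ (x * e + y, 0))"
      unfolding D_def using A(1) e that cA
      by (subst mult_mat_index_sum) (auto simp: sum_lessThan_times mult_less_bound)
    also have "\<dots> = (\<Sum>x<d. \<Sum>y<e. if y = 0 then (if x = a then C a \<phi> $$ (b, 0) * A \<phi> $$ (a, 0) else 0) else 0)"
      using A(1) e that cA by (intro sum.cong refl) (auto simp: block_diag_def mult_less_bound)
    also have "\<dots> = C a \<phi> $$ (b, 0) * A \<phi> $$ (a, 0)" using e that by simp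
    finally show ?thesis .
  qed
  moreover have "p \<phi> * P \<phi> S + (1 - p \<phi>) * Q \<phi> S =
     (weight (d * e) (D \<phi>) (\<lambda>k. val (k div e) (k mod e) \<in> S))" for \<phi> S
  proof -
    have "weight (d * e) (D \<phi>) (\<lambda>k. val (k div e) (k mod e) \<in> S) =
      (\<Sum>a<d. (cmod (A \<phi> $$ (a, 0)))\<^sup>2 * (weight e (C a \<phi>) (\<lambda>b. val a b \<in> S)))"
      unfolding sum_lessThan_times sum_distrib_left
      by (intro sum.cong refl) (simp add: D_index norm_mult power_mult_distrib)
    also have "\<dots> = (\<Sum>a<d. (if G a then (cmod (A \<phi> $$ (a, 0)))\<^sup>2 else 0) * P \<phi> S +
        ((cmod (A \<phi> $$ (a, 0)))\<^sup>2 - (if G a then (cmod (A \<phi> $$ (a, 0)))\<^sup>2 else 0)) * Q \<phi> S)"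
      unfolding C_out by (intro sum.cong refl) auto
    also have "\<dots> = p \<phi> * P \<phi> S + (1 - p \<phi>) * Q \<phi> S"
      using unitary_mat_col_norm[OF phase_circuit_unitary[OF A(2)] A(1)]
      by (simp add: sum.distrib sum_subtractf A(3) flip: sum_distrib_right)
    finally show ?thesis ..
  qed
  ultimately show ?thesis
    using A(1) e by (intro samplesI[of "d * e" m _ D _ "\<lambda>k. val (k div e) (k mod e)"])
      (auto simp: add.commute)
qed

lemma tester_samples: "tester m T p \<Longrightarrow> 0 < m \<Longrightarrow>
   samples m T (\<lambda>\<phi> S. p \<phi> * (if True \<in> S then 1 else 0) + (1 - p \<phi>) * (if False \<in> S then 1 else 0))"
  using samples_if[of m T p 0, OF _ samples_const[of m 0 True] samples_const[of m 0 False]] by simp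

text \<open>The second test is run only when the first one rejects; otherwise the constant answer
  \<open>True\<close> takes its place.\<close>

lemma tester_or:
  assumes "tester m T p" "tester m T' q" "0 < m"
  shows "tester m (T + T') (\<lambda>\<phi>. p \<phi> + (1 - p \<phi>) * q \<phi>)"
  using samples_tester[OF samples_if[OF assms(1) samples_const[of m T' True] tester_samples[OF assms(2)]],
      of "{True}"] assms(3) by simp

text \<open>One round of amplitude amplification. Let \<open>\<psi>\<close> be the final state of
  \<open>A\<close>. Conjugated with \<open>A\<close>, the sign flip \<open>z\<close> of basis state
  \<open>0\<close> becomes the reflection that subtracts twice the component along
  \<open>\<psi>\<close>. The sign flip \<open>r\<close> of the accepted states has expectation
  \<open>1 - 2 * p\<close> in \<open>\<psi>\<close>. An accepted entry is therefore multiplied by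
  \<open>- 1 - 2 * (1 - 2 * p) = - (3 - 4 * p)\<close>.\<close>

lemma tester_triple:
  assumes "tester m T p"
  shows "tester m (3 * T) (\<lambda>\<phi>. p \<phi> * (3 - 4 * p \<phi>)\<^sup>2)"
proof -
  obtain d A G where A: "0 < d" "phase_circuit m d T A"
    "\<And>\<phi>. p \<phi> = weight d (A \<phi>) G"
    using assms unfolding tester_def by blast
  define r :: "nat \<Rightarrow> complex" where "r a = (if G a then - 1 else 1)" for a
  define z :: "nat \<Rightarrow> complex" where "z a = (if a = 0 then - 1 else 1)" for a
  define B where "B \<phi> = A \<phi> * (cdiag d z * (mat_adjoint (A \<phi>) * (cdiag d r * A \<phi>)))" for \<phi>
  have "unitary_mat d (cdiag d r)" "unitary_mat d (cdiag d z)"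
    by (auto intro!: unitary_mat_cdiag simp: r_def z_def)
  then have "phase_circuit m d (T + (T + T)) B"
    unfolding B_def
    by (intro phase_circuit_comp phase_circuit_left_mult phase_circuit_adjoint A(2))
  moreover have "B \<phi> $$ (a, 0) = (r a - 2 * (1 - 2 * complex_of_real (p \<phi>))) * A \<phi> $$ (a, 0)"
    if a: "a < d" for a \<phi>
  proof -
    have c: "A \<phi> \<in> carrier_mat d d" and u: "unitary_mat d (A \<phi>)"
      using A(2) phase_circuit_carrier phase_circuit_unitary by blast+
    then have c1: "cdiag d r * A \<phi> \<in> carrier_mat d d" by (meson mult_carrier_mat cdiag_carrier)
    then have c2: "mat_adjoint (A \<phi>) * (cdiag d r * A \<phi>) \<in> carrier_mat d d"
      using c by (meson mult_carrier_mat mat_adjoint_carrier)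
    then have c3: "cdiag d z * (mat_adjoint (A \<phi>) * (cdiag d r * A \<phi>)) \<in> carrier_mat d d"
      by (meson mult_carrier_mat cdiag_carrier)
    have dA: "dim_row (A \<phi>) = d" "dim_col (A \<phi>) = d" using c by auto
    define w where "w j = (\<Sum>k<d. cnj (A \<phi> $$ (k, j)) * (r k * A \<phi> $$ (k, 0)))" for j
    have w: "(mat_adjoint (A \<phi>) * (cdiag d r * A \<phi>)) $$ (j, 0) = w j" if "j < d" for j
      using that c1 dA A(1) cdiag_mult_index[OF c, of _ 0 r] unfolding w_def
      by (subst mult_mat_index_sum) (auto intro!: sum.cong simp del: index_mult_mat(1))
    \<comment> \<open>The expectation of the sign flip \<open>r\<close> in the final state of
      \<open>A\<close>.\<close>
    have w0: "w 0 = 1 - 2 * complex_of_real (p \<phi>)"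
    proof -
      have "w 0 = (\<Sum>k<d. complex_of_real ((cmod (A \<phi> $$ (k, 0)))\<^sup>2) -
          2 * complex_of_real (if G k then (cmod (A \<phi> $$ (k, 0)))\<^sup>2 else 0))"
        unfolding w_def r_def
        by (intro sum.cong refl) (auto simp: complex_norm_square mult.commute simp del: of_real_power)
      also have "\<dots> = complex_of_real (\<Sum>k<d. (cmod (A \<phi> $$ (k, 0)))\<^sup>2) - 2 * complex_of_real (p \<phi>)"
        by (simp only: sum_subtractf A(3) of_real_sum sum_distrib_left)
      finally show ?thesis using unitary_mat_col_norm[OF u A(1)] by simp
    qed
    have "B \<phi> $$ (a, 0) = (\<Sum>j<d. A \<phi> $$ (a, j) * (z j * w j))"
      unfolding B_def using a A(1) dA c3 w cdiag_mult_index[OF c2, of _ 0 z]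
      by (subst mult_mat_index_sum) (auto intro!: sum.cong simp del: index_mult_mat(1))
    also have "\<dots> = (\<Sum>j<d. A \<phi> $$ (a, j) * w j - (if j = 0 then 2 * A \<phi> $$ (a, 0) * w 0 else 0))"
      by (intro sum.cong refl) (auto simp: z_def algebra_simps)
    also have "\<dots> = (\<Sum>j<d. A \<phi> $$ (a, j) * w j) - 2 * A \<phi> $$ (a, 0) * w 0"
      using A(1) by (simp add: sum_subtractf)
    also have "(\<Sum>j<d. A \<phi> $$ (a, j) * w j) =
        (\<Sum>k<d. (\<Sum>j<d. A \<phi> $$ (a, j) * cnj (A \<phi> $$ (k, j))) * (r k * A \<phi> $$ (k, 0)))"
      unfolding w_def sum_distrib_left sum_distrib_right
      by (subst sum.swap) (simp add: mult.assoc)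
    also have "\<dots> = (\<Sum>k<d. if k = a then r a * A \<phi> $$ (a, 0) else 0)"
      using unitary_mat_rows[OF u a] by (intro sum.cong refl) auto
    also have "\<dots> = r a * A \<phi> $$ (a, 0)" using a by simp
    finally show ?thesis unfolding w0 by (simp add: algebra_simps)
  qed
  then have "p \<phi> * (3 - 4 * p \<phi>)\<^sup>2 = weight d (B \<phi>) G" for \<phi>
  proof -
    have "r a - 2 * (1 - 2 * complex_of_real (p \<phi>)) = - complex_of_real (3 - 4 * p \<phi>)" if "G a" for a
      using that by (simp add: r_def)
    then have "(if G a then (cmod (B \<phi> $$ (a, 0)))\<^sup>2 else 0) =
        (if G a then (cmod (A \<phi> $$ (a, 0)))\<^sup>2 else 0) * (3 - 4 * p \<phi>)\<^sup>2" if "a < d" for a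
      using \<open>\<And>a \<phi>. a < d \<Longrightarrow> B \<phi> $$ (a, 0) = _\<close>[OF that, of \<phi>]
      by (simp add: norm_mult power_mult_distrib del: of_real_diff)
    then have "weight d (B \<phi>) G =
        (\<Sum>a<d. (if G a then (cmod (A \<phi> $$ (a, 0)))\<^sup>2 else 0) * (3 - 4 * p \<phi>)\<^sup>2)"
      by (intro sum.cong refl) auto
    then show ?thesis by (simp add: A(3) flip: sum_distrib_right)
  qed
  ultimately show ?thesis
    using A(1) by (intro testerI[of d m _ B _ G]) (auto simp: numeral_3_eq_3)
qed

section \<open>Phase estimation with a power of a Dirichlet kernel as window\<close>

text \<open>Parseval's identity over arbitrary finite index sets. It serves unitary matrices, the
  absence of interference between products of eigenvectors, and the norm of the projected advice
  state.\<close>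

lemma sum_cmod_sq_orthonormal:
  fixes e :: "'k \<Rightarrow> 'i \<Rightarrow> complex"
  assumes "finite I" "finite K"
    "\<And>j k. j \<in> K \<Longrightarrow> k \<in> K \<Longrightarrow> (\<Sum>i\<in>I. cnj (e j i) * e k i) = (if j = k then 1 else 0)"
  shows "(\<Sum>i\<in>I. (cmod (\<Sum>k\<in>K. c k * e k i))\<^sup>2) = (\<Sum>k\<in>K. (cmod (c k))\<^sup>2)"
proof -
  have "complex_of_real (\<Sum>i\<in>I. (cmod (\<Sum>k\<in>K. c k * e k i))\<^sup>2) =
      (\<Sum>i\<in>I. (\<Sum>k\<in>K. c k * e k i) * (\<Sum>j\<in>K. cnj (c j) * cnj (e j i)))"
    by (simp only: of_real_sum complex_norm_square cnj_sum complex_cnj_mult)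
  also have "\<dots> = (\<Sum>i\<in>I. \<Sum>k\<in>K. \<Sum>j\<in>K. c k * cnj (c j) * (cnj (e j i) * e k i))"
    by (simp add: sum_product ac_simps)
  also have "\<dots> = (\<Sum>k\<in>K. \<Sum>j\<in>K. c k * cnj (c j) * (\<Sum>i\<in>I. cnj (e j i) * e k i))"
    unfolding sum_distrib_left by (subst sum.swap, intro sum.cong refl, subst sum.swap, rule refl)
  also have "\<dots> = (\<Sum>k\<in>K. \<Sum>j\<in>K. if j = k then c k * cnj (c k) else 0)"
    by (intro sum.cong refl) (auto simp: assms(3))
  also have "\<dots> = complex_of_real (\<Sum>k\<in>K. (cmod (c k))\<^sup>2)"
    using assms(2) by (simp only: of_real_sum complex_norm_square) (simp add: sum.delta)
  finally show ?thesis by (simp only: of_real_eq_iff)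
qed

lemma unitary_mat_norm:
  assumes "unitary_mat d V"
  shows "(\<Sum>i<d. (cmod (\<Sum>k<d. V $$ (i, k) * v k))\<^sup>2) = (\<Sum>k<d. (cmod (v k))\<^sup>2)"
  using sum_cmod_sq_orthonormal[of "{..<d}" "{..<d}" "\<lambda>k i. V $$ (i, k)" v] unitary_mat_cols[OF assms]
  by (simp add: mult.commute)

text \<open>A Householder reflection; a first entry with a nonzero imaginary part would need an extra phase.\<close>
lemma unitary_mat_with_first_column:
  fixes v :: "nat \<Rightarrow> complex"
  assumes "0 < d" "(\<Sum>k<d. (cmod (v k))\<^sup>2) = 1" "v 0 \<in> \<real>"
  shows "\<exists>V. unitary_mat d V \<and> (\<forall>a<d. V $$ (a, 0) = v a)"
proof -
  obtain r where r: "v 0 = complex_of_real r" using assms(3) by (elim Reals_cases)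
  define w where "w k = v k - (if k = 0 then 1 else 0)" for k
  have split: "(\<Sum>k<d. h k) = h 0 + (\<Sum>k\<in>{0<..<d}. h k)" for h :: "nat \<Rightarrow> real"
    using assms(1) by (subst sum.remove[of _ 0]) (auto intro!: arg_cong[of _ _ "sum h"])
  have rest: "(\<Sum>k\<in>{0<..<d}. (cmod (v k))\<^sup>2) = 1 - r\<^sup>2"
    using assms(2) unfolding split by (simp add: r)
  have "(\<Sum>k<d. (cmod (w k))\<^sup>2) = (r - 1)\<^sup>2 + (1 - r\<^sup>2)"
    unfolding split rest[symmetric]
    using norm_of_real[of "r - 1", where 'a = complex]
    by (intro arg_cong2[of _ _ _ _ "(+)"] sum.cong) (auto simp: w_def r)
  then have norm_w: "(\<Sum>k<d. (cmod (w k))\<^sup>2) = 2 * (1 - r)" by (simp add: power2_eq_square algebra_simps)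
  show ?thesis
  proof (cases "r = 1")
    case True
    then have "cmod (w k) = 0" if "k < d" for k
      using norm_w that by (simp add: sum_nonneg_eq_0_iff)
    then have "(1\<^sub>m d :: complex mat) $$ (a, 0) = v a" if "a < d" for a
      using that assms(1) by (auto simp: w_def split: if_splits)
    then show ?thesis by (intro exI[of _ "1\<^sub>m d"]) simp
  next
    case False
    \<comment> \<open>This is \<open>2\<close> divided by the squared norm of \<open>w\<close>,
      which \<open>norm_w\<close> gives as \<open>2 * (1 - r)\<close>. So \<open>H\<close> is the
      reflection that takes the first basis vector to \<open>v\<close>.\<close>
    define \<beta> where "\<beta> = complex_of_real (1 / (1 - r))"
    define H where "H = mat d d (\<lambda>(i, j). (if i = j then 1 else 0) - \<beta> * w i * cnj (w j))"
    have \<beta>: "cnj \<beta> = \<beta>" "\<beta> * (\<Sum>k<d. w k * cnj (w k)) = 2" "\<beta> * (1 - complex_of_real r) = 1"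
    proof -
      have "(\<Sum>k<d. w k * cnj (w k)) = complex_of_real (2 * (1 - r))"
        by (simp only: flip: complex_norm_square of_real_sum norm_w)
      moreover have "complex_of_real r \<noteq> 1" using False by (metis of_real_1 of_real_eq_iff)
      ultimately show "cnj \<beta> = \<beta>" "\<beta> * (\<Sum>k<d. w k * cnj (w k)) = 2" "\<beta> * (1 - complex_of_real r) = 1"
        by (auto simp: \<beta>_def field_simps)
    qed
    have "unitary_mat d H"
    proof (rule unitary_matI)
      fix i j assume ij: "i < d" "j < d"
      have "(\<Sum>k<d. H $$ (i, k) * cnj (H $$ (j, k))) =
         (\<Sum>k<d. (if k = i then (if i = j then 1 else 0) - \<beta> * cnj (w j) * w i else 0) -
            (if k = j then \<beta> * w i * cnj (w j) else 0) +
            \<beta> * w i * cnj (w j) * (\<beta> * (w k * cnj (w k))))"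
        using ij by (intro sum.cong refl) (auto simp: H_def \<beta>(1) algebra_simps)
      also have "\<dots> = (if i = j then 1 else 0) - \<beta> * cnj (w j) * w i - \<beta> * w i * cnj (w j) +
          \<beta> * w i * cnj (w j) * (\<beta> * (\<Sum>k<d. w k * cnj (w k)))"
        using ij by (simp add: sum.distrib sum_subtractf sum_distrib_left)
      also have "\<dots> = (if i = j then 1 else 0)" unfolding \<beta>(2) by (simp add: algebra_simps)
      finally show "(\<Sum>k<d. H $$ (i, k) * cnj (H $$ (j, k))) = (if i = j then 1 else 0)" .
    qed (simp add: H_def)
    moreover have "H $$ (a, 0) = v a" if "a < d" for a
    proof -
      have "H $$ (a, 0) = (if a = 0 then 1 else 0) + w a * (\<beta> * (1 - complex_of_real r))"
        using that assms(1) by (simp add: H_def w_def r algebra_simps)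
      then show ?thesis unfolding \<beta>(3) by (simp add: w_def)
    qed
    ultimately show ?thesis by blast
  qed
qed

text \<open>The negative exponent makes outcome \<open>y\<close> stand for the phase
  \<open>2 * pi * y / M\<close>.\<close>

definition dft :: "nat \<Rightarrow> complex mat" where
  "dft M = mat M M (\<lambda>(y, t). cis (- (real t * (2 * pi * real y / real M))) / sqrt (real M))"

lemma dft_carrier [simp]: "dft M \<in> carrier_mat M M"
  by (simp add: dft_def)

lemma unitary_mat_dft: "unitary_mat M (dft M)"
proof (rule unitary_matI)
  fix i j assume ij: "i < M" "j < M"
  define z where "z = cis (2 * pi * (real j - real i) / real M)"
  have M: "0 < M" using ij by simp
  have "(\<Sum>k<M. dft M $$ (i, k) * cnj (dft M $$ (j, k))) = (\<Sum>k<M. z ^ k / of_nat M)"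
  proof (intro sum.cong refl)
    fix k assume "k \<in> {..<M}"
    then have "dft M $$ (i, k) * cnj (dft M $$ (j, k)) =
        cis (- (real k * (2 * pi * real i / real M))) * cis (real k * (2 * pi * real j / real M)) /
          (complex_of_real (sqrt (real M)) * complex_of_real (sqrt (real M)))"
      using ij by (simp add: dft_def cis_cnj)
    also have "complex_of_real (sqrt (real M)) * complex_of_real (sqrt (real M)) = of_nat M"
      by (simp flip: of_real_mult)
    also have "cis (- (real k * (2 * pi * real i / real M))) * cis (real k * (2 * pi * real j / real M)) = z ^ k"
      unfolding z_def Complex.DeMoivre cis_mult by (intro arg_cong[of _ _ cis]) (simp add: algebra_simps diff_divide_distrib)
    finally show "dft M $$ (i, k) * cnj (dft M $$ (j, k)) = z ^ k / of_nat M" .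
  qed
  also have "\<dots> = (\<Sum>k<M. z ^ k) / of_nat M" by (simp add: sum_divide_distrib)
  also have "\<dots> = (if i = j then 1 else 0)"
  proof (cases "i = j")
    case False
    have "z \<noteq> 1"
    proof
      assume "z = 1"
      then have "cos (2 * pi * (real j - real i) / real M) = 1" by (simp add: z_def cis.ctr complex_eq_iff)
      then obtain n :: int where n: "2 * pi * (real j - real i) / real M = of_int n * 2 * pi"
        using cos_one_2pi_int by blast
      then have "2 * pi * (real j - real i) = 2 * pi * (of_int n * real M)" using M by (simp add: field_simps)
      then have "real j - real i = of_int n * real M" by simp
      then have "int j - int i = n * int M" by (metis of_int_diff of_int_eq_iff of_int_mult of_int_of_nat_eq)
      then have "int M dvd int j - int i" by simp
      moreover have "\<bar>int j - int i\<bar> < int M" using ij by linarith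
      ultimately show False using False by (metis abs_of_nat dvd_imp_le_int eq_iff_diff_eq_0 not_less of_nat_eq_iff)
    qed
    moreover have "z ^ M = 1"
    proof -
      have "real M * (2 * pi * (real j - real i) / real M) = of_int (int j - int i) * (2 * pi)"
        using M by (simp add: field_simps)
      then have "z ^ M = cis (of_int (int j - int i) * (2 * pi))"
        unfolding z_def Complex.DeMoivre by simp
      then show ?thesis using cis_multiple_2pi[of "of_int (int j - int i)"] by (simp add: mult.commute)
    qed
    ultimately show ?thesis using False by (simp add: geometric_sum)
  qed (use M in \<open>simp add: z_def\<close>)
  finally show "(\<Sum>k<M. dft M $$ (i, k) * cnj (dft M $$ (j, k))) = (if i = j then 1 else 0)" .
qed simp

text \<open>On the unit circle this is a Dirichlet kernel up to a phase. The coefficients of its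
  \<open>L\<close>-th power are the \<open>L\<close>-fold convolution of a box of length
  \<open>w\<close>. With polynomials, the Fourier transform of this window is an evaluation, and
  hence the \<open>L\<close>-th power of the kernel.\<close>

definition geom_poly :: "nat \<Rightarrow> complex poly" where
  "geom_poly w = (\<Sum>j<w. monom 1 j)"

lemma poly_geom_poly: "poly (geom_poly w) z = (\<Sum>j<w. z ^ j)"
  by (simp add: geom_poly_def poly_sum poly_monom)

lemma degree_geom_poly_power_less:
  assumes "0 < w" "0 < L"
  shows "degree (geom_poly w ^ L) < L * w"
proof -
  have "degree (geom_poly w) \<le> w - 1"
    unfolding geom_poly_def using assms by (intro degree_sum_le) (auto simp: degree_monom_eq)
  then have "degree (geom_poly w ^ L) \<le> (w - 1) * L"
    using degree_power_le[of "geom_poly w" L] by (meson le_trans mult_le_mono1)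
  also have "\<dots> < L * w" using assms by (simp add: mult.commute[of L])
  finally show ?thesis .
qed

lemma poly_eq_sum_less:
  assumes "degree p < n"
  shows "poly p (z :: complex) = (\<Sum>t<n. coeff p t * z ^ t)"
proof -
  have "poly p z = (\<Sum>t\<le>degree p. coeff p t * z ^ t)" by (rule poly_altdef)
  also have "\<dots> = (\<Sum>t<n. coeff p t * z ^ t)"
    using assms by (intro sum.mono_neutral_left) (auto simp: coeff_eq_0)
  finally show ?thesis .
qed

text \<open>The closed form of the geometric sum has a numerator of norm at most \<open>2\<close>
  and a denominator of norm \<open>2 * \<bar>sin (\<eta> / 2)\<bar>\<close>. The bound does not grow
  with \<open>w\<close>, while the kernel reaches \<open>w\<close> at its peak.\<close>

lemma norm_geom_sum_le:
  assumes "1 \<le> K * \<bar>sin (\<eta> / 2)\<bar>" "0 < K"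
  shows "cmod (\<Sum>j<w. cis \<eta> ^ j) \<le> K"
proof -
  have s: "\<bar>sin (\<eta> / 2)\<bar> > 0" using assms by (auto intro!: Nat.gr0I simp: less_le)
  have "(cmod (cis \<eta> - 1))\<^sup>2 = (cos \<eta> - 1)\<^sup>2 + (sin \<eta>)\<^sup>2" by (simp add: cmod_power2)
  also have "\<dots> = 2 - 2 * cos \<eta>"
    using sin_cos_squared_add[of \<eta>] by (simp add: power2_eq_square algebra_simps)
  also have "\<dots> = (2 * sin (\<eta> / 2))\<^sup>2"
    using cos_double_sin[of "\<eta> / 2"] by (simp add: power2_eq_square)
  finally have n: "cmod (cis \<eta> - 1) = 2 * \<bar>sin (\<eta> / 2)\<bar>"
    using power2_eq_iff_nonneg[of "cmod (cis \<eta> - 1)" "2 * \<bar>sin (\<eta> / 2)\<bar>"] by (simp add: power_mult_distrib)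
  then have "cis \<eta> \<noteq> 1" using s by auto
  then have "cmod (\<Sum>j<w. cis \<eta> ^ j) = cmod (cis \<eta> ^ w - 1) / cmod (cis \<eta> - 1)"
    by (simp add: geometric_sum norm_divide)
  also have "\<dots> \<le> 2 / (2 * \<bar>sin (\<eta> / 2)\<bar>)"
    unfolding n using norm_triangle_ineq4[of "cis \<eta> ^ w" 1] s by (intro divide_right_mono) (auto simp: norm_power)
  also have "\<dots> \<le> K" using s assms by (simp add: field_simps)
  finally show ?thesis .
qed

text \<open>A crude linear bound. Up to \<open>pi / 3\<close> the derivative is at least
  \<open>1 / 2\<close>; beyond it the sine is at least \<open>1 / 2\<close>, and
  \<open>x / 4\<close> is smaller since \<open>x \<le> pi / 2 < 2\<close>.\<close>

lemma sin_ge_quarter: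
  assumes "0 \<le> x" "x \<le> pi / 2"
  shows "x / 4 \<le> sin x"
proof (cases "x \<le> pi / 3")
  case True
  show ?thesis
  proof (cases "x = 0")
    case False
    then obtain z where z: "0 < z" "z < x" "sin x - sin 0 = (x - 0) * cos z"
      using MVT2[of 0 x sin cos] assms by (auto intro: DERIV_sin)
    have "cos (pi / 3) \<le> cos z" using z True by (intro cos_monotone_0_pi_le) auto
    then have "x * (1 / 2) \<le> x * cos z" using assms by (intro mult_left_mono) (auto simp: cos_60)
    then show ?thesis using z assms by simp
  qed simp
next
  case False
  then have "sin (pi / 6) \<le> sin x" using assms by (intro sin_monotone_2pi_le) auto
  then show ?thesis using assms pi_less_4 by (simp add: sin_30)
qed

text \<open>The assumptions keep \<open>\<eta>\<close> at distance \<open>\<kappa>\<close> from the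
  multiples \<open>0\<close> and \<open>\<plusminus> 2 * pi\<close> of the period. This is the
  source of the kernel bound \<open>K = 8 / \<kappa>\<close>.\<close>

lemma abs_sin_half_ge:
  assumes "0 < \<kappa>" "\<kappa> \<le> \<bar>\<eta>\<bar>" "\<bar>\<eta>\<bar> \<le> 2 * pi - \<kappa>"
  shows "1 \<le> 8 / \<kappa> * \<bar>sin (\<eta> / 2)\<bar>"
proof -
  have "sin (\<kappa> / 2) \<le> sin (\<bar>\<eta>\<bar> / 2)"
  proof (cases "\<bar>\<eta>\<bar> \<le> pi")
    case True
    then show ?thesis using assms by (intro sin_monotone_2pi_le) auto
  next
    case False
    then have "sin (\<kappa> / 2) \<le> sin (pi - \<bar>\<eta>\<bar> / 2)" using assms by (intro sin_monotone_2pi_le) auto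
    then show ?thesis by simp
  qed
  moreover have "\<bar>sin (\<eta> / 2)\<bar> \<ge> sin (\<bar>\<eta>\<bar> / 2)" by (cases "0 \<le> \<eta>") auto
  moreover have "\<kappa> / 8 \<le> sin (\<kappa> / 2)" using sin_ge_quarter[of "\<kappa> / 2"] assms by simp
  ultimately have "\<kappa> / 8 \<le> \<bar>sin (\<eta> / 2)\<bar>" by linarith
  then show ?thesis using assms(1) by (simp add: field_simps)
qed

abbreviation window_weight :: "nat \<Rightarrow> nat \<Rightarrow> real" where
  "window_weight L w \<equiv> \<Sum>t<L * w. (cmod (coeff (geom_poly w ^ L) t))\<^sup>2"

definition window :: "nat \<Rightarrow> nat \<Rightarrow> nat \<Rightarrow> complex" where
  "window L w t = coeff (geom_poly w ^ L) t /
     complex_of_real (sqrt (window_weight L w))"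

text \<open>The variance of the numbers \<open>a t\<close> is nonnegative.\<close>

lemma sum_squared_le: "(\<Sum>t<n. a t)\<^sup>2 \<le> real n * (\<Sum>t<n. (a t)\<^sup>2)" for a :: "nat \<Rightarrow> real"
proof (cases "n = 0")
  case False
  define s where "s = (\<Sum>t<n. a t) / real n"
  have s: "(\<Sum>t<n. a t) = real n * s" using False by (simp add: s_def)
  have "0 \<le> (\<Sum>t<n. (a t - s)\<^sup>2)" by (intro sum_nonneg) simp
  also have "\<dots> = (\<Sum>t<n. (a t)\<^sup>2 - 2 * s * a t + s\<^sup>2)"
    by (intro sum.cong refl) (simp add: power2_eq_square algebra_simps)
  also have "\<dots> = (\<Sum>t<n. (a t)\<^sup>2) - real n * s\<^sup>2"
    by (simp add: sum.distrib sum_subtractf s power2_eq_square flip: sum_distrib_left)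
  finally have "real n * (real n * s\<^sup>2) \<le> real n * (\<Sum>t<n. (a t)\<^sup>2)"
    by (intro mult_left_mono) auto
  then show ?thesis unfolding s by (simp add: power2_eq_square ac_simps)
qed simp

text \<open>The coefficients sum to the value \<open>w ^ L\<close> at \<open>1\<close>, and
  Cauchy-Schwarz bounds this sum. As a lower bound on the norm of the window, it shows that
  normalization costs little of the decay of the kernel.\<close>

lemma sum_coeff_geom_poly_power_ge:
  assumes "0 < w" "0 < L"
  shows "(real w ^ L)\<^sup>2 \<le> real (L * w) * window_weight L w"
proof -
  define c where "c = coeff (geom_poly w ^ L)"
  have "of_nat w ^ L = poly (geom_poly w ^ L) 1" by (simp add: poly_geom_poly)
  also have "\<dots> = (\<Sum>t<L * w. c t)"
    using poly_eq_sum_less[OF degree_geom_poly_power_less[OF assms], of 1] by (simp add: c_def)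
  finally have "real w ^ L = cmod (\<Sum>t<L * w. c t)" by (metis norm_of_nat norm_power)
  also have "\<dots> \<le> (\<Sum>t<L * w. cmod (c t))" by (rule norm_sum)
  finally have "(real w ^ L)\<^sup>2 \<le> (\<Sum>t<L * w. cmod (c t))\<^sup>2" by (intro power_mono) auto
  also have "\<dots> \<le> real (L * w) * (\<Sum>t<L * w. (cmod (c t))\<^sup>2)"
    by (rule sum_squared_le)
  finally show ?thesis by (simp add: c_def)
qed

lemma window_norm:
  assumes "0 < w" "0 < L"
  shows "(\<Sum>t<L * w. (cmod (window L w t))\<^sup>2) = 1"
proof -
  define Z where "Z = window_weight L w"
  have "(real w ^ L)\<^sup>2 \<le> real (L * w) * Z"
    unfolding Z_def by (rule sum_coeff_geom_poly_power_ge[OF assms])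
  moreover have "0 < (real w ^ L)\<^sup>2" using assms by simp
  ultimately have "0 < real (L * w) * Z" by linarith
  then have Z: "Z > 0" using assms zero_less_mult_pos[of "real (L * w)" Z] by simp
  have "(cmod (window L w t))\<^sup>2 = (cmod (coeff (geom_poly w ^ L) t))\<^sup>2 / Z" for t
    unfolding window_def Z_def[symmetric] using Z by (simp add: norm_divide power_divide)
  then have "(\<Sum>t<L * w. (cmod (window L w t))\<^sup>2) = (\<Sum>t<L * w. (cmod (coeff (geom_poly w ^ L) t))\<^sup>2 / Z)"
    by (rule sum.cong[OF refl])
  also have "\<dots> = Z / Z" unfolding sum_divide_distrib[symmetric] Z_def[symmetric] ..
  finally show ?thesis using Z by simp
qed

text \<open>State preparation by \<open>unitary_mat_with_first_column\<close> asks for a real first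
  amplitude.\<close>

lemma window_zero_real: "window L w 0 \<in> \<real>"
proof -
  have "coeff (geom_poly w ^ L) 0 = (if 0 < w then 1 else 0) ^ L"
    by (simp add: coeff_0_power geom_poly_def coeff_sum if_distrib cong: if_cong)
  then show ?thesis by (simp add: window_def)
qed

definition estimate_amp :: "nat \<Rightarrow> nat \<Rightarrow> real \<Rightarrow> nat \<Rightarrow> complex" where
  "estimate_amp L w x y = (\<Sum>t<L * w. dft (L * w) $$ (y, t) * (cis (real t * x) * window L w t))"

lemma estimate_amp_norm:
  assumes "0 < w" "0 < L"
  shows "(\<Sum>y<L * w. (cmod (estimate_amp L w x y))\<^sup>2) = 1"
  unfolding estimate_amp_def
  by (simp add: unitary_mat_norm[OF unitary_mat_dft] norm_mult window_norm[OF assms])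

text \<open>The sum over \<open>t\<close> evaluates the polynomial at \<open>cis\<close> of the
  distance between the phase and the grid point of \<open>y\<close>, and evaluation commutes with
  powers.\<close>

lemma estimate_amp_eq:
  assumes "0 < w" "0 < L" "y < L * w"
  shows "estimate_amp L w x y = (\<Sum>j<w. cis (x - 2 * pi * real y / real (L * w)) ^ j) ^ L /
     complex_of_real (sqrt (real (L * w)) * sqrt (window_weight L w))"
proof -
  define \<eta> where "\<eta> = x - 2 * pi * real y / real (L * w)"
  define Z where "Z = window_weight L w"
  have "estimate_amp L w x y = (\<Sum>t<L * w. coeff (geom_poly w ^ L) t * cis \<eta> ^ t /
      complex_of_real (sqrt (real (L * w)) * sqrt Z))"
    unfolding estimate_amp_def
  proof (intro sum.cong refl)
    fix t assume t: "t \<in> {..<L * w}"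
    have "cis \<eta> ^ t = cis (- (real t * (2 * pi * real y / real (L * w)))) * cis (real t * x)"
      unfolding \<eta>_def Complex.DeMoivre cis_mult by (intro arg_cong[of _ _ cis]) (simp add: algebra_simps)
    then show "dft (L * w) $$ (y, t) * (cis (real t * x) * window L w t) =
        coeff (geom_poly w ^ L) t * cis \<eta> ^ t / complex_of_real (sqrt (real (L * w)) * sqrt Z)"
      using t assms by (simp add: dft_def window_def Z_def[symmetric])
  qed
  also have "\<dots> = poly (geom_poly w ^ L) (cis \<eta>) / complex_of_real (sqrt (real (L * w)) * sqrt Z)"
    unfolding poly_eq_sum_less[OF degree_geom_poly_power_less[OF assms(1,2)]] by (rule sum_divide_distrib[symmetric])
  finally show ?thesis by (simp add: poly_geom_poly \<eta>_def Z_def)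
qed

text \<open>All but one of the \<open>L\<close> factors of the window are bounded pointwise. The last one is summed with
  Parseval's identity, so that no factor \<open>w\<close> is lost.\<close>
lemma estimate_amp_tail:
  assumes "0 < w" "B \<subseteq> {..<Suc L * w}" "0 < K" "4 * K \<le> real w"
    "\<And>y. y \<in> B \<Longrightarrow> 1 \<le> K * \<bar>sin ((x - 2 * pi * real y / real (Suc L * w)) / 2)\<bar>"
  shows "(\<Sum>y\<in>B. (cmod (estimate_amp (Suc L) w x y))\<^sup>2) \<le> real (Suc L) / 16 ^ L"
proof -
  define M where "M = Suc L * w"
  define Z where "Z = (\<Sum>t<M. (cmod (coeff (geom_poly w ^ Suc L) t))\<^sup>2)"
  define D where "D y = (\<Sum>j<w. cis (x - 2 * pi * real y / real M) ^ j)" for y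
  have M: "0 < M" "w \<le> M" using assms(1) by (auto simp: M_def)
  have Z: "(real w ^ Suc L)\<^sup>2 \<le> real M * Z"
    using sum_coeff_geom_poly_power_ge[OF assms(1), of "Suc L"] by (simp add: M_def Z_def)
  have Z0: "0 < real M * Z" by (rule less_le_trans[OF _ Z]) (use assms(1) in simp)
  have D_sum: "(\<Sum>y<M. (cmod (D y))\<^sup>2) = real M * real w"
  proof -
    have "(\<Sum>y<M. (cmod (D y))\<^sup>2) = (\<Sum>y<M. real M * (cmod (\<Sum>t<M. dft M $$ (y, t) *
        (if t < w then cis (real t * x) else 0)))\<^sup>2)"
    proof (intro sum.cong refl)
      fix y assume y: "y \<in> {..<M}"
      have "D y = (\<Sum>t<w. complex_of_real (sqrt (real M)) * (dft M $$ (y, t) * cis (real t * x)))"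
        unfolding D_def
      proof (intro sum.cong refl)
        fix t assume t: "t \<in> {..<w}"
        have "cis (x - 2 * pi * real y / real M) ^ t =
            cis (- (real t * (2 * pi * real y / real M))) * cis (real t * x)"
          unfolding Complex.DeMoivre cis_mult by (intro arg_cong[of _ _ cis]) (simp add: algebra_simps)
        then show "cis (x - 2 * pi * real y / real M) ^ t =
            complex_of_real (sqrt (real M)) * (dft M $$ (y, t) * cis (real t * x))"
          using t y M by (simp add: dft_def)
      qed
      also have "\<dots> = complex_of_real (sqrt (real M)) *
          (\<Sum>t<M. dft M $$ (y, t) * (if t < w then cis (real t * x) else 0))"
        unfolding sum_distrib_left using M by (intro sum.mono_neutral_cong_left) auto
      finally show "(cmod (D y))\<^sup>2 = real M * (cmod (\<Sum>t<M. dft M $$ (y, t) *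
          (if t < w then cis (real t * x) else 0)))\<^sup>2"
        by (simp add: norm_mult power_mult_distrib)
    qed
    also have "\<dots> = real M * (\<Sum>t<M. (cmod (if t < w then cis (real t * x) else 0))\<^sup>2)"
      by (simp add: unitary_mat_norm[OF unitary_mat_dft] flip: sum_distrib_left)
    also have "(\<Sum>t<M. (cmod (if t < w then cis (real t * x) else 0))\<^sup>2) = (\<Sum>t<w. 1)"
      using M by (intro sum.mono_neutral_cong_right) auto
    finally show ?thesis by simp
  qed
  have "(\<Sum>y\<in>B. (cmod (estimate_amp (Suc L) w x y))\<^sup>2) = (\<Sum>y\<in>B. (cmod (D y))\<^sup>2 ^ L * (cmod (D y))\<^sup>2 / (real M * Z))"
  proof (intro sum.cong refl)
    fix y assume "y \<in> B"
    then have y: "y < Suc L * w" using assms(2) by auto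
    have Z00: "0 \<le> Z" unfolding Z_def by (intro sum_nonneg) simp
    have "estimate_amp (Suc L) w x y = D y ^ Suc L / complex_of_real (sqrt (real M) * sqrt Z)"
      using estimate_amp_eq[OF assms(1) _ y, of x] by (simp only: M_def D_def Z_def)
    then have "cmod (estimate_amp (Suc L) w x y) = cmod (D y) ^ Suc L / (sqrt (real M) * sqrt Z)"
      using Z00 by (simp add: norm_divide norm_power norm_mult)
    then show "(cmod (estimate_amp (Suc L) w x y))\<^sup>2 = (cmod (D y))\<^sup>2 ^ L * (cmod (D y))\<^sup>2 / (real M * Z)"
      using Z00 by (simp add: power_divide power_mult_distrib ac_simps flip: power_mult)
  qed
  also have "\<dots> \<le> (\<Sum>y\<in>B. (K\<^sup>2) ^ L * (cmod (D y))\<^sup>2 / (real M * Z))"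
  proof (intro sum_mono divide_right_mono mult_right_mono power_mono)
    fix y assume "y \<in> B"
    then show "cmod (D y) \<le> K"
      unfolding D_def using assms(5)[of y] assms(3) by (intro norm_geom_sum_le) (auto simp: M_def)
  qed (use Z0 in auto)
  also have "\<dots> = (K\<^sup>2) ^ L * (\<Sum>y\<in>B. (cmod (D y))\<^sup>2) / (real M * Z)"
    by (simp add: sum_divide_distrib sum_distrib_left)
  also have "\<dots> \<le> (K\<^sup>2) ^ L * (real M * real w) / (real w ^ Suc L)\<^sup>2"
  proof (intro frac_le mult_left_mono)
    show "(\<Sum>y\<in>B. (cmod (D y))\<^sup>2) \<le> real M * real w"
      unfolding D_sum[symmetric] using assms(2) by (intro sum_mono2) (auto simp: M_def)
  qed (use Z assms(1) in auto)
  \<comment> \<open>As \<open>M = Suc L * w\<close>, the factor \<open>M * w\<close> is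
    \<open>Suc L\<close> times \<open>w\<^sup>2\<close>, and this \<open>w\<^sup>2\<close> cancels
    one of the \<open>Suc L\<close> such factors in the denominator.\<close>
  also have "\<dots> = real (Suc L) * ((K\<^sup>2) ^ L / ((real w)\<^sup>2) ^ L)"
  proof -
    have "(real w ^ Suc L)\<^sup>2 = (real w)\<^sup>2 * ((real w)\<^sup>2) ^ L" by (simp add: power_mult_distrib ac_simps flip: power_mult)
    moreover have "real M * real w = real (Suc L) * (real w)\<^sup>2" by (simp add: M_def power2_eq_square algebra_simps)
    ultimately show ?thesis using assms(1) by (simp del: of_nat_Suc)
  qed
  also have "\<dots> = real (Suc L) * ((K / real w)\<^sup>2) ^ L"
    by (simp add: power_divide)
  also have "\<dots> \<le> real (Suc L) * (1 / 16) ^ L"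
  proof (intro mult_left_mono power_mono)
    have "K / real w \<le> 1 / 4" using assms by (simp add: field_simps)
    then have "(K / real w)\<^sup>2 \<le> (1 / 4)\<^sup>2" using assms by (intro power_mono) auto
    then show "(K / real w)\<^sup>2 \<le> 1 / 16" by (simp add: power2_eq_square)
  qed auto
  finally show ?thesis by (simp add: power_divide)
qed

section \<open>Tests for phases in an arc\<close>

definition arc_prob :: "nat \<Rightarrow> nat \<Rightarrow> nat set \<Rightarrow> real \<Rightarrow> real" where
  "arc_prob L w Y x = (\<Sum>y\<in>Y. (cmod (estimate_amp L w x y))\<^sup>2)"

text \<open>Basis state \<open>a\<close> takes part in the first \<open>n a\<close> queries only, so
  different powers are applied in superposition. The minimum with \<open>T\<close> describes the
  state after \<open>T\<close> of these queries.\<close>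

lemma phase_circuit_power:
  assumes "\<And>a. i a < m"
  shows "phase_circuit m d T (\<lambda>\<phi>. cdiag d (\<lambda>a. cis (real (min (n a) T) * \<phi> (i a))))"
proof (induction T)
  case 0
  then show ?case using phase_circuit.Free[OF unitary_mat_one] by simp
next
  case (Suc T)
  define s :: "nat \<Rightarrow> int" where "s a = (if T < n a then 1 else 0)" for a
  have "1\<^sub>m d * (phase_diag d i s \<phi> * cdiag d (\<lambda>a. cis (real (min (n a) T) * \<phi> (i a)))) =
      cdiag d (\<lambda>a. cis (real (min (n a) (Suc T)) * \<phi> (i a)))" for \<phi>
  proof -
    have "cis (of_int (s a) * \<phi> (i a)) * cis (real (min (n a) T) * \<phi> (i a)) =
        cis (real (min (n a) (Suc T)) * \<phi> (i a))" for a
      unfolding cis_mult by (intro arg_cong[of _ _ cis]) (auto simp: s_def min_def algebra_simps le_Suc_eq)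
    then show ?thesis by (simp add: phase_diag_def cdiag_mult left_mult_one_mat[OF cdiag_carrier])
  qed
  then show ?case
    using phase_circuit.Query[OF Suc unitary_mat_one, of i s] assms by (simp add: s_def)
qed

text \<open>Phase estimation is run on a uniform superposition of the indices.\<close>
lemma tester_average_arc_prob:
  assumes "0 < m" "0 < w" "0 < L" "Y \<subseteq> {..<L * w}"
  shows "tester m (L * w) (\<lambda>\<phi>. (\<Sum>i<m. arc_prob L w Y (\<phi> i)) / real m)"
proof -
  define M where "M = L * w"
  have M: "0 < M" using assms by (simp add: M_def)
  \<comment> \<open>Uniform superposition over the index register, tensored with the window on the
    clock register.\<close>
  define v where "v a = window L w (a mod M) / complex_of_real (sqrt (real m))" for a
  have "(\<Sum>k<m * M. (cmod (v k))\<^sup>2) = (\<Sum>i<m. (\<Sum>t<M. (cmod (window L w t))\<^sup>2) / real m)"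
    unfolding sum_lessThan_times sum_divide_distrib
    by (intro sum.cong refl) (simp add: v_def norm_divide power_divide)
  also have "\<dots> = 1" using assms by (simp add: M_def window_norm)
  finally have "(\<Sum>k<m * M. (cmod (v k))\<^sup>2) = 1" .
  moreover have "v 0 \<in> \<real>" using window_zero_real[of L w] by (auto simp: v_def intro!: Reals_divide)
  ultimately obtain V where V: "unitary_mat (m * M) V" "\<And>a. a < m * M \<Longrightarrow> V $$ (a, 0) = v a"
    using unitary_mat_with_first_column[of "m * M" v] assms(1) M by auto
  \<comment> \<open>Both truncations are vacuous on the \<open>m * M\<close> basis states. The query
    rule demands an index below \<open>m\<close> for every natural number, which
    \<open>mod m\<close> ensures.\<close>
  define Q where "Q \<phi> = cdiag (m * M) (\<lambda>a. cis (real (min (a mod M) M) * \<phi> ((a div M) mod m)))" for \<phi> :: "nat \<Rightarrow> real"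
  define F where "F = block_diag m M (\<lambda>_. dft M)"
  have F: "unitary_mat (m * M) F" unfolding F_def by (intro unitary_mat_block_diag unitary_mat_dft)
  have Q: "phase_circuit m (m * M) M Q"
    unfolding Q_def using assms(1) by (intro phase_circuit_power) simp
  have A: "phase_circuit m (m * M) M (\<lambda>\<phi>. F * (Q \<phi> * V))"
    using phase_circuit_left_mult[OF phase_circuit_comp[OF Q phase_circuit.Free[OF V(1)]] F] by simp
  have idx: "(F * (Q \<phi> * V)) $$ (i * M + y, 0) = estimate_amp L w (\<phi> i) y / complex_of_real (sqrt (real m))"
    if i: "i < m" and y: "y < M" for i y \<phi>
  proof -
    have Vc: "V \<in> carrier_mat (m * M) (m * M)" using V(1) by simp
    then have QV: "Q \<phi> * V \<in> carrier_mat (m * M) (m * M)"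
      unfolding Q_def by (meson mult_carrier_mat cdiag_carrier)
    have QV_idx: "(Q \<phi> * V) $$ (k * M + t, 0) = cis (real t * \<phi> k) * v t" if "k < m" "t < M" for k t
      unfolding Q_def using that M assms(1) V(2)[of "k * M + t"]
      by (subst cdiag_mult_index[OF Vc]) (auto simp: mult_less_bound v_def)
    have "(F * (Q \<phi> * V)) $$ (i * M + y, 0) =
        (\<Sum>k<m. \<Sum>t<M. F $$ (i * M + y, k * M + t) * (Q \<phi> * V) $$ (k * M + t, 0))"
      using i y M assms(1) QV F
      by (subst mult_mat_index_sum) (auto simp: sum_lessThan_times mult_less_bound F_def simp del: index_mult_mat(1))
    also have "\<dots> = (\<Sum>k<m. if k = i then \<Sum>t<M. dft M $$ (y, t) * (cis (real t * \<phi> k) * v t) else 0)"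
      using i y by (intro sum.cong refl) (auto simp: F_def block_diag_def mult_less_bound QV_idx simp del: index_mult_mat(1))
    also have "\<dots> = (\<Sum>t<M. dft M $$ (y, t) * (cis (real t * \<phi> i) * window L w t) / complex_of_real (sqrt (real m)))"
      using i by (simp add: v_def)
    also have "\<dots> = estimate_amp L w (\<phi> i) y / complex_of_real (sqrt (real m))"
      by (simp only: sum_divide_distrib estimate_amp_def M_def)
    finally show ?thesis .
  qed
  have "(\<Sum>i<m. arc_prob L w Y (\<phi> i)) / real m =
      (weight (m * M) (F * (Q \<phi> * V)) (\<lambda>a. a mod M \<in> Y))" for \<phi>
  proof -
    have "weight (m * M) (F * (Q \<phi> * V)) (\<lambda>a. a mod M \<in> Y) =
       (\<Sum>i<m. \<Sum>y<M. if y \<in> Y then (cmod (estimate_amp L w (\<phi> i) y))\<^sup>2 / real m else 0)"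
      unfolding sum_lessThan_times
      by (intro sum.cong refl) (simp add: idx norm_divide power_divide del: index_mult_mat(1))
    also have "\<dots> = (\<Sum>i<m. \<Sum>y\<in>Y. (cmod (estimate_amp L w (\<phi> i) y))\<^sup>2 / real m)"
    proof (rule sum.cong[OF refl])
      fix i
      have "{y \<in> {..<M}. y \<in> Y} = Y" using assms(4) by (auto simp: M_def)
      then show "(\<Sum>y<M. if y \<in> Y then (cmod (estimate_amp L w (\<phi> i) y))\<^sup>2 / real m else 0) =
          (\<Sum>y\<in>Y. (cmod (estimate_amp L w (\<phi> i) y))\<^sup>2 / real m)"
        using sum.inter_filter[of "{..<M}" "\<lambda>y. (cmod (estimate_amp L w (\<phi> i) y))\<^sup>2 / real m" "\<lambda>y. y \<in> Y"]
        by simp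
    qed
    finally show ?thesis by (simp add: arc_prob_def sum_divide_distrib)
  qed
  then show ?thesis
    using A assms(1) M unfolding M_def[symmetric] by (intro testerI[of "m * M" m M _ _ "\<lambda>a. a mod M \<in> Y"]) auto
qed

text \<open>\<open>q x\<close> is the probability that the estimate of \<open>x\<close> falls into
  the arc from \<open>lo + \<kappa>\<close> to \<open>2 * pi - \<kappa>\<close>. On the circle,
  phases up to \<open>lo\<close> are at least \<open>\<kappa>\<close> away from this arc, and phases
  from \<open>hi\<close> to \<open>b\<close> are at least \<open>\<kappa>\<close> away from its
  complement. This is why \<open>2 * \<kappa>\<close> is required both between \<open>lo\<close> and
  \<open>hi\<close> and between \<open>b\<close> and \<open>2 * pi\<close>.\<close>

lemma arc_tester:
  assumes "0 < m" "0 < \<kappa>" "32 / \<kappa> \<le> real w" "0 \<le> lo" "lo + 2 * \<kappa> \<le> hi" "b \<le> 2 * pi - 2 * \<kappa>"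
  obtains q where "tester m (Suc L * w) (\<lambda>\<phi>. (\<Sum>i<m. q (\<phi> i)) / real m)" "\<And>x. 0 \<le> q x"
    "\<And>x. 0 \<le> x \<Longrightarrow> x \<le> lo \<Longrightarrow> q x \<le> real (Suc L) / 16 ^ L"
    "\<And>x. hi \<le> x \<Longrightarrow> x \<le> b \<Longrightarrow> 1 - real (Suc L) / 16 ^ L \<le> q x"
proof -
  define M where "M = Suc L * w"
  have w: "0 < w" using assms by (auto intro!: Nat.gr0I simp: divide_le_0_iff)
  then have M: "0 < M" by (simp add: M_def)
  define g where "g y = 2 * pi * real y / real M" for y
  have g: "0 \<le> g y" "g y < 2 * pi" if "y < M" for y
    using that M by (auto simp: g_def field_simps)
  define Y where "Y = {y. y < M \<and> lo + \<kappa> \<le> g y \<and> g y \<le> 2 * pi - \<kappa>}"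
  have Y_sub: "Y \<subseteq> {..<M}" by (auto simp: Y_def)
  have tail: "(\<Sum>y\<in>B. (cmod (estimate_amp (Suc L) w x y))\<^sup>2) \<le> real (Suc L) / 16 ^ L"
    if "B \<subseteq> {..<M}" "\<And>y. y \<in> B \<Longrightarrow> \<kappa> \<le> \<bar>x - g y\<bar> \<and> \<bar>x - g y\<bar> \<le> 2 * pi - \<kappa>" for B x
  \<comment> \<open>\<open>8 / \<kappa>\<close> is the constant of \<open>abs_sin_half_ge\<close>,
    and \<open>32 / \<kappa> \<le> w\<close> becomes \<open>4 * K \<le> w\<close>.\<close>
  proof (rule estimate_amp_tail[of w B L "8 / \<kappa>"])
    show "1 \<le> 8 / \<kappa> * \<bar>sin ((x - 2 * pi * real y / real (Suc L * w)) / 2)\<bar>" if "y \<in> B" for y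
      using abs_sin_half_ge[of \<kappa> "x - g y"] assms that \<open>\<And>y. y \<in> B \<Longrightarrow> _\<close>[OF that]
      by (simp add: g_def M_def)
  qed (use assms that w in \<open>auto simp: M_def\<close>)
  show thesis
  proof
    show "tester m (Suc L * w) (\<lambda>\<phi>. (\<Sum>i<m. arc_prob (Suc L) w Y (\<phi> i)) / real m)"
      using assms(1) w by (intro tester_average_arc_prob) (auto simp: Y_def M_def)
    show "0 \<le> arc_prob (Suc L) w Y x" for x
      unfolding arc_prob_def by (intro sum_nonneg) simp
    show "arc_prob (Suc L) w Y x \<le> real (Suc L) / 16 ^ L" if "0 \<le> x" "x \<le> lo" for x
      unfolding arc_prob_def
    proof (rule tail)
      fix y assume "y \<in> Y"
      then show "\<kappa> \<le> \<bar>x - g y\<bar> \<and> \<bar>x - g y\<bar> \<le> 2 * pi - \<kappa>" using that assms by (auto simp: Y_def)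
    qed (auto simp: Y_def)
    show "1 - real (Suc L) / 16 ^ L \<le> arc_prob (Suc L) w Y x" if "hi \<le> x" "x \<le> b" for x
    proof -
      have "(\<Sum>y\<in>{..<M} - Y. (cmod (estimate_amp (Suc L) w x y))\<^sup>2) \<le> real (Suc L) / 16 ^ L"
      proof (rule tail)
        fix y assume "y \<in> {..<M} - Y"
        then have "y < M" "g y < lo + \<kappa> \<or> 2 * pi - \<kappa> < g y" by (auto simp: Y_def)
        then show "\<kappa> \<le> \<bar>x - g y\<bar> \<and> \<bar>x - g y\<bar> \<le> 2 * pi - \<kappa>"
          using that assms g[of y] by (auto simp: abs_if)
      qed auto
      moreover have "arc_prob (Suc L) w Y x + (\<Sum>y\<in>{..<M} - Y. (cmod (estimate_amp (Suc L) w x y))\<^sup>2) = 1"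
        using estimate_amp_norm[OF w, of "Suc L" x, folded M_def] unfolding arc_prob_def
          sum.subset_diff[OF Y_sub finite_lessThan, of "\<lambda>y. (cmod (estimate_amp (Suc L) w x y))\<^sup>2"]
        by linarith
      ultimately show ?thesis by linarith
    qed
  qed
qed

section \<open>Amplitude amplification with an unknown amplitude\<close>

definition triple :: "real \<Rightarrow> real" where
  "triple p = p * (3 - 4 * p)\<^sup>2"

text \<open>The triple-angle formula: if the amplitude is the sine of an angle, a round of
  amplification triples the angle.\<close>

lemma triple_sin: "triple ((sin x)\<^sup>2) = (sin (3 * x))\<^sup>2"
proof -
  have "sin (3 * x) = sin (2 * x + x)" by (simp add: algebra_simps)
  also have "\<dots> = 2 * sin x * (cos x)\<^sup>2 + (1 - 2 * (sin x)\<^sup>2) * sin x"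
    unfolding sin_add sin_double cos_double_sin by (simp add: power2_eq_square algebra_simps)
  also have "\<dots> = sin x * (3 - 4 * (sin x)\<^sup>2)"
    by (simp add: cos_squared_eq algebra_simps)
  finally show ?thesis by (simp add: triple_def power_mult_distrib)
qed

lemma sin_arcsin_sqrt: "0 \<le> p \<Longrightarrow> p \<le> 1 \<Longrightarrow> sin (arcsin (sqrt p)) = sqrt p"
  by (rule sin_arcsin) (auto intro: order_trans[of _ 0])

lemma funpow_triple_sin: "(triple ^^ s) ((sin x)\<^sup>2) = (sin (3 ^ s * x))\<^sup>2"
  by (induction s) (simp_all add: triple_sin mult.assoc)

text \<open>The upper bound \<open>1\<close> comes from the form as a squared sine, and the growth
  by at most \<open>9\<close> per round from \<open>\<bar>3 - 4 * x\<bar> \<le> 3\<close>. The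
  growth bound controls false positives.\<close>

lemma funpow_triple_bounds:
  assumes "0 \<le> p" "p \<le> 1"
  shows "0 \<le> (triple ^^ s) p \<and> (triple ^^ s) p \<le> 1 \<and> (triple ^^ s) p \<le> 9 ^ s * p"
proof (induction s)
  case (Suc s)
  define x where "x = (triple ^^ s) p"
  have x: "0 \<le> x" "x \<le> 1" "x \<le> 9 ^ s * p" using Suc by (auto simp: x_def)
  have "(triple ^^ Suc s) p = (sin (3 ^ Suc s * arcsin (sqrt p)))\<^sup>2"
    using funpow_triple_sin[of "Suc s" "arcsin (sqrt p)"] assms by (simp add: sin_arcsin_sqrt del: funpow.simps)
  then have "(triple ^^ Suc s) p \<le> 1" by (simp add: abs_square_le_1)
  moreover have "(3 - 4 * x)\<^sup>2 \<le> 3\<^sup>2" using x by (intro power2_le_iff_abs_le[THEN iffD2]) auto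
  then have "x * (3 - 4 * x)\<^sup>2 \<le> x * 9" using x by (intro mult_left_mono) auto
  then have "(triple ^^ Suc s) p \<le> 9 ^ Suc s * p"
    using x by (simp add: triple_def x_def[symmetric])
  moreover have "0 \<le> (triple ^^ Suc s) p" using x by (simp add: triple_def x_def[symmetric])
  ultimately show ?case by blast
qed (use assms in auto)

text \<open>Repeated tripling of the angle cannot jump over the range from \<open>pi / 6\<close> to
  \<open>pi / 2\<close>, whose ends differ by the factor \<open>3\<close>. In this range the squared
  sine is at least \<open>1 / 4\<close>.\<close>

lemma ex_funpow_triple_ge:
  assumes "0 < m" "1 / (2 * real m) \<le> p" "p \<le> 1" "sqrt (real m) \<le> 3 ^ S"
  shows "\<exists>s\<le>S. 1 / 4 \<le> (triple ^^ s) p"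
proof -
  have p: "0 < p" using assms by (auto intro: less_le_trans[of _ "1 / (2 * real m)"])
  define \<omega> where "\<omega> = arcsin (sqrt p)"
  have sq: "(sin \<omega>)\<^sup>2 = p" using p assms by (simp add: \<omega>_def sin_arcsin_sqrt)
  have "- 1 \<le> sqrt p" "sqrt p \<le> 1" using p assms by (auto intro: order_trans[of _ 0])
  then have \<omega>: "0 \<le> \<omega>" "\<omega> \<le> pi / 2"
    unfolding \<omega>_def using p by (auto intro: arcsin_nonneg arcsin_ubound simp del: le_divide_eq_numeral1)
  have sin_\<omega>: "sin \<omega> = sqrt p" using p assms by (simp add: \<omega>_def sin_arcsin_sqrt)
  have "sqrt p \<le> \<omega>" using sin_x_le_x[OF \<omega>(1)] sin_\<omega> by simp
  moreover have "sqrt (1 / (2 * real m)) \<le> sqrt p" using assms(2) by (rule real_sqrt_le_mono)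
  then have "sqrt (1 / (2 * real m)) \<le> \<omega>" using \<open>sqrt p \<le> \<omega>\<close> by (rule order_trans)
  ultimately have "sqrt (real m) * sqrt (1 / (2 * real m)) \<le> 3 ^ S * \<omega>"
    using assms(4) by (intro mult_mono) auto
  moreover have "sqrt (real m) * sqrt (1 / (2 * real m)) = sqrt (1 / 2)"
    using assms(1) by (simp flip: real_sqrt_mult)
  \<comment> \<open>Compared with \<open>pi / 6 < 2 / 3\<close>, which follows from
    \<open>pi < 4\<close>.\<close>
  moreover have "2 / 3 \<le> sqrt (1 / 2)" by (rule real_le_rsqrt) (simp add: power2_eq_square)
  ultimately have "pi / 6 \<le> 3 ^ S * \<omega>" using pi_less_4 by linarith
  define s where "s = (LEAST s. pi / 6 \<le> 3 ^ s * \<omega>)"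
  have s: "pi / 6 \<le> 3 ^ s * \<omega>" "s \<le> S"
    unfolding s_def using \<open>pi / 6 \<le> 3 ^ S * \<omega>\<close> by (auto intro: LeastI Least_le)
  \<comment> \<open>For \<open>s > 0\<close> minimality puts the preceding angle below
    \<open>pi / 6\<close>; for \<open>s = 0\<close> the range of the arcsine is enough.\<close>
  have "3 ^ s * \<omega> \<le> pi / 2"
  proof (cases s)
    case (Suc s')
    then have "\<not> pi / 6 \<le> 3 ^ s' * \<omega>"
      using not_less_Least[of s' "\<lambda>s. pi / 6 \<le> 3 ^ s * \<omega>"] unfolding s_def by simp
    then show ?thesis using Suc by simp
  qed (use \<omega> in simp)
  then have "sin (pi / 6) \<le> sin (3 ^ s * \<omega>)" using s by (intro sin_monotone_2pi_le) auto
  then have "(1 / 2)\<^sup>2 \<le> (sin (3 ^ s * \<omega>))\<^sup>2" by (intro power_mono) (auto simp: sin_30)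
  then have "1 / 4 \<le> (triple ^^ s) p"
    unfolding sq[symmetric] funpow_triple_sin by (simp add: power2_eq_square)
  then show ?thesis using s by blast
qed

section \<open>Search with an unknown number of rounds\<close>

lemma tester_funpow_triple: "tester m T p \<Longrightarrow> tester m (3 ^ s * T) (\<lambda>\<phi>. (triple ^^ s) (p \<phi>))"
proof (induction s)
  case (Suc s)
  then show ?case using tester_triple[OF Suc(1)[OF Suc(2)]] by (simp add: triple_def mult.assoc)
qed simp

lemma tester_zero: "0 < m \<Longrightarrow> tester m T (\<lambda>_. 0)"
  using samples_tester[OF samples_const[of m T "()"], of "{}"] by simp

lemma tester_or_sum:
  fixes n :: nat
  assumes "0 < m" "\<And>s. s < n \<Longrightarrow> tester m (T s) (p s)"
  shows "tester m (\<Sum>s<n. T s) (\<lambda>\<phi>. 1 - (\<Prod>s<n. 1 - p s \<phi>))"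
  using assms(2)
proof (induction n)
  case (Suc n)
  have "tester m (\<Sum>s<n. T s) (\<lambda>\<phi>. 1 - (\<Prod>s<n. 1 - p s \<phi>))" "tester m (T n) (p n)"
    using Suc by auto
  from tester_or[OF this assms(1)] have "tester m (\<Sum>s<Suc n. T s)
     (\<lambda>\<phi>. 1 - (\<Prod>s<n. 1 - p s \<phi>) + (1 - (1 - (\<Prod>s<n. 1 - p s \<phi>))) * p n \<phi>)" by simp
  then show ?case
    by (rule tester_cong) (simp add: algebra_simps)
qed (simp add: tester_zero assms)

lemma one_minus_prod_le_sum:
  fixes p :: "nat \<Rightarrow> real"
  assumes "\<And>s. s < n \<Longrightarrow> 0 \<le> p s" "\<And>s. s < n \<Longrightarrow> p s \<le> 1"
  shows "1 - (\<Prod>s<n. 1 - p s) \<le> (\<Sum>s<n. p s)"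
  using assms
proof (induction n)
  case (Suc n)
  have IH: "1 - (\<Prod>s<n. 1 - p s) \<le> (\<Sum>s<n. p s)" using Suc by simp
  have "(\<Prod>s<n. 1 - p s) \<le> (\<Prod>s<n. 1)" using Suc.prems by (intro prod_mono) auto
  then have "p n * (\<Prod>s<n. 1 - p s) \<le> p n * 1" using Suc.prems by (intro mult_left_mono) auto
  then show ?case using IH by (simp add: algebra_simps)
qed simp

text \<open>As the amplitude is unknown, every number of rounds up to \<open>S\<close> is tried
  \<open>r\<close> times. The costs triple with each round, so the largest number dominates.\<close>

lemma tester_search:
  assumes "tester m T p" "0 < m"
  shows "tester m (\<Sum>s<Suc S. r * (3 ^ s * T)) (\<lambda>\<phi>. 1 - (\<Prod>s<Suc S. (1 - (triple ^^ s) (p \<phi>)) ^ r))"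
proof -
  have "tester m (r * (3 ^ s * T)) (\<lambda>\<phi>. 1 - (1 - (triple ^^ s) (p \<phi>)) ^ r)" for s
    using tester_or_sum[OF assms(2) tester_funpow_triple[OF assms(1), of s], where n = r] by simp
  from tester_or_sum[OF assms(2) this, where n = "Suc S"] show ?thesis by simp
qed

lemma one_minus_power_le: "0 \<le> x \<Longrightarrow> x \<le> 1 \<Longrightarrow> 1 - (1 - x) ^ n \<le> real n * x"
  using one_minus_prod_le_sum[of n "\<lambda>_. x"] by simp

text \<open>False positives obey a union bound over all runs, with the geometric sum of
  \<open>9 ^ s\<close>. For true positives a single good number of rounds is enough: its
  \<open>r\<close> runs all fail with probability at most \<open>(3 / 4) ^ r\<close>.\<close>

lemma search_prob_bounds:
  assumes "0 \<le> p" "p \<le> 1"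
  shows "1 - (\<Prod>s<Suc S. (1 - (triple ^^ s) p) ^ r) \<le> real r * (9 ^ Suc S / 8) * p"
    and "0 < m \<Longrightarrow> 1 / (2 * real m) \<le> p \<Longrightarrow> sqrt (real m) \<le> 3 ^ S \<Longrightarrow>
      (\<Prod>s<Suc S. (1 - (triple ^^ s) p) ^ r) \<le> (3 / 4) ^ r"
proof -
  note b = funpow_triple_bounds[OF assms]
  have pw: "0 \<le> (1 - (triple ^^ s) p) ^ r" "(1 - (triple ^^ s) p) ^ r \<le> 1" for s
    using b[of s] by (auto intro: power_le_one)
  have "1 - (\<Prod>s<Suc S. (1 - (triple ^^ s) p) ^ r) =
      1 - (\<Prod>s<Suc S. 1 - (1 - (1 - (triple ^^ s) p) ^ r))" by simp
  also have "\<dots> \<le> (\<Sum>s<Suc S. 1 - (1 - (triple ^^ s) p) ^ r)"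
    using pw by (intro one_minus_prod_le_sum) auto
  also have "\<dots> \<le> (\<Sum>s<Suc S. real r * (9 ^ s * p))"
  proof (intro sum_mono)
    fix s
    have "1 - (1 - (triple ^^ s) p) ^ r \<le> real r * (triple ^^ s) p"
      using b[of s] by (intro one_minus_power_le) auto
    also have "\<dots> \<le> real r * (9 ^ s * p)" using b[of s] by (intro mult_left_mono) auto
    finally show "1 - (1 - (triple ^^ s) p) ^ r \<le> real r * (9 ^ s * p)" .
  qed
  also have "\<dots> = real r * p * (\<Sum>s<Suc S. 9 ^ s)"
    unfolding sum_distrib_left by (intro sum.cong refl) simp
  also have "(\<Sum>s<Suc S. 9 ^ s) = (9 ^ Suc S - 1) / (8 :: real)"
    using geometric_sum[of "9 :: real" "Suc S"] by simp
  also have "real r * p * ((9 ^ Suc S - 1) / 8) \<le> real r * p * (9 ^ Suc S / 8)"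
    using assms by (intro mult_left_mono) auto
  finally show "1 - (\<Prod>s<Suc S. (1 - (triple ^^ s) p) ^ r) \<le> real r * (9 ^ Suc S / 8) * p"
    by (simp add: ac_simps)
  assume "0 < m" "1 / (2 * real m) \<le> p" "sqrt (real m) \<le> 3 ^ S"
  then obtain s where s: "s \<le> S" "1 / 4 \<le> (triple ^^ s) p"
    using ex_funpow_triple_ge assms(2) by blast
  \<comment> \<open>The factor of the good \<open>s\<close> is isolated; the remaining ones are at
    most \<open>1\<close>.\<close>
  have "(\<Prod>s<Suc S. (1 - (triple ^^ s) p) ^ r) =
      (1 - (triple ^^ s) p) ^ r * (\<Prod>s\<in>{..<Suc S} - {s}. (1 - (triple ^^ s) p) ^ r)"
    using s(1) by (intro prod.remove) auto
  also have "\<dots> \<le> (3 / 4) ^ r * 1"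
    using pw b[of s] s(2) by (intro mult_mono power_mono prod_le_1 prod_nonneg) auto
  finally show "(\<Prod>s<Suc S. (1 - (triple ^^ s) p) ^ r) \<le> (3 / 4) ^ r" by simp
qed

lemma ex_power_three:
  assumes "0 < m"
  shows "\<exists>S. sqrt (real m) \<le> 3 ^ S \<and> 3 ^ S \<le> 3 * sqrt (real m)"
proof -
  obtain n where n: "sqrt (real m) < 3 ^ n" using real_arch_pow[of 3 "sqrt (real m)"] by auto
  define S where "S = (LEAST S. sqrt (real m) \<le> 3 ^ S)"
  have "sqrt (real m) \<le> 3 ^ S"
    unfolding S_def using n by (intro LeastI[of "\<lambda>S. sqrt (real m) \<le> 3 ^ S" n] less_imp_le)
  moreover have "3 ^ S \<le> 3 * sqrt (real m)"
  proof (cases S)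
    case (Suc S')
    then have "\<not> sqrt (real m) \<le> 3 ^ S'"
      using not_less_Least[of S' "\<lambda>S. sqrt (real m) \<le> 3 ^ S"] unfolding S_def by simp
    then have "3 ^ S' \<le> sqrt (real m)" by linarith
    then show ?thesis unfolding Suc power_Suc by linarith
  next
    case 0
    have "1 \<le> sqrt (real m)" using assms by simp
    then show ?thesis unfolding 0 power_0 by linarith
  qed
  ultimately show ?thesis by (intro exI conjI)
qed

text \<open>Window width \<open>w\<close> about \<open>32 / \<kappa>\<close>,
  \<open>Suc L = l + j + 3\<close> convolutions and \<open>3 * j\<close> repetitions. The constant
  is \<open>486 = 3 * 36 * 9 / 2\<close>, from the repetitions, the bound
  \<open>36 / \<kappa>\<close> on \<open>w\<close>, and the sum of \<open>3 ^ s\<close> for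
  \<open>s \<le> S\<close>.\<close>

lemma threshold_tester:
  assumes "0 < m" "m \<le> 2 ^ l" "0 < \<kappa>" "\<kappa> \<le> 4" "0 \<le> lo" "lo + 2 * \<kappa> \<le> hi" "b \<le> 2 * pi - 2 * \<kappa>" "0 < j"
  obtains T p where "tester m T p"
    "real T \<le> 486 * real j * real (l + j + 3) * sqrt (real m) / \<kappa>"
    "\<And>\<phi>. \<forall>i<m. 0 \<le> \<phi> i \<and> \<phi> i \<le> b \<Longrightarrow> \<exists>i<m. hi \<le> \<phi> i \<Longrightarrow> 1 - 1 / 2 ^ j \<le> p \<phi>"
    "\<And>\<phi>. \<forall>i<m. 0 \<le> \<phi> i \<and> \<phi> i \<le> lo \<Longrightarrow> p \<phi> \<le> 1 / 2 ^ j"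
proof -
  define w where "w = nat \<lceil>32 / \<kappa>\<rceil>"
  \<comment> \<open>The error \<open>8\<close> to the power \<open>- L\<close> has to beat both the
    amplification, of order \<open>2 ^ l\<close>, and the target \<open>1 / 2 ^ j\<close>. The
    summand \<open>2\<close> pays for the constants.\<close>
  define L where "L = l + j + 2"
  define \<epsilon> where "\<epsilon> = real (Suc L) / 16 ^ L"
  have "0 < 32 / \<kappa>" using assms by simp
  then have w: "32 / \<kappa> \<le> real w" "real w \<le> 32 / \<kappa> + 1" unfolding w_def by linarith+
  have \<epsilon>: "\<epsilon> \<le> 1 / 8 ^ L"
  proof -
    have "Suc L \<le> 2 ^ L" by (rule Suc_leI[OF less_exp])
    then have "real (Suc L) \<le> 2 ^ L" by (metis of_nat_le_iff of_nat_numeral of_nat_power)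
    then have "\<epsilon> \<le> 2 ^ L / 16 ^ L" unfolding \<epsilon>_def by (intro divide_right_mono) auto
    also have "\<dots> = (2 / 16) ^ L" by (simp only: power_divide)
    also have "\<dots> = 1 / 8 ^ L" by (simp add: power_divide)
    finally show ?thesis .
  qed
  obtain q where q: "tester m (Suc L * w) (\<lambda>\<phi>. (\<Sum>i<m. q (\<phi> i)) / real m)" "\<And>x. 0 \<le> q x"
    "\<And>x. 0 \<le> x \<Longrightarrow> x \<le> lo \<Longrightarrow> q x \<le> \<epsilon>" "\<And>x. hi \<le> x \<Longrightarrow> x \<le> b \<Longrightarrow> 1 - \<epsilon> \<le> q x"
    using arc_tester[OF assms(1,3) w(1) assms(5,6,7), of L] unfolding \<epsilon>_def by blast
  define avg where "avg \<phi> = (\<Sum>i<m. q (\<phi> i)) / real m" for \<phi>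
  have avg: "0 \<le> avg \<phi>" "avg \<phi> \<le> 1" for \<phi>
    using tester_range[OF q(1)] unfolding avg_def by auto
  obtain S where S: "sqrt (real m) \<le> 3 ^ S" "3 ^ S \<le> 3 * sqrt (real m)"
    using ex_power_three[OF assms(1)] by blast
  define T where "T = (\<Sum>s<Suc S. (3 * j) * (3 ^ s * (Suc L * w)))"
  define p where "p \<phi> = 1 - (\<Prod>s<Suc S. (1 - (triple ^^ s) (avg \<phi>)) ^ (3 * j))" for \<phi>
  show thesis
  proof
    show "tester m T p"
      unfolding T_def p_def avg_def by (rule tester_search[OF q(1) assms(1)])
    have "real T = real (3 * j) * real (Suc L) * real w * (\<Sum>s<Suc S. 3 ^ s)"
      unfolding T_def of_nat_sum sum_distrib_left by (intro sum.cong refl) (simp only: of_nat_mult of_nat_power of_nat_numeral ac_simps)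
    also have "(\<Sum>s<Suc S. 3 ^ s) = (3 ^ Suc S - 1) / (2 :: real)"
      using geometric_sum[of "3 :: real" "Suc S"] by simp
    also have "real (3 * j) * real (Suc L) * real w * ((3 ^ Suc S - 1) / 2) \<le>
        real (3 * j) * real (Suc L) * (36 / \<kappa>) * (9 / 2 * sqrt (real m))"
    proof (intro mult_mono mult_nonneg_nonneg)
      have "1 \<le> (3 :: real) ^ Suc S" by (rule one_le_power) simp
      then show "0 \<le> (3 ^ Suc S - 1) / (2 :: real)" by simp
      have "1 \<le> 4 / \<kappa>" using assms by simp
      then show "real w \<le> 36 / \<kappa>" using w(2) by (simp add: field_simps)
      show "(3 ^ Suc S - 1) / 2 \<le> 9 / 2 * sqrt (real m)" using S(2) by simp
    qed (use assms in auto)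
    also have "\<dots> = 486 * real j * real (l + j + 3) * sqrt (real m) / \<kappa>"
    proof -
      have "real (Suc L) = real (l + j + 3)" by (simp add: L_def)
      then show ?thesis by (simp del: of_nat_Suc of_nat_add)
    qed
    finally show "real T \<le> 486 * real j * real (l + j + 3) * sqrt (real m) / \<kappa>" .
    show "1 - 1 / 2 ^ j \<le> p \<phi>" if \<phi>: "\<forall>i<m. 0 \<le> \<phi> i \<and> \<phi> i \<le> b" "\<exists>i<m. hi \<le> \<phi> i" for \<phi>
    proof -
      obtain i where i: "i < m" "hi \<le> \<phi> i" "\<phi> i \<le> b" using \<phi> by blast
      have "8 ^ 1 \<le> (8 :: real) ^ L" unfolding L_def by (intro power_increasing) auto
      then have "1 / 8 ^ L \<le> 1 / (8 :: real)" by (intro divide_left_mono) auto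
      \<comment> \<open>A single phase above \<open>hi\<close> contributes at least
        \<open>1 / 2\<close> to the sum, hence \<open>1 / (2 * m)\<close> to the average. This is
        the smallest probability that the search is built to amplify.\<close>
      then have "1 / 2 \<le> q (\<phi> i)" using q(4)[OF i(2,3)] \<epsilon> by linarith
      also have "\<dots> \<le> (\<Sum>i<m. q (\<phi> i))" using i q(2) by (intro member_le_sum) auto
      finally have "1 / (2 * real m) \<le> avg \<phi>"
        using assms(1) by (simp add: avg_def field_simps)
      from search_prob_bounds(2)[OF avg assms(1) this S(1), of "3 * j"]
      have "1 - (3 / 4) ^ (3 * j) \<le> p \<phi>" by (simp add: p_def)
      \<comment> \<open>Three repetitions halve the failure probability, since
        \<open>27 / 64 \<le> 1 / 2\<close>.\<close>
      moreover have "(3 / 4 :: real) ^ (3 * j) \<le> (1 / 2) ^ j"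
        unfolding power_mult by (intro power_mono) (auto simp: power3_eq_cube)
      ultimately show ?thesis by (simp add: power_divide)
    qed
    show "p \<phi> \<le> 1 / 2 ^ j" if \<phi>: "\<forall>i<m. 0 \<le> \<phi> i \<and> \<phi> i \<le> lo" for \<phi>
    proof -
      have "(\<Sum>i<m. q (\<phi> i)) \<le> (\<Sum>i<m. \<epsilon>)" using \<phi> q(3) by (intro sum_mono) auto
      then have "avg \<phi> \<le> \<epsilon>" using assms(1) by (simp add: avg_def field_simps)
      then have a: "avg \<phi> \<le> 1 / 8 ^ L" using \<epsilon> by simp
      have "(3 ^ S)\<^sup>2 \<le> (3 * sqrt (real m))\<^sup>2" using S(2) by (intro power_mono) auto
      then have "9 ^ S \<le> 9 * real m" by (simp add: power_mult_distrib flip: power_mult) (simp add: power_mult mult.commute[of S])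
      also have "\<dots> \<le> 9 * 2 ^ l" using assms(2) by (metis mult_left_mono of_nat_le_iff of_nat_numeral of_nat_power zero_le_numeral)
      finally have nine: "9 ^ Suc S / 8 \<le> 81 / 8 * (2 :: real) ^ l" by simp
      have "p \<phi> \<le> real (3 * j) * (9 ^ Suc S / 8) * avg \<phi>"
        unfolding p_def by (rule search_prob_bounds(1)[OF avg])
      also have "\<dots> \<le> (3 * 2 ^ j) * (81 / 8 * 2 ^ l) * (1 / 8 ^ L)"
      proof (intro mult_mono nine a avg)
        have "j \<le> 2 ^ j" by (rule less_imp_le[OF less_exp])
        then have "real j \<le> 2 ^ j" by (metis of_nat_le_iff of_nat_numeral of_nat_power)
        then show "real (3 * j) \<le> 3 * 2 ^ j" by simp
      qed auto
      \<comment> \<open>\<open>3 * 81 / 8\<close> divided by the \<open>8\<^sup>2\<close> that comes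
        from the summand \<open>2\<close> of \<open>L\<close>.\<close>
      also have "\<dots> = 243 / 512 * (2 ^ j / 8 ^ j) * (2 ^ l / 8 ^ l)"
        by (simp add: L_def power_add field_simps)
      also have "\<dots> = 243 / 512 * (1 / 4) ^ j * (1 / 4) ^ l"
        by (simp flip: power_divide)
      also have "\<dots> \<le> 1 * (1 / 2) ^ j * 1"
        by (intro mult_mono power_mono power_le_one) auto
      finally show ?thesis by (simp add: power_divide)
    qed
  qed
qed

section \<open>Estimating the largest phase\<close>

abbreviation phases_below :: "nat \<Rightarrow> real \<Rightarrow> (nat \<Rightarrow> real) set" where
  "phases_below m b \<equiv> {\<phi>. \<forall>i<m. 0 \<le> \<phi> i \<and> \<phi> i \<le> b}"

abbreviation near_max :: "nat \<Rightarrow> real \<Rightarrow> (nat \<Rightarrow> real) \<Rightarrow> real set" where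
  "near_max m \<delta> \<phi> \<equiv> {x. \<bar>x - Max (\<phi> ` {..<m})\<bar> \<le> \<delta>}"

text \<open>Nothing is asked outside \<open>K\<close>, so that each branch of a search can be
  specialised to the tuples for which it is meant.\<close>

definition estimates_max :: "nat \<Rightarrow> real \<Rightarrow> real \<Rightarrow> real \<Rightarrow> (nat \<Rightarrow> real) set \<Rightarrow> bool" where
  "estimates_max m \<delta> B \<epsilon> K \<longleftrightarrow> (\<exists>T P. real T \<le> B \<and> samples m T P \<and>
     (\<forall>\<phi>\<in>K. 1 - \<epsilon> \<le> P \<phi> (near_max m \<delta> \<phi>)))"

lemma estimates_max_mono:
  "estimates_max m \<delta> B \<epsilon> K \<Longrightarrow> B \<le> B' \<Longrightarrow> \<epsilon> \<le> \<epsilon>' \<Longrightarrow> K' \<subseteq> K \<Longrightarrow> estimates_max m \<delta> B' \<epsilon>' K'"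
proof -
  assume "estimates_max m \<delta> B \<epsilon> K" and le: "B \<le> B'" "\<epsilon> \<le> \<epsilon>'" "K' \<subseteq> K"
  then obtain T P where TP: "real T \<le> B" "samples m T P"
    "\<And>\<phi>. \<phi> \<in> K \<Longrightarrow> 1 - \<epsilon> \<le> P \<phi> (near_max m \<delta> \<phi>)"
    unfolding estimates_max_def by blast
  show ?thesis unfolding estimates_max_def
  proof (intro exI conjI ballI)
    show "samples m T P" by (rule TP)
    show "real T \<le> B'" using TP(1) le(1) by linarith
    show "1 - \<epsilon>' \<le> P \<phi> (near_max m \<delta> \<phi>)" if "\<phi> \<in> K'" for \<phi>
      using TP(3)[of \<phi>] that le(2,3) by force
  qed
qed

text \<open>The test has to be reliable only outside the overlap of \<open>K1\<close> and
  \<open>K2\<close>; inside it either branch succeeds. This is what makes tests with a gap between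
  \<open>lo\<close> and \<open>hi\<close> usable.\<close>

lemma estimates_max_if:
  assumes "0 < m" "tester m T p" "real T \<le> C"
    "estimates_max m \<delta> B \<epsilon> K1" "estimates_max m \<delta> B \<epsilon> K2"
    "\<And>\<phi>. \<phi> \<in> K \<Longrightarrow> \<phi> \<notin> K1 \<Longrightarrow> p \<phi> \<le> \<eta>" "\<And>\<phi>. \<phi> \<in> K \<Longrightarrow> \<phi> \<notin> K2 \<Longrightarrow> 1 - \<eta> \<le> p \<phi>"
    "K \<subseteq> K1 \<union> K2" "0 \<le> \<eta>"
  shows "estimates_max m \<delta> (C + B) (\<epsilon> + \<eta>) K"
proof -
  obtain T1 P1 where P1: "real T1 \<le> B" "samples m T1 P1"
    "\<forall>\<phi>\<in>K1. 1 - \<epsilon> \<le> P1 \<phi> (near_max m \<delta> \<phi>)"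
    using assms(4) unfolding estimates_max_def by blast
  obtain T2 P2 where P2: "real T2 \<le> B" "samples m T2 P2"
    "\<forall>\<phi>\<in>K2. 1 - \<epsilon> \<le> P2 \<phi> (near_max m \<delta> \<phi>)"
    using assms(5) unfolding estimates_max_def by blast
  define T' where "T' = max T1 T2"
  have s: "samples m T' P1" "samples m T' P2"
    using samples_mono[OF P1(2)] samples_mono[OF P2(2)] assms(1) by (auto simp: T'_def)
  show ?thesis unfolding estimates_max_def
  proof (intro exI conjI ballI)
    show "samples m (T + T') (\<lambda>\<phi> S. p \<phi> * P1 \<phi> S + (1 - p \<phi>) * P2 \<phi> S)"
      by (rule samples_if[OF assms(2) s])
    show "real (T + T') \<le> C + B" using assms(3) P1(1) P2(1) by (simp add: T'_def max_def)
    fix \<phi> assume \<phi>: "\<phi> \<in> K"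
    define G where "G = near_max m \<delta> \<phi>"
    have r: "0 \<le> p \<phi>" "p \<phi> \<le> 1" "0 \<le> P1 \<phi> G" "P1 \<phi> G \<le> 1" "0 \<le> P2 \<phi> G" "P2 \<phi> G \<le> 1"
      using tester_range[OF assms(2)] samples_range[OF s(1)] samples_range[OF s(2)] by auto
    have "(1 - p \<phi>) * P1 \<phi> G \<le> (1 - p \<phi>) * 1" "p \<phi> * P2 \<phi> G \<le> p \<phi> * 1"
      using r by (intro mult_left_mono; simp)+
    moreover have "0 \<le> (1 - p \<phi>) * P2 \<phi> G" "0 \<le> p \<phi> * P1 \<phi> G" using r by simp_all
    \<comment> \<open>Relying on one branch alone loses at most the probability that the other one
      is taken.\<close>
    ultimately have b1: "p \<phi> * P1 \<phi> G + (1 - p \<phi>) * P2 \<phi> G \<ge> P1 \<phi> G - (1 - p \<phi>)"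
      and b2: "p \<phi> * P1 \<phi> G + (1 - p \<phi>) * P2 \<phi> G \<ge> P2 \<phi> G - p \<phi>"
      unfolding left_diff_distrib by linarith+
    consider "\<phi> \<in> K1" "\<phi> \<in> K2" | "\<phi> \<in> K1" "\<phi> \<notin> K2" | "\<phi> \<notin> K1" "\<phi> \<in> K2" using \<phi> assms(8) by blast
    then have "1 - (\<epsilon> + \<eta>) \<le> p \<phi> * P1 \<phi> G + (1 - p \<phi>) * P2 \<phi> G"
    proof cases
      case 1
      then have "1 - \<epsilon> \<le> P1 \<phi> G" "1 - \<epsilon> \<le> P2 \<phi> G" using P1(3) P2(3) by (auto simp: G_def)
      then have "p \<phi> * (1 - \<epsilon>) + (1 - p \<phi>) * (1 - \<epsilon>) \<le> p \<phi> * P1 \<phi> G + (1 - p \<phi>) * P2 \<phi> G"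
        using r by (intro add_mono mult_left_mono) auto
      then show ?thesis using assms(9) by (simp add: algebra_simps)
    next
      case 2
      then have "1 - \<epsilon> \<le> P1 \<phi> G" "1 - \<eta> \<le> p \<phi>" using P1(3) assms(7)[OF \<phi>] by (auto simp: G_def)
      then show ?thesis using b1 by linarith
    next
      case 3
      then have "1 - \<epsilon> \<le> P2 \<phi> G" "p \<phi> \<le> \<eta>" using P2(3) assms(6)[OF \<phi>] by (auto simp: G_def)
      then show ?thesis using b2 by linarith
    qed
    then show "1 - (\<epsilon> + \<eta>) \<le> p \<phi> * P1 \<phi> (near_max m \<delta> \<phi>) +
        (1 - p \<phi>) * P2 \<phi> (near_max m \<delta> \<phi>)"
      by (simp only: G_def)
  qed
qed

text \<open>The lower end \<open>a\<close> may be negative, so an interval of a prescribed length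
  can be used even if it extends below \<open>0\<close>.\<close>

definition max_in :: "nat \<Rightarrow> real \<Rightarrow> real \<Rightarrow> (nat \<Rightarrow> real) set" where
  "max_in m a b = {\<phi>. (\<forall>i<m. 0 \<le> \<phi> i \<and> \<phi> i \<le> b) \<and> (\<exists>i<m. a \<le> \<phi> i)}"

lemma estimates_max_const:
  assumes "0 < m" "b - a = 2 * \<delta>" "0 \<le> B" "0 \<le> \<epsilon>"
  shows "estimates_max m \<delta> B \<epsilon> (max_in m a b)"
  unfolding estimates_max_def
proof (intro exI conjI ballI)
  \<comment> \<open>The midpoint of the interval is returned without a query.\<close>
  show "samples m 0 (\<lambda>\<phi> S. if b - \<delta> \<in> S then 1 else 0)" by (rule samples_const[OF assms(1)])
  show "real 0 \<le> B" using assms by simp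
  fix \<phi> assume \<phi>: "\<phi> \<in> max_in m a b"
  then obtain i where i: "i < m" "a \<le> \<phi> i" by (auto simp: max_in_def)
  have "Max (\<phi> ` {..<m}) \<le> b" using \<phi> assms(1) by (intro Max.boundedI) (auto simp: max_in_def)
  moreover have "\<phi> i \<le> Max (\<phi> ` {..<m})" using i(1) by (intro Max_ge) auto
  ultimately have "\<bar>b - \<delta> - Max (\<phi> ` {..<m})\<bar> \<le> \<delta>"
    unfolding abs_le_iff using assms(2) i(2) by (intro conjI) linarith+
  then show "1 - \<epsilon> \<le> (if b - \<delta> \<in> (near_max m \<delta> \<phi>) then 1 else 0)"
    using assms(4) by simp
qed

text \<open>The bound of \<open>threshold_tester\<close> with \<open>j = k + 5\<close> and
  \<open>\<kappa> = 3 / 8 * \<delta> * (3 / 2) ^ k\<close>, where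
  \<open>486 * 8 / 3 = 1296\<close>.\<close>

definition level_cost :: "nat \<Rightarrow> nat \<Rightarrow> real \<Rightarrow> nat \<Rightarrow> real" where
  "level_cost m l \<delta> k = 1296 * real (k + 5) * real (l + k + 8) * sqrt (real m) / (\<delta> * (3 / 2) ^ k)"

lemma level_cost_nonneg: "0 < \<delta> \<Longrightarrow> 0 \<le> level_cost m l \<delta> k"
  by (simp add: level_cost_def)

text \<open>Ternary search: the two thresholds are at the thirds of the interval, so that either answer
  is allowed for a maximum in the middle third.\<close>
lemma estimates_max_interval:
  assumes "0 < m" "m \<le> 2 ^ l" "0 < \<delta>"
  shows "2 * \<delta> * (3 / 2) ^ k \<le> 32 \<Longrightarrow> 2 * \<delta> * (3 / 2) ^ k / 4 \<le> 2 * pi - b \<Longrightarrow>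
    estimates_max m \<delta> (\<Sum>i<k. level_cost m l \<delta> i) (\<Sum>i<k. 1 / 2 ^ (i + 5)) (max_in m (b - 2 * \<delta> * (3 / 2) ^ k) b)"
proof (induction k arbitrary: b)
  case 0
  then show ?case using assms by (intro estimates_max_const) auto
next
  case (Suc k)
  define W where "W = 2 * \<delta> * (3 / 2) ^ Suc k"
  have W: "0 < W" "2 * \<delta> * (3 / 2) ^ k = 2 * W / 3" "W \<le> 32" "W / 4 \<le> 2 * pi - b"
    using assms Suc.prems by (simp_all add: W_def)
  define a where "a = b - W"
  define lo where "lo = a + W / 3"
  define hi where "hi = a + 2 * W / 3"
  let ?B = "\<Sum>i<k. level_cost m l \<delta> i" and ?E = "\<Sum>i<k. 1 / 2 ^ (i + 5)"
  have up: "estimates_max m \<delta> ?B ?E (max_in m lo b)"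
    using Suc.IH[of b] W unfolding W(2) by (simp add: lo_def a_def)
  have down: "estimates_max m \<delta> ?B ?E (max_in m a hi)"
    using Suc.IH[of hi] W unfolding W(2) by (simp add: hi_def a_def)
  have "estimates_max m \<delta> (level_cost m l \<delta> k + ?B) (?E + 1 / 2 ^ (k + 5)) (max_in m a b)"
  proof (cases "0 \<le> lo")
    case True
    \<comment> \<open>The test has resolution \<open>W / 8\<close>. Then \<open>W \<le> 32\<close>
      keeps it at most \<open>4\<close>, the assumed margin \<open>W / 4\<close> below
      \<open>2 * pi\<close> is twice the resolution, and the distance \<open>W / 3\<close> from
      \<open>lo\<close> to \<open>hi\<close> exceeds \<open>W / 4\<close>.\<close>
    have conds: "0 < W / 8" "W / 8 \<le> 4" "lo + 2 * (W / 8) \<le> hi" "b \<le> 2 * pi - 2 * (W / 8)" "0 < k + 5"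
      using W by (auto simp: lo_def hi_def)
    obtain T p where T: "tester m T p"
      "real T \<le> 486 * real (k + 5) * real (l + (k + 5) + 3) * sqrt (real m) / (W / 8)"
      "\<And>\<phi>. \<forall>i<m. 0 \<le> \<phi> i \<and> \<phi> i \<le> b \<Longrightarrow> \<exists>i<m. hi \<le> \<phi> i \<Longrightarrow> 1 - 1 / 2 ^ (k + 5) \<le> p \<phi>"
      "\<And>\<phi>. \<forall>i<m. 0 \<le> \<phi> i \<and> \<phi> i \<le> lo \<Longrightarrow> p \<phi> \<le> 1 / 2 ^ (k + 5)"
      using threshold_tester[OF assms(1,2) conds(1,2) True conds(3,4,5)] by blast
    have "real T \<le> level_cost m l \<delta> k"
    proof -
      have "l + (k + 5) + 3 = l + k + 8" by simp
      then have "real T \<le> 486 * real (k + 5) * real (l + k + 8) * sqrt (real m) / (W / 8)"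
        using T(2) by (simp only:)
      also have "W / 8 = \<delta> * (3 / 2) ^ k * (3 / 8)" by (simp add: W_def)
      also have "486 * real (k + 5) * real (l + k + 8) * sqrt (real m) / (\<delta> * (3 / 2) ^ k * (3 / 8)) =
          level_cost m l \<delta> k"
        unfolding level_cost_def by (simp del: of_nat_add)
      finally show ?thesis .
    qed
    then show ?thesis
    proof (rule estimates_max_if[OF assms(1) T(1) _ up down])
      fix \<phi> assume \<phi>: "\<phi> \<in> max_in m a b"
      show "p \<phi> \<le> 1 / 2 ^ (k + 5)" if "\<phi> \<notin> max_in m lo b"
        using \<phi> that by (intro T(4)) (auto simp: max_in_def not_le less_imp_le)
      show "1 - 1 / 2 ^ (k + 5) \<le> p \<phi>" if "\<phi> \<notin> max_in m a hi"
        using \<phi> that by (intro T(3)) (auto simp: max_in_def not_le less_imp_le)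
    next
      show "max_in m a b \<subseteq> max_in m lo b \<union> max_in m a hi"
        using conds(1,3) by (force simp: max_in_def)
    qed simp
  next
    case False
    \<comment> \<open>The phases are nonnegative, so they all lie above a negative \<open>lo\<close>
      and the interval shrinks without a test.\<close>
    then have "max_in m a b \<subseteq> max_in m lo b" by (force simp: max_in_def)
    then show ?thesis
      using level_cost_nonneg[OF assms(3)] by - (rule estimates_max_mono[OF up]; simp)
  qed
  then show ?case by (simp add: a_def W_def add.commute)
qed

text \<open>A coarse test cannot distinguish phases close to \<open>2 * pi\<close> from phases close to \<open>0\<close>. Therefore
  the distance of the maximum to \<open>2 * pi\<close> is first determined up to a constant factor.\<close>
lemma estimates_max_gap:
  assumes "0 < m" "m \<le> 2 ^ l" "0 < \<delta>" "1 \<le> \<delta> * (3 / 2) ^ n" "\<delta> * (3 / 2) ^ n \<le> 4"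
    "\<And>k. k < n \<Longrightarrow> \<delta> * (3 / 2) ^ k < 1"
  shows "k \<le> n \<Longrightarrow> estimates_max m \<delta> ((\<Sum>i\<in>{k..<n}. level_cost m l \<delta> i) + (\<Sum>i<n + 3. level_cost m l \<delta> i))
    ((\<Sum>i\<in>{k..<n}. 1 / 2 ^ (i + 5)) + (\<Sum>i<n + 3. 1 / 2 ^ (i + 5))) (phases_below m (2 * pi - 2 * (\<delta> * (3 / 2) ^ k)))"
proof (induction k rule: inc_induct)
  case base
  define g where "g = \<delta> * (3 / 2) ^ n"
  have g: "1 \<le> g" "g \<le> 4" using assms(4,5) unfolding g_def by simp_all
  \<comment> \<open>Three extra levels make the interval reach below \<open>0\<close>: its length
    plus the margin is \<open>35 / 4 * g \<ge> 8 > 2 * pi\<close>. Since \<open>g \<le> 4\<close>,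
    the length stays below \<open>32\<close>.\<close>
  have W: "2 * \<delta> * (3 / 2) ^ (n + 3) = 27 / 4 * g" by (simp add: g_def power3_eq_cube power_add)
  have "estimates_max m \<delta> (\<Sum>i<n + 3. level_cost m l \<delta> i) (\<Sum>i<n + 3. 1 / 2 ^ (i + 5))
      (max_in m (2 * pi - 2 * g - 2 * \<delta> * (3 / 2) ^ (n + 3)) (2 * pi - 2 * g))"
  proof (rule estimates_max_interval[OF assms(1,2,3)])
    show "2 * \<delta> * (3 / 2) ^ (n + 3) \<le> 32" "2 * \<delta> * (3 / 2) ^ (n + 3) / 4 \<le> 2 * pi - (2 * pi - 2 * g)"
      unfolding W using g by linarith+
  qed
  moreover have "phases_below m (2 * pi - 2 * g) \<subseteq>
      max_in m (2 * pi - 2 * g - 2 * \<delta> * (3 / 2) ^ (n + 3)) (2 * pi - 2 * g)"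
  proof -
    have "2 * pi - 2 * g - 27 / 4 * g \<le> 0" using g(1) pi_less_4 by linarith
    then have "2 * pi - 2 * g - 27 / 4 * g \<le> \<phi> 0" if "\<forall>i<m. 0 \<le> \<phi> i \<and> \<phi> i \<le> 2 * pi - 2 * g" for \<phi>
      using that assms(1) by (meson order_trans)
    then have "\<phi> \<in> max_in m (2 * pi - 2 * g - 27 / 4 * g) (2 * pi - 2 * g)"
      if "\<forall>i<m. 0 \<le> \<phi> i \<and> \<phi> i \<le> 2 * pi - 2 * g" for \<phi>
      using that assms(1) unfolding max_in_def by simp (intro exI[of _ 0], simp)
    then show ?thesis unfolding W by (intro subsetI) simp
  qed
  ultimately show ?case unfolding g_def by - (rule estimates_max_mono[rotated 3], assumption+, simp_all)
next
  case (step k)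
  define g where "g = \<delta> * (3 / 2) ^ k"
  have g: "0 < g" "g < 1" using assms(3) assms(6)[OF step(2)] unfolding g_def by simp_all
  \<comment> \<open>Acceptance leaves a maximum between \<open>2 * g\<close> and
    \<open>4 * g\<close> below \<open>2 * pi\<close>; this interval has the length that the ternary
    search expects at level \<open>k\<close>. Rejection leaves the upper bound \<open>hi\<close>,
    which is the one of level \<open>k + 1\<close>. That \<open>g < 1\<close> makes
    \<open>lo\<close> nonnegative.\<close>
  define b where "b = 2 * pi - 2 * g"
  define lo where "lo = 2 * pi - 4 * g"
  define hi where "hi = 2 * pi - 3 * g"
  let ?B = "\<lambda>k. (\<Sum>i\<in>{k..<n}. level_cost m l \<delta> i) + (\<Sum>i<n + 3. level_cost m l \<delta> i)"
  let ?E = "\<lambda>k. (\<Sum>i\<in>{k..<n}. 1 / 2 ^ (i + 5)) + (\<Sum>i<n + 3. 1 / (2 :: real) ^ (i + 5))"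
  have conds: "0 < g / 2" "g / 2 \<le> 4" "0 \<le> lo" "lo + 2 * (g / 2) \<le> hi" "b \<le> 2 * pi - 2 * (g / 2)" "0 < k + 5"
    using g pi_ge_two by (auto simp: lo_def hi_def b_def)
  obtain T p where T: "tester m T p"
    "real T \<le> 486 * real (k + 5) * real (l + (k + 5) + 3) * sqrt (real m) / (g / 2)"
    "\<And>\<phi>. \<forall>i<m. 0 \<le> \<phi> i \<and> \<phi> i \<le> b \<Longrightarrow> \<exists>i<m. hi \<le> \<phi> i \<Longrightarrow> 1 - 1 / 2 ^ (k + 5) \<le> p \<phi>"
    "\<And>\<phi>. \<forall>i<m. 0 \<le> \<phi> i \<and> \<phi> i \<le> lo \<Longrightarrow> p \<phi> \<le> 1 / 2 ^ (k + 5)"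
    using threshold_tester[OF assms(1,2) conds] by blast
  have "real T \<le> level_cost m l \<delta> k"
  proof -
    have "l + (k + 5) + 3 = l + k + 8" by simp
    then have "real T \<le> 486 * real (k + 5) * real (l + k + 8) * sqrt (real m) / (g / 2)"
      using T(2) by (simp only:)
    also have "\<dots> = 972 * real (k + 5) * real (l + k + 8) * sqrt (real m) / g" by simp
    also have "\<dots> \<le> 1296 * real (k + 5) * real (l + k + 8) * sqrt (real m) / g"
      using g by (intro divide_right_mono mult_right_mono) auto
    finally show ?thesis unfolding level_cost_def g_def .
  qed
  moreover have "estimates_max m \<delta> (?B (Suc k)) (?E (Suc k)) (max_in m lo b)"
  proof -
    have W: "2 * \<delta> * (3 / 2) ^ k = 2 * g" by (simp add: g_def)
    have "estimates_max m \<delta> (\<Sum>i<k. level_cost m l \<delta> i) (\<Sum>i<k. 1 / 2 ^ (i + 5)) (max_in m (b - 2 * \<delta> * (3 / 2) ^ k) b)"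
      using g by (intro estimates_max_interval[OF assms(1,2,3)]; simp add: W b_def)
    then have up: "estimates_max m \<delta> (\<Sum>i<k. level_cost m l \<delta> i) (\<Sum>i<k. 1 / 2 ^ (i + 5)) (max_in m lo b)"
      unfolding W by (simp add: b_def lo_def)
    \<comment> \<open>The ternary search from level \<open>k\<close> fits into the budget for
      \<open>n + 3\<close> levels, so both branches share one bound.\<close>
    have "{..<k} \<subseteq> {..<n + 3}" using step(2) by auto
    then have le: "(\<Sum>i<k. level_cost m l \<delta> i) \<le> (\<Sum>i<n + 3. level_cost m l \<delta> i)"
      "(\<Sum>i<k. 1 / (2 :: real) ^ (i + 5)) \<le> (\<Sum>i<n + 3. 1 / 2 ^ (i + 5))"
      by (intro sum_mono2 level_cost_nonneg assms(3); simp)+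
    have nonneg: "0 \<le> (\<Sum>i\<in>{Suc k..<n}. level_cost m l \<delta> i)" "0 \<le> (\<Sum>i\<in>{Suc k..<n}. 1 / (2 :: real) ^ (i + 5))"
      by (intro sum_nonneg level_cost_nonneg assms(3); simp)+
    show ?thesis
      by (rule estimates_max_mono[OF up add_increasing[OF nonneg(1) le(1)]
            add_increasing[OF nonneg(2) le(2)] subset_refl])
  qed
  moreover have "\<delta> * (3 / 2) ^ Suc k = 3 / 2 * g" by (simp add: g_def)
  then have "estimates_max m \<delta> (?B (Suc k)) (?E (Suc k)) (phases_below m hi)"
    using step(3) by (simp add: hi_def)
  ultimately have "estimates_max m \<delta> (level_cost m l \<delta> k + ?B (Suc k)) (?E (Suc k) + 1 / 2 ^ (k + 5))
      (phases_below m b)"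
  proof (rule estimates_max_if[OF assms(1) T(1)])
    fix \<phi> assume \<phi>: "\<phi> \<in> phases_below m b"
    show "p \<phi> \<le> 1 / 2 ^ (k + 5)" if "\<phi> \<notin> max_in m lo b"
      using \<phi> that by (intro T(4)) (auto simp: max_in_def not_le less_imp_le)
    show "1 - 1 / 2 ^ (k + 5) \<le> p \<phi>" if "\<phi> \<notin> phases_below m hi"
      using \<phi> that by (intro T(3)) (auto simp: not_le less_imp_le)
  next
    show "phases_below m b \<subseteq> max_in m lo b \<union> phases_below m hi"
      using conds(1,4) by (force simp: max_in_def)
  qed simp
  moreover have "{k..<n} = insert k {Suc k..<n}" using step(2) by auto
  then have "(\<Sum>i\<in>{k..<n}. f i) = f k + (\<Sum>i\<in>{Suc k..<n}. f i)" for f :: "nat \<Rightarrow> real" by simp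
  then have "?B k = level_cost m l \<delta> k + ?B (Suc k)" "?E k = ?E (Suc k) + 1 / 2 ^ (k + 5)"
    by (simp_all only: add_ac)
  ultimately show ?case unfolding b_def g_def by (simp only:)
qed

text \<open>The ratio of consecutive terms is largest at the start, where it is
  \<open>81 / 64 * 2 / 3 = 27 / 32\<close>.\<close>

lemma summable_level_series: "summable (\<lambda>k. (real k + 8)\<^sup>2 * (2 / 3) ^ k)"
proof (rule summable_ratio_test)
  fix n :: nat
  have "(real (Suc n) + 8)\<^sup>2 = real n * real n + 18 * real n + 81"
    "(real n + 8)\<^sup>2 = real n * real n + 16 * real n + 64" "0 \<le> real n * real n" "0 \<le> real n"
    by (simp_all add: power2_eq_square algebra_simps)
  then have "(real (Suc n) + 8)\<^sup>2 * (2 / 3) \<le> 27 / 32 * (real n + 8)\<^sup>2" by linarith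
  then have "((real (Suc n) + 8)\<^sup>2 * (2 / 3)) * (2 / 3) ^ n \<le> (27 / 32 * (real n + 8)\<^sup>2) * (2 / 3) ^ n"
    by (intro mult_right_mono) auto
  then show "norm ((real (Suc n) + 8)\<^sup>2 * (2 / 3) ^ Suc n) \<le> 27 / 32 * norm ((real n + 8)\<^sup>2 * (2 / 3) ^ n)"
    by (simp add: ac_simps)
qed simp

text \<open>The gap phase and the ternary search each cost at most the sum over all levels, and each
  err with probability at most \<open>1 / 16\<close>. Once \<open>l + 1\<close> is factored out, the
  sum is bounded by a convergent series, and the constant is twice
  \<open>1296 * \<Sigma>\<close>.\<close>

lemma max_estimation:
  "\<exists>C > 0. \<forall>m l \<delta>. 0 < m \<longrightarrow> m \<le> 2 ^ l \<longrightarrow> 0 < \<delta> \<longrightarrow> \<delta> \<le> 4 \<longrightarrow>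
    estimates_max m \<delta> (C * sqrt (real m) * real (l + 1) / \<delta>) (1 / 8) (phases_below m (2 * pi - 2 * \<delta>))"
proof -
  define \<Sigma> where "\<Sigma> = (\<Sum>k. (real k + 8)\<^sup>2 * (2 / 3) ^ k)"
  have \<Sigma>: "(\<Sum>i<n. (real i + 8)\<^sup>2 * (2 / 3) ^ i) \<le> \<Sigma>" for n
    unfolding \<Sigma>_def by (intro sum_le_suminf summable_level_series) auto
  then have \<Sigma>0: "0 < \<Sigma>" using \<Sigma>[of 1] by simp
  show ?thesis
  proof (intro exI[of _ "2592 * \<Sigma>"] conjI allI impI)
    show "0 < 2592 * \<Sigma>" using \<Sigma>0 by simp
    fix m l :: nat and \<delta> :: real assume m: "0 < m" "m \<le> 2 ^ l" and \<delta>: "0 < \<delta>" "\<delta> \<le> 4"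
    obtain n0 where "1 / \<delta> < (3 / 2) ^ n0" using real_arch_pow[of "3 / 2" "1 / \<delta>"] by auto
    then have n0: "1 \<le> \<delta> * (3 / 2) ^ n0" using \<delta> by (simp add: field_simps)
    define n where "n = (LEAST n. 1 \<le> \<delta> * (3 / 2) ^ n)"
    have n1: "1 \<le> \<delta> * (3 / 2) ^ n" unfolding n_def using n0 by (rule LeastI)
    have n2: "\<delta> * (3 / 2) ^ k < 1" if "k < n" for k
      using not_less_Least[of k "\<lambda>n. 1 \<le> \<delta> * (3 / 2) ^ n"] that unfolding n_def by simp
    \<comment> \<open>For \<open>n > 0\<close> minimality even gives \<open>3 / 2\<close>; for
      \<open>n = 0\<close> this is the assumption on \<open>\<delta>\<close>.\<close>
    have n3: "\<delta> * (3 / 2) ^ n \<le> 4"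
    proof (cases n)
      case (Suc n')
      then show ?thesis using n2[of n'] by simp
    qed (use \<delta> in simp)
    have cost: "(\<Sum>i<n + 3. level_cost m l \<delta> i) \<le> 1296 * sqrt (real m) * real (l + 1) / \<delta> * \<Sigma>"
    proof -
      have "(\<Sum>i<n + 3. level_cost m l \<delta> i) \<le>
          (\<Sum>i<n + 3. 1296 * sqrt (real m) * real (l + 1) / \<delta> * ((real i + 8)\<^sup>2 * (2 / 3) ^ i))"
      proof (rule sum_mono)
        fix i
        \<comment> \<open>Separates \<open>l\<close> from \<open>i\<close> at the price of one
          factor \<open>i + 8\<close>.\<close>
        have "real (i + 5) * real (l + i + 8) \<le> (real i + 8) * ((real i + 8) * real (l + 1))"
        proof (rule mult_mono)
          have "0 \<le> real i * real l + 7 * real l" by simp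
          then show "real (l + i + 8) \<le> (real i + 8) * real (l + 1)" by (simp add: algebra_simps)
        qed auto
        then have "1296 * sqrt (real m) / (\<delta> * (3 / 2) ^ i) * (real (i + 5) * real (l + i + 8)) \<le>
            1296 * sqrt (real m) / (\<delta> * (3 / 2) ^ i) * ((real i + 8) * ((real i + 8) * real (l + 1)))"
          using \<delta> by (intro mult_left_mono) auto
        moreover have "(2 / 3 :: real) ^ i = 1 / (3 / 2) ^ i" by (simp add: power_divide)
        ultimately show "level_cost m l \<delta> i \<le> 1296 * sqrt (real m) * real (l + 1) / \<delta> * ((real i + 8)\<^sup>2 * (2 / 3) ^ i)"
          unfolding level_cost_def power2_eq_square by (simp add: ac_simps del: of_nat_add distrib_left_numeral distrib_right_numeral)
      qed
      also have "\<dots> \<le> 1296 * sqrt (real m) * real (l + 1) / \<delta> * \<Sigma>"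
        unfolding sum_distrib_left[symmetric] using \<delta> by (intro mult_left_mono \<Sigma>) auto
      finally show ?thesis .
    qed
    have err: "(\<Sum>i<n + 3. 1 / (2 :: real) ^ (i + 5)) \<le> 1 / 16"
    proof -
      have "(\<Sum>i<k. 1 / (2 :: real) ^ (i + 5)) = 1 / 16 - 1 / 2 ^ (k + 4)" for k
      proof (induction k)
        case (Suc k)
        have "1 / (2 :: real) ^ (k + 4) = 2 * (1 / 2 ^ (k + 5))" "1 / (2 :: real) ^ (Suc k + 4) = 1 / 2 ^ (k + 5)"
          by (simp_all add: power_add)
        then show ?case using Suc by simp
      qed simp
      then show ?thesis by simp
    qed
    have "(\<Sum>i\<in>{0..<n}. level_cost m l \<delta> i) \<le> (\<Sum>i<n + 3. level_cost m l \<delta> i)"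
      "(\<Sum>i\<in>{0..<n}. 1 / (2 :: real) ^ (i + 5)) \<le> (\<Sum>i<n + 3. 1 / 2 ^ (i + 5))"
      using level_cost_nonneg[OF \<delta>(1)] by (intro sum_mono2; auto)+
    note le = this
    show "estimates_max m \<delta> (2592 * \<Sigma> * sqrt (real m) * real (l + 1) / \<delta>) (1 / 8)
        (phases_below m (2 * pi - 2 * \<delta>))"
    proof (rule estimates_max_mono[OF estimates_max_gap[OF m \<delta>(1) n1 n3 n2, of 0]])
      have "2592 * \<Sigma> * sqrt (real m) * real (l + 1) / \<delta> = 2 * (1296 * sqrt (real m) * real (l + 1) / \<delta> * \<Sigma>)"
        by simp
      then show "(\<Sum>i\<in>{0..<n}. level_cost m l \<delta> i) + (\<Sum>i<n + 3. level_cost m l \<delta> i) \<le>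
          2592 * \<Sigma> * sqrt (real m) * real (l + 1) / \<delta>"
        using le(1) cost by linarith
      show "(\<Sum>i\<in>{0..<n}. 1 / (2 :: real) ^ (i + 5)) + (\<Sum>i<n + 3. 1 / 2 ^ (i + 5)) \<le> 1 / 8"
        using le(2) err by linarith
    qed simp_all
  qed
qed

section \<open>Digits and products of families of vectors\<close>

text \<open>The digits of an index of the copies register name the basis states of the single
  copies. The leftmost tensor factor has the most significant digit, as in
  \<open>tensor_power\<close>.\<close>

definition dig :: "nat \<Rightarrow> nat \<Rightarrow> nat \<Rightarrow> nat" where
  "dig N i y = y div N ^ i mod N"

definition undig :: "nat \<Rightarrow> nat \<Rightarrow> (nat \<Rightarrow> nat) \<Rightarrow> nat" where
  "undig N m f = (\<Sum>i<m. f i * N ^ i)"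

lemma dig_less: "0 < N \<Longrightarrow> dig N i y < N"
  by (simp add: dig_def)

lemma dig_split:
  assumes "y' < N ^ m" "x < N"
  shows "dig N m (x * N ^ m + y') = x" "i < m \<Longrightarrow> dig N i (x * N ^ m + y') = dig N i y'"
proof -
  show "dig N m (x * N ^ m + y') = x" using assms by (simp add: dig_def)
  assume i: "i < m"
  \<comment> \<open>\<open>x * N ^ m\<close> is a multiple of \<open>N ^ Suc i\<close> and so does
    not affect digit \<open>i\<close>.\<close>
  then have "m = i + Suc (m - Suc i)" by simp
  then have "N ^ m = N ^ i * (N * N ^ (m - Suc i))" by (metis power_Suc power_add)
  then have e: "x * N ^ m + y' = y' + (x * N ^ (m - Suc i) * N) * N ^ i" by (simp only: ac_simps)
  show "dig N i (x * N ^ m + y') = dig N i y'" unfolding dig_def e using assms(2) by simp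
qed

lemma undig_less: "(\<And>i. i < m \<Longrightarrow> f i < N) \<Longrightarrow> undig N m f < N ^ m"
proof (induction m)
  case (Suc m)
  then have "undig N m f < N ^ m" "f m < N" by auto
  then show ?case using mult_less_bound[of "f m" N "undig N m f" "N ^ m"]
    by (simp add: undig_def add.commute)
qed (simp add: undig_def)

lemma dig_undig:
  "(\<And>i. i < m \<Longrightarrow> f i < N) \<Longrightarrow> i < m \<Longrightarrow> dig N i (undig N m f) = f i"
proof (induction m)
  case (Suc m)
  have lt: "undig N m f < N ^ m" "f m < N" using Suc.prems undig_less[of m f N] by auto
  have "undig N (Suc m) f = f m * N ^ m + undig N m f" by (simp add: undig_def)
  then show ?case using dig_split(1)[OF lt] dig_split(2)[OF lt, of i] Suc by (cases "i = m") auto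
qed simp

lemma undig_dig: "y < N ^ m \<Longrightarrow> undig N m (\<lambda>i. dig N i y) = y"
proof (induction m arbitrary: y)
  case (Suc m)
  define x where "x = y div N ^ m"
  define y' where "y' = y mod N ^ m"
  have "y < N * N ^ m" using Suc.prems by simp
  then have lt: "y' < N ^ m" "x < N" unfolding x_def y'_def using divmod_nat_less[of y N "N ^ m"] by auto
  have y: "y = x * N ^ m + y'" unfolding x_def y'_def by (rule div_mult_mod_eq[symmetric])
  have "undig N (Suc m) (\<lambda>i. dig N i y) = undig N m (\<lambda>i. dig N i y) + x * N ^ m"
    unfolding y using dig_split(1)[OF lt] by (simp add: undig_def)
  also have "undig N m (\<lambda>i. dig N i y) = undig N m (\<lambda>i. dig N i y')"
    unfolding undig_def y using dig_split(2)[OF lt] by (intro sum.cong) auto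
  finally show ?case using Suc.IH[OF lt(1)] y by simp
qed (simp add: undig_def)

text \<open>The distributive law, with tuples encoded by their digits. It factorises inner products
  of product vectors and probabilities of independent samples.\<close>

lemma sum_prod_dig:
  fixes g :: "nat \<Rightarrow> nat \<Rightarrow> 'a::comm_semiring_1"
  shows "(\<Sum>y<N ^ m. \<Prod>i<m. g i (dig N i y)) = (\<Prod>i<m. \<Sum>x<N. g i x)"
proof (induction m)
  case (Suc m)
  have "(\<Sum>y<N ^ Suc m. \<Prod>i<Suc m. g i (dig N i y)) =
      (\<Sum>x<N. \<Sum>y<N ^ m. \<Prod>i<Suc m. g i (dig N i (x * N ^ m + y)))"
    unfolding power_Suc sum_lessThan_times ..
  also have "\<dots> = (\<Sum>x<N. \<Sum>y<N ^ m. (\<Prod>i<m. g i (dig N i y)) * g m x)"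
    by (intro sum.cong refl) (simp add: dig_split)
  also have "\<dots> = (\<Sum>y<N ^ m. \<Prod>i<m. g i (dig N i y)) * (\<Sum>x<N. g m x)"
    by (simp add: sum_product, subst sum.swap, rule refl)
  finally show ?case using Suc by simp
qed simp

definition set_dig :: "nat \<Rightarrow> nat \<Rightarrow> nat \<Rightarrow> nat \<Rightarrow> nat \<Rightarrow> nat" where
  "set_dig N m i x y = undig N m (\<lambda>k. if k = i then x else dig N k y)"

lemma set_dig_props:
  assumes "x < N"
  shows "set_dig N m i x y < N ^ m"
    "k < m \<Longrightarrow> dig N k (set_dig N m i x y) = (if k = i then x else dig N k y)"
  unfolding set_dig_def using assms dig_less[of N] by (auto intro!: undig_less simp: dig_undig)

text \<open>Writing the old digit back restores the number. This makes \<open>copy_swap\<close> an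
  involution.\<close>

lemma set_dig_set_dig:
  assumes "x < N" "y < N ^ m" "i < m"
  shows "set_dig N m i (dig N i y) (set_dig N m i x y) = y"
proof -
  have "set_dig N m i (dig N i y) (set_dig N m i x y) = undig N m (\<lambda>k. dig N k y)"
    unfolding set_dig_def[of N m i "dig N i y"] undig_def
    using set_dig_props(2)[OF assms(1)] by (intro sum.cong) auto
  then show ?thesis using undig_dig[OF assms(2)] by simp
qed

text \<open>Unlike \<open>tensor_power\<close>, it allows different factors, as products of
  eigenvectors require.\<close>

definition prod_vec :: "nat \<Rightarrow> nat \<Rightarrow> (nat \<Rightarrow> complex vec) \<Rightarrow> complex vec" where
  "prod_vec N m v = vec (N ^ m) (\<lambda>y. \<Prod>i<m. v i $ dig N i y)"

lemma prod_vec_carrier [simp]: "prod_vec N m v \<in> carrier_vec (N ^ m)"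
  by (simp add: prod_vec_def)

lemma prod_vec_dim [simp]: "dim_vec (prod_vec N m v) = N ^ m"
  by (simp add: prod_vec_def)

lemma tensor_power_eq_prod_vec:
  assumes "\<alpha> \<in> carrier_vec N"
  shows "tensor_power \<alpha> m = prod_vec N m (\<lambda>_. \<alpha>)"
proof (induction m)
  case 0
  show ?case by (intro eq_vecI) (auto simp: prod_vec_def)
next
  case (Suc m)
  show ?case
  proof (intro eq_vecI)
    fix y assume "y < dim_vec (prod_vec N (Suc m) (\<lambda>_. \<alpha>))"
    then have y: "y < N * N ^ m" by simp
    define x where "x = y div N ^ m"
    define y' where "y' = y mod N ^ m"
    have lt: "y' < N ^ m" "x < N" unfolding x_def y'_def using divmod_nat_less[OF y] by auto
    have y_eq: "y = x * N ^ m + y'" unfolding x_def y'_def by (rule div_mult_mod_eq[symmetric])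
    have "tensor_power \<alpha> (Suc m) $ y = \<alpha> $ x * (\<Prod>i<m. \<alpha> $ dig N i y')"
      using assms y Suc lt by (simp add: x_def y'_def prod_vec_def)
    also have "\<dots> = prod_vec N (Suc m) (\<lambda>_. \<alpha>) $ y"
      using y by (simp add: prod_vec_def) (simp add: y_eq dig_split[OF lt] mult.commute)
    finally show "tensor_power \<alpha> (Suc m) $ y = prod_vec N (Suc m) (\<lambda>_. \<alpha>) $ y" .
  qed (use assms Suc in simp)
qed

section \<open>Linear combinations and permutation matrices\<close>

definition lincomb_vec :: "nat \<Rightarrow> 'k set \<Rightarrow> ('k \<Rightarrow> complex) \<Rightarrow> ('k \<Rightarrow> complex vec) \<Rightarrow> complex vec" where
  "lincomb_vec D K c f = vec D (\<lambda>z. \<Sum>k\<in>K. c k * f k $ z)"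

lemma lincomb_vec_carrier [simp]: "lincomb_vec D K c f \<in> carrier_vec D"
  by (simp add: lincomb_vec_def)

lemma mult_mat_lincomb_vec:
  assumes "A \<in> carrier_mat D D" "\<And>k. k \<in> K \<Longrightarrow> f k \<in> carrier_vec D"
  shows "A *\<^sub>v lincomb_vec D K c f = lincomb_vec D K c (\<lambda>k. A *\<^sub>v f k)"
proof (intro eq_vecI)
  fix z assume "z < dim_vec (lincomb_vec D K c (\<lambda>k. A *\<^sub>v f k))"
  then have z: "z < D" by (simp add: lincomb_vec_def)
  have A: "dim_row A = D" "dim_col A = D" using assms(1) by auto
  have "(A *\<^sub>v lincomb_vec D K c f) $ z = (\<Sum>x<D. A $$ (z, x) * (\<Sum>k\<in>K. c k * f k $ x))"
    using z A by (subst mult_mat_vec_index_sum) (auto simp: lincomb_vec_def)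
  also have "\<dots> = (\<Sum>k\<in>K. c k * (\<Sum>x<D. A $$ (z, x) * f k $ x))"
    unfolding sum_distrib_left by (subst sum.swap) (simp add: ac_simps)
  also have "\<dots> = (\<Sum>k\<in>K. c k * (A *\<^sub>v f k) $ z)"
    using z A carrier_vecD[OF assms(2)] by (intro sum.cong refl) (subst mult_mat_vec_index_sum, auto)
  also have "\<dots> = lincomb_vec D K c (\<lambda>k. A *\<^sub>v f k) $ z" using z by (simp add: lincomb_vec_def)
  finally show "(A *\<^sub>v lincomb_vec D K c f) $ z = lincomb_vec D K c (\<lambda>k. A *\<^sub>v f k) $ z" .
qed (use assms in \<open>simp add: lincomb_vec_def\<close>)

text \<open>It sends basis state \<open>\<sigma> z\<close> to \<open>z\<close>. For the involution
  \<open>copy_swap\<close> the direction makes no difference.\<close>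

definition perm_mat :: "nat \<Rightarrow> (nat \<Rightarrow> nat) \<Rightarrow> complex mat" where
  "perm_mat D \<sigma> = mat D D (\<lambda>(i, j). if j = \<sigma> i then 1 else 0)"

lemma perm_mat_carrier [simp]: "perm_mat D \<sigma> \<in> carrier_mat D D"
  by (simp add: perm_mat_def)

lemma perm_mat_mult_vec_index:
  assumes "v \<in> carrier_vec D" "z < D" "\<sigma> z < D"
  shows "(perm_mat D \<sigma> *\<^sub>v v) $ z = v $ \<sigma> z"
proof -
  have "(perm_mat D \<sigma> *\<^sub>v v) $ z = (\<Sum>k<D. perm_mat D \<sigma> $$ (z, k) * v $ k)"
    using assms carrier_vecD[OF assms(1)] by (subst mult_mat_vec_index_sum) (auto simp: perm_mat_def)
  also have "\<dots> = (\<Sum>k<D. if k = \<sigma> z then v $ \<sigma> z else 0)"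
    using assms by (intro sum.cong refl) (auto simp: perm_mat_def)
  finally show ?thesis using assms by simp
qed

lemma unitary_perm_mat:
  assumes "\<And>z. z < D \<Longrightarrow> \<sigma> z < D" "inj_on \<sigma> {..<D}"
  shows "unitary_mat D (perm_mat D \<sigma>)"
proof (rule unitary_matI)
  fix i j assume ij: "i < D" "j < D"
  have "(\<Sum>k<D. perm_mat D \<sigma> $$ (i, k) * cnj (perm_mat D \<sigma> $$ (j, k))) =
      (\<Sum>k<D. if k = \<sigma> i then (if \<sigma> i = \<sigma> j then 1 else 0) else 0)"
    using ij by (intro sum.cong refl) (auto simp: perm_mat_def)
  also have "\<dots> = (if i = j then 1 else 0)"
    using ij assms inj_on_eq_iff[OF assms(2), of i j] by simp
  finally show "(\<Sum>k<D. perm_mat D \<sigma> $$ (i, k) * cnj (perm_mat D \<sigma> $$ (j, k))) = (if i = j then 1 else 0)" .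
qed simp

lemma tensor_vec_smult_left: "(c \<cdot>\<^sub>v v) \<otimes>\<^sub>v w = c \<cdot>\<^sub>v (v \<otimes>\<^sub>v w)"
  by (intro eq_vecI) auto

lemma tensor_vec_index_pair:
  assumes "j < dim_vec w" "i < dim_vec v"
  shows "(v \<otimes>\<^sub>v w) $ (i * dim_vec w + j) = v $ i * w $ j"
  using assms mult_less_bound[OF assms(2,1)] by simp

section \<open>Simulating a phase circuit on products of eigenvectors\<close>

definition ket :: "nat \<Rightarrow> nat \<Rightarrow> complex vec \<Rightarrow> nat \<Rightarrow> nat \<Rightarrow> complex vec \<Rightarrow> complex vec" where
  "ket N d v b a w = v \<otimes>\<^sub>v unit_vec 2 b \<otimes>\<^sub>v unit_vec d a \<otimes>\<^sub>v w"

text \<open>The index of the basis state with first register \<open>x\<close>, control qubit \<open>b\<close>, ancilla \<open>a\<close>, copies \<open>y\<close>.\<close>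
definition enc :: "nat \<Rightarrow> nat \<Rightarrow> nat \<Rightarrow> nat \<Rightarrow> nat \<Rightarrow> nat \<Rightarrow> nat" where
  "enc d M x b a y = x * (2 * (d * M)) + (b * (d * M) + (a * M + y))"

lemma enc_less:
  assumes "x < N" "b < 2" "a < d" "y < M"
  shows "enc d M x b a y < N * (2 * (d * M))" "a * M + y < d * M" "b * (d * M) + (a * M + y) < 2 * (d * M)"
proof -
  show 1: "a * M + y < d * M" using assms by (intro mult_less_bound)
  show 2: "b * (d * M) + (a * M + y) < 2 * (d * M)" using assms by (intro mult_less_bound 1)
  show "enc d M x b a y < N * (2 * (d * M))" unfolding enc_def using assms by (intro mult_less_bound 2)
qed

lemma enc_cases:
  assumes "z < N * (2 * (d * M))"
  obtains x b a y where "x < N" "b < 2" "a < d" "y < M" "z = enc d M x b a y"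
proof
  define z1 where "z1 = z mod (2 * (d * M))"
  define z2 where "z2 = z1 mod (d * M)"
  have z1: "z1 < 2 * (d * M)" unfolding z1_def by (rule divmod_nat_less[OF assms])
  have z2: "z2 < d * M" unfolding z2_def by (rule divmod_nat_less[OF z1])
  show "z div (2 * (d * M)) < N" "z1 div (d * M) < 2" "z2 div M < d" "z2 mod M < M"
    by (rule divmod_nat_less[OF assms] divmod_nat_less[OF z1] divmod_nat_less[OF z2])+
  show "z = enc d M (z div (2 * (d * M))) (z1 div (d * M)) (z2 div M) (z2 mod M)"
    unfolding enc_def by (simp only: z1_def z2_def div_mult_mod_eq)
qed

definition dec :: "nat \<Rightarrow> nat \<Rightarrow> nat \<Rightarrow> nat \<times> nat \<times> nat \<times> nat" where
  "dec d M z = (z div (2 * (d * M)), z mod (2 * (d * M)) div (d * M),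
     z mod (2 * (d * M)) mod (d * M) div M, z mod (2 * (d * M)) mod (d * M) mod M)"

lemma dec_enc:
  assumes "b < 2" "a < d" "y < M"
  shows "dec d M (enc d M x b a y) = (x, b, a, y)"
  using assms enc_less(2,3)[of 0 1 b a d y M] unfolding dec_def enc_def
  by (simp only: divmod_nat_eqs zero_less_one)

lemma ket_index:
  assumes "v \<in> carrier_vec N" "w \<in> carrier_vec M" "x < N" "b' < 2" "a' < d" "y < M"
  shows "ket N d v b a w $ enc d M x b' a' y = (if b' = b \<and> a' = a then v $ x * w $ y else 0)"
proof -
  have "dim_vec w = M" "dim_vec v = N" using assms by auto
  then have "ket N d v b a w $ enc d M x b' a' y = v $ x * (unit_vec 2 b $ b' * (unit_vec d a $ a' * w $ y))"
    using enc_less[OF assms(3-6)] assms(3-6)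
      tensor_vec_index_pair[of y w a' "unit_vec d a"]
      tensor_vec_index_pair[of "a' * M + y" "unit_vec d a \<otimes>\<^sub>v w" b' "unit_vec 2 b"]
      tensor_vec_index_pair[of "b' * (d * M) + (a' * M + y)" "unit_vec 2 b \<otimes>\<^sub>v unit_vec d a \<otimes>\<^sub>v w" x v]
    unfolding ket_def enc_def by (simp only: tensor_vec_dim index_unit_vec dim_vec)
  then show ?thesis using assms by (auto simp: unit_vec_def)
qed

lemma ket_carrier:
  "v \<in> carrier_vec N \<Longrightarrow> w \<in> carrier_vec M \<Longrightarrow> ket N d v b a w \<in> carrier_vec (N * (2 * (d * M)))"
  unfolding ket_def by (intro tensor_vec_carrier) auto

text \<open>On ancilla state \<open>a\<close>, the first register is exchanged with copy \<open>i a\<close>, and the control qubit is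
  flipped if \<open>s a\<close> holds.\<close>
definition copy_swap :: "nat \<Rightarrow> nat \<Rightarrow> nat \<Rightarrow> (nat \<Rightarrow> nat) \<Rightarrow> (nat \<Rightarrow> bool) \<Rightarrow> nat \<Rightarrow> nat" where
  "copy_swap N m d i s z = (case dec d (N ^ m) z of (x, b, a, y) \<Rightarrow>
     enc d (N ^ m) (dig N (i a) y) (if s a then 1 - b else b) a (set_dig N m (i a) x y))"

lemma copy_swap_enc:
  "b < 2 \<Longrightarrow> a < d \<Longrightarrow> y < N ^ m \<Longrightarrow> copy_swap N m d i s (enc d (N ^ m) x b a y) =
     enc d (N ^ m) (dig N (i a) y) (if s a then 1 - b else b) a (set_dig N m (i a) x y)"
  by (simp add: copy_swap_def dec_enc)

lemma copy_swap_less: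
  assumes "z < N * (2 * (d * N ^ m))"
  shows "copy_swap N m d i s z < N * (2 * (d * N ^ m))"
proof -
  obtain x b a y where z: "x < N" "b < 2" "a < d" "y < N ^ m" "z = enc d (N ^ m) x b a y"
    using enc_cases[OF assms] by blast
  then have "0 < N" by simp
  then show ?thesis unfolding z(5) copy_swap_enc[OF z(2-4)]
    using z by (intro enc_less(1)) (auto simp: dig_less set_dig_props)
qed

lemma copy_swap_copy_swap:
  assumes "z < N * (2 * (d * N ^ m))" "\<And>a. i a < m"
  shows "copy_swap N m d i s (copy_swap N m d i s z) = z"
proof -
  obtain x b a y where z: "x < N" "b < 2" "a < d" "y < N ^ m" "z = enc d (N ^ m) x b a y"
    using enc_cases[OF assms(1)] by blast
  have b: "(if s a then 1 - b else b) < 2" "(if s a then 1 - (if s a then 1 - b else b) else if s a then 1 - b else b) = b"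
    using z(2) by auto
  show ?thesis
    unfolding z(5) copy_swap_enc[OF z(2-4)] copy_swap_enc[OF b(1) z(3) set_dig_props(1)[OF z(1)]] b(2)
      set_dig_props(2)[OF z(1) assms(2)] set_dig_set_dig[OF z(1,4) assms(2)] by simp
qed

abbreviation swap_mat :: "nat \<Rightarrow> nat \<Rightarrow> nat \<Rightarrow> (nat \<Rightarrow> nat) \<Rightarrow> (nat \<Rightarrow> bool) \<Rightarrow> complex mat" where
  "swap_mat N m d i s \<equiv> perm_mat (N * (2 * (d * N ^ m))) (copy_swap N m d i s)"

lemma unitary_copy_swap:
  assumes "\<And>a. i a < m"
  shows "unitary_mat (N * (2 * (d * N ^ m))) (swap_mat N m d i s)"
proof (rule unitary_perm_mat)
  show "inj_on (copy_swap N m d i s) {..<N * (2 * (d * N ^ m))}"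
    by (rule inj_on_inverseI[where g = "copy_swap N m d i s"]) (simp add: copy_swap_copy_swap assms)
qed (rule copy_swap_less)

lemma copy_swap_mult_twice:
  assumes "\<And>a. i a < m" "f \<in> carrier_vec (N * (2 * (d * N ^ m)))"
  shows "swap_mat N m d i s *\<^sub>v
    (swap_mat N m d i s *\<^sub>v f) = f"
proof (intro eq_vecI)
  fix z assume "z < dim_vec f"
  then have z: "z < N * (2 * (d * N ^ m))" using assms(2) by simp
  have c: "swap_mat N m d i s *\<^sub>v f \<in> carrier_vec (N * (2 * (d * N ^ m)))"
    using assms(2) by (meson mult_mat_vec_carrier perm_mat_carrier)
  show "(swap_mat N m d i s *\<^sub>v
    (swap_mat N m d i s *\<^sub>v f)) $ z = f $ z"
    using z copy_swap_less[OF z, of i s] copy_swap_less[OF copy_swap_less[OF z, of i s], of i s]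
    by (simp only: perm_mat_mult_vec_index[OF c] perm_mat_mult_vec_index[OF assms(2)]
        copy_swap_copy_swap[OF z assms(1)])
qed (use assms(2) in \<open>simp add: perm_mat_def\<close>)

text \<open>Queries act on the first register only, so an eigenvector has to be moved there; the
  idle state of that register takes its place among the copies. The control qubit records whether
  the query is to happen.\<close>

lemma copy_swap_ket:
  assumes "0 < N" "\<And>a. i a < m" "\<And>k. v k \<in> carrier_vec N" "a < d"
  shows "swap_mat N m d i s *\<^sub>v ket N d (unit_vec N 0) 0 a (prod_vec N m v) =
    ket N d (v (i a)) (if s a then 1 else 0) a (prod_vec N m (v(i a := unit_vec N 0)))" (is "?P *\<^sub>v ?f = ?g")
proof (intro eq_vecI)
  have f: "?f \<in> carrier_vec (N * (2 * (d * N ^ m)))" and g: "?g \<in> carrier_vec (N * (2 * (d * N ^ m)))"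
    using assms by (auto intro!: ket_carrier)
  show "dim_vec (?P *\<^sub>v ?f) = dim_vec ?g" using f g by (simp add: perm_mat_def)
  fix z assume "z < dim_vec ?g"
  then have z_less: "z < N * (2 * (d * N ^ m))" using g by simp
  then obtain x b a' y where z: "x < N" "b < 2" "a' < d" "y < N ^ m" "z = enc d (N ^ m) x b a' y"
    using enc_cases by blast
  have b: "(if s a' then 1 - b else b) < 2" "(if s a' then 1 - b else b) = 0 \<longleftrightarrow> b = (if s a' then 1 else 0)"
    using z(2) by auto
  have e0: "unit_vec N 0 $ dig N k y = (if dig N k y = 0 then 1 else (0 :: complex))" for k
    using assms(1) dig_less[OF assms(1), of k y] by (simp add: unit_vec_def)
  have split: "(\<Prod>k<m. h k) = h (i a) * (\<Prod>k\<in>{..<m} - {i a}. h k)" for h :: "nat \<Rightarrow> complex"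
    using assms(2) by (intro prod.remove) auto
  have "(?P *\<^sub>v ?f) $ z = ?f $ enc d (N ^ m) (dig N (i a') y) (if s a' then 1 - b else b) a' (set_dig N m (i a') x y)"
    using perm_mat_mult_vec_index[OF f z_less, of "copy_swap N m d i s", OF copy_swap_less[OF z_less]] by (simp only: z(5) copy_swap_enc[OF z(2-4)])
  also have "\<dots> = (if b = (if s a' then 1 else 0) \<and> a' = a then
      unit_vec N 0 $ dig N (i a') y * prod_vec N m v $ set_dig N m (i a') x y else 0)"
    using assms dig_less[OF assms(1)] b z by (subst ket_index[of _ N _ "N ^ m"]) (auto simp: set_dig_props)
  also have "\<dots> = (if b = (if s a then 1 else 0) \<and> a' = a then
      v (i a) $ x * prod_vec N m (v(i a := unit_vec N 0)) $ y else 0)"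
  proof (cases "b = (if s a' then 1 else 0) \<and> a' = a")
    case True
    have "prod_vec N m v $ set_dig N m (i a) x y = v (i a) $ x * (\<Prod>k\<in>{..<m} - {i a}. v k $ dig N k y)"
    proof -
      have "(\<Prod>k\<in>{..<m} - {i a}. v k $ dig N k (set_dig N m (i a) x y)) =
          (\<Prod>k\<in>{..<m} - {i a}. v k $ dig N k y)"
        using set_dig_props[OF z(1)] by (intro prod.cong) auto
      then show ?thesis
        unfolding prod_vec_def using set_dig_props[OF z(1)] assms(2)[of a] by (simp add: split)
    qed
    moreover have "prod_vec N m (v(i a := unit_vec N 0)) $ y =
        unit_vec N 0 $ dig N (i a) y * (\<Prod>k\<in>{..<m} - {i a}. v k $ dig N k y)"
      unfolding prod_vec_def using z(4) by (simp add: split)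
    ultimately show ?thesis using True by simp
  qed auto
  also have "\<dots> = ?g $ z"
    unfolding z(5) using assms z by (subst ket_index[of _ N _ "N ^ m"]) auto
  finally show "(?P *\<^sub>v ?f) $ z = ?g $ z" .
qed

lemma controlled_carrier:
  "V \<in> carrier_mat N N \<Longrightarrow> controlled N r V \<in> carrier_mat (N * (2 * r)) (N * (2 * r))"
  unfolding controlled_def qubit_proj_def by (intro add_carrier_mat tensor_mat_carrier) auto

lemma qubit_proj_mult: "b < 2 \<Longrightarrow> qubit_proj c *\<^sub>v unit_vec 2 b = (if b = c then unit_vec 2 b else 0\<^sub>v 2)"
  by (intro eq_vecI) (auto simp: qubit_proj_def mult_mat_vec_index_sum unit_vec_def numeral_2_eq_2 lessThan_Suc less_Suc_eq simp del: index_mult_mat_vec)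

lemma tensor_zero_vec: "0\<^sub>v n \<otimes>\<^sub>v w = 0\<^sub>v (n * dim_vec w)" "w \<otimes>\<^sub>v 0\<^sub>v n = 0\<^sub>v (dim_vec w * n)"
  by (intro eq_vecI; simp)+

lemma controlled_ket:
  assumes "V \<in> carrier_mat N N" "v \<in> carrier_vec N" "w \<in> carrier_vec M" "b < 2"
  shows "controlled N (d * M) V *\<^sub>v ket N d v b a w = ket N d (if b = 1 then V *\<^sub>v v else v) b a w"
proof -
  define w' where "w' = unit_vec d a \<otimes>\<^sub>v w"
  have w': "w' \<in> carrier_vec (d * M)" unfolding w'_def using assms by auto
  have q: "qubit_proj c \<in> carrier_mat 2 2" for c by (simp add: qubit_proj_def)
  have Vv: "V *\<^sub>v v \<in> carrier_vec N" using assms by (meson mult_mat_vec_carrier)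
  have part: "(X \<otimes>\<^sub>m qubit_proj c \<otimes>\<^sub>m 1\<^sub>m (d * M)) *\<^sub>v (v \<otimes>\<^sub>v unit_vec 2 b \<otimes>\<^sub>v w') =
      (if b = c then (X *\<^sub>v v) \<otimes>\<^sub>v unit_vec 2 b \<otimes>\<^sub>v w' else 0\<^sub>v (N * (2 * (d * M))))"
    if "X \<in> carrier_mat N N" for X c
    using assms that w' q carrier_vecD[OF w'] carrier_matD[OF that]
    by (subst tensor_mat_vec_mult[of _ N N _ "2 * (d * M)" "2 * (d * M)"])
      (auto simp: tensor_mat_vec_mult[of _ 2 2 _ "d * M" "d * M"] qubit_proj_mult tensor_zero_vec)
  have c: "v \<otimes>\<^sub>v unit_vec 2 b \<otimes>\<^sub>v w' \<in> carrier_vec (N * (2 * (d * M)))"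
    "(V *\<^sub>v v) \<otimes>\<^sub>v unit_vec 2 b \<otimes>\<^sub>v w' \<in> carrier_vec (N * (2 * (d * M)))"
    using assms w' Vv by (intro tensor_vec_carrier; simp)+
  have "controlled N (d * M) V *\<^sub>v (v \<otimes>\<^sub>v unit_vec 2 b \<otimes>\<^sub>v w') =
      (1\<^sub>m N \<otimes>\<^sub>m qubit_proj 0 \<otimes>\<^sub>m 1\<^sub>m (d * M)) *\<^sub>v (v \<otimes>\<^sub>v unit_vec 2 b \<otimes>\<^sub>v w') +
      (V \<otimes>\<^sub>m qubit_proj 1 \<otimes>\<^sub>m 1\<^sub>m (d * M)) *\<^sub>v (v \<otimes>\<^sub>v unit_vec 2 b \<otimes>\<^sub>v w')"
    unfolding controlled_def
    using assms q c by (intro add_mult_distrib_mat_vec[of _ "N * (2 * (d * M))" "N * (2 * (d * M))"] tensor_mat_carrier) auto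
  also have "\<dots> = (if b = 1 then V *\<^sub>v v else v) \<otimes>\<^sub>v unit_vec 2 b \<otimes>\<^sub>v w'"
    unfolding part[OF one_carrier_mat] part[OF assms(1)]
    using assms(2,4) c by (auto simp: less_2_cases_iff)
  finally show ?thesis unfolding ket_def w'_def .
qed

section \<open>Action of the input on its eigenvectors\<close>

lemma cscalar_prod_sum: "dim_vec v = n \<Longrightarrow> dim_vec w = n \<Longrightarrow> v \<bullet>c w = (\<Sum>i<n. v $ i * cnj (w $ i))"
  by (auto simp: scalar_prod_def atLeast0LessThan intro!: sum.cong)

text \<open>The coefficients are arbitrary, so that both \<open>U\<close> and its adjoint are
  covered.\<close>

lemma spectral_sum_mult:
  assumes "\<forall>j<N. u j \<in> carrier_vec N" "\<forall>j<N. \<forall>k<N. u j \<bullet>c u k = (if j = k then 1 else 0)" "k < N"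
  shows "mat N N (\<lambda>(a, b). \<Sum>j<N. c j * u j $ a * cnj (u j $ b)) *\<^sub>v u k = c k \<cdot>\<^sub>v u k"
proof (intro eq_vecI)
  have dim: "dim_vec (u j) = N" if "j < N" for j using assms(1) that by auto
  fix a assume "a < dim_vec (c k \<cdot>\<^sub>v u k)"
  then have a: "a < N" using dim[OF assms(3)] by simp
  have "(mat N N (\<lambda>(a, b). \<Sum>j<N. c j * u j $ a * cnj (u j $ b)) *\<^sub>v u k) $ a =
      (\<Sum>b<N. (\<Sum>j<N. c j * u j $ a * cnj (u j $ b)) * u k $ b)"
    using a dim[OF assms(3)] by (subst mult_mat_vec_index_sum) auto
  also have "\<dots> = (\<Sum>j<N. c j * u j $ a * (\<Sum>b<N. u k $ b * cnj (u j $ b)))"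
    unfolding sum_distrib_right sum_distrib_left by (subst sum.swap) (simp add: ac_simps)
  also have "\<dots> = (\<Sum>j<N. if j = k then c k * u k $ a else 0)"
    using assms(2,3) dim by (intro sum.cong refl) (auto simp flip: cscalar_prod_sum[of _ N])
  also have "\<dots> = (c k \<cdot>\<^sub>v u k) $ a" using a assms(3) dim[OF assms(3)] by simp
  finally show "(mat N N (\<lambda>(a, b). \<Sum>j<N. c j * u j $ a * cnj (u j $ b)) *\<^sub>v u k) $ a = (c k \<cdot>\<^sub>v u k) $ a" .
qed (use assms in auto)

lemma spectral_decomp_eigen:
  assumes "spectral_decomp N U \<theta> u" "k < N"
  shows "U \<in> carrier_mat N N" "U *\<^sub>v u k = cis (\<theta> k) \<cdot>\<^sub>v u k"
    "mat_adjoint U *\<^sub>v u k = cis (- \<theta> k) \<cdot>\<^sub>v u k"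
proof -
  have u: "\<forall>j<N. u j \<in> carrier_vec N" "\<forall>j<N. \<forall>k<N. u j \<bullet>c u k = (if j = k then 1 else 0)"
    and U: "U = mat N N (\<lambda>(a, b). \<Sum>j<N. cis (\<theta> j) * u j $ a * cnj (u j $ b))"
    using assms(1) by (auto simp: spectral_decomp_def)
  show "U \<in> carrier_mat N N" unfolding U by simp
  show "U *\<^sub>v u k = cis (\<theta> k) \<cdot>\<^sub>v u k" unfolding U by (rule spectral_sum_mult[OF u assms(2)])
  have "mat_adjoint U = mat N N (\<lambda>(a, b). \<Sum>j<N. cis (- \<theta> j) * u j $ a * cnj (u j $ b))"
    unfolding U by (intro eq_matI) (auto simp: cis_cnj ac_simps)
  then show "mat_adjoint U *\<^sub>v u k = cis (- \<theta> k) \<cdot>\<^sub>v u k"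
    by (simp only: spectral_sum_mult[OF u assms(2)])
qed

section \<open>Gate lists and the simulation of queries\<close>

definition run :: "nat \<Rightarrow> nat \<Rightarrow> complex mat \<Rightarrow> gate list \<Rightarrow> complex vec \<Rightarrow> complex vec" where
  "run N r U gs \<psi> = foldl (\<lambda>\<psi> g. gate_op N r U g *\<^sub>v \<psi>) \<psi> gs"

lemma run_simps [simp]:
  "run N r U [] \<psi> = \<psi>" "run N r U (g # gs) \<psi> = run N r U gs (gate_op N r U g *\<^sub>v \<psi>)"
  "run N r U (gs @ gs') \<psi> = run N r U gs' (run N r U gs \<psi>)"
  by (simp_all add: run_def)

definition free_unitary :: "nat \<Rightarrow> gate list \<Rightarrow> bool" where
  "free_unitary D gs \<longleftrightarrow> (\<forall>V. Free V \<in> set gs \<longrightarrow> unitary_mat D V)"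

lemma gate_op_carrier:
  assumes "U \<in> carrier_mat N N" "\<And>V. g = Free V \<Longrightarrow> V \<in> carrier_mat (N * (2 * r)) (N * (2 * r))"
  shows "gate_op N r U g \<in> carrier_mat (N * (2 * r)) (N * (2 * r))"
proof (cases g)
  case ApplyU
  then show ?thesis using assms by (simp add: on_first_def tensor_mat_carrier)
next
  case ApplyUinv
  then show ?thesis using assms by (simp add: on_first_def tensor_mat_carrier)
qed (use assms controlled_carrier in auto)

lemma run_lincomb_vec:
  assumes "U \<in> carrier_mat N N" "free_unitary (N * (2 * r)) gs" "\<And>k. k \<in> K \<Longrightarrow> f k \<in> carrier_vec (N * (2 * r))"
  shows "run N r U gs (lincomb_vec (N * (2 * r)) K c f) = lincomb_vec (N * (2 * r)) K c (\<lambda>k. run N r U gs (f k))"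
  using assms(2,3)
proof (induction gs arbitrary: f)
  case (Cons g gs)
  have g: "gate_op N r U g \<in> carrier_mat (N * (2 * r)) (N * (2 * r))"
    using assms(1) Cons.prems(1) by (intro gate_op_carrier) (auto simp: free_unitary_def)
  then have "gate_op N r U g *\<^sub>v f k \<in> carrier_vec (N * (2 * r))" if "k \<in> K" for k
    using Cons.prems(2)[OF that] by (meson mult_mat_vec_carrier)
  then show ?case
    using Cons.IH[of "\<lambda>k. gate_op N r U g *\<^sub>v f k"] Cons.prems
    by (simp add: mult_mat_lincomb_vec[OF g] free_unitary_def)
qed simp

text \<open>Whether \<open>U\<close>, its inverse or neither is wanted depends on the ancilla state.
  Both controlled queries are therefore always made, and the control qubit is set only where the
  sign matches. This is the factor \<open>2\<close> in the cost.\<close>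

definition query_gates :: "nat \<Rightarrow> nat \<Rightarrow> nat \<Rightarrow> (nat \<Rightarrow> nat) \<Rightarrow> (nat \<Rightarrow> int) \<Rightarrow> gate list" where
  "query_gates N m d i s =
    [Free (swap_mat N m d i (\<lambda>a. s a = 1)), CtrlU,
     Free (swap_mat N m d i (\<lambda>a. s a = 1)),
     Free (swap_mat N m d i (\<lambda>a. s a = -1)), CtrlUinv,
     Free (swap_mat N m d i (\<lambda>a. s a = -1))]"

text \<open>Phase kickback: on an eigenvector the controlled query only produces a scalar, so the
  second swap restores the original state.\<close>

lemma run_controlled_copy_swap:
  assumes "0 < N" "\<And>a. i a < m" "\<And>k. v k \<in> carrier_vec N" "a < d" "V \<in> carrier_mat N N"
    "V *\<^sub>v v (i a) = c \<cdot>\<^sub>v v (i a)"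
  shows "swap_mat N m d i s *\<^sub>v (controlled N (d * N ^ m) V *\<^sub>v
      (swap_mat N m d i s *\<^sub>v ket N d (unit_vec N 0) 0 a (prod_vec N m v))) =
    (if s a then c else 1) \<cdot>\<^sub>v ket N d (unit_vec N 0) 0 a (prod_vec N m v)"
proof -
  let ?P = "swap_mat N m d i s"
  let ?f = "ket N d (unit_vec N 0) 0 a (prod_vec N m v)"
  let ?g = "ket N d (v (i a)) (if s a then 1 else 0) a (prod_vec N m (v(i a := unit_vec N 0)))"
  have f: "?f \<in> carrier_vec (N * (2 * (d * N ^ m)))" and g: "?g \<in> carrier_vec (N * (2 * (d * N ^ m)))"
    using assms by (auto intro!: ket_carrier)
  have Pf: "?P *\<^sub>v ?f = ?g" by (rule copy_swap_ket[OF assms(1-4)])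
  have "controlled N (d * N ^ m) V *\<^sub>v ?g = (if s a then c else 1) \<cdot>\<^sub>v ?g"
    using assms by (subst controlled_ket) (auto simp: ket_def tensor_vec_smult_left)
  then have "?P *\<^sub>v (controlled N (d * N ^ m) V *\<^sub>v (?P *\<^sub>v ?f)) = (if s a then c else 1) \<cdot>\<^sub>v (?P *\<^sub>v ?g)"
    unfolding Pf using mult_mat_vec[OF perm_mat_carrier g] by simp
  also have "?P *\<^sub>v ?g = ?f" unfolding Pf[symmetric] by (rule copy_swap_mult_twice[OF assms(2) f])
  finally show ?thesis .
qed

definition work_state :: "nat \<Rightarrow> complex vec \<Rightarrow> complex vec \<Rightarrow> complex vec" where
  "work_state N \<psi> w = unit_vec N 0 \<otimes>\<^sub>v unit_vec 2 0 \<otimes>\<^sub>v \<psi> \<otimes>\<^sub>v w"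

lemma work_state_carrier:
  "\<psi> \<in> carrier_vec d \<Longrightarrow> w \<in> carrier_vec M \<Longrightarrow> work_state N \<psi> w \<in> carrier_vec (N * (2 * (d * M)))"
  unfolding work_state_def by (intro tensor_vec_carrier) auto

lemma work_state_index:
  assumes "\<psi> \<in> carrier_vec d" "w \<in> carrier_vec M" "x < N" "b < 2" "a < d" "y < M"
  shows "work_state N \<psi> w $ enc d M x b a y = (if x = 0 \<and> b = 0 then \<psi> $ a * w $ y else 0)"
proof -
  have dims: "dim_vec w = M" "dim_vec \<psi> = d" using assms by auto
  then have "work_state N \<psi> w $ enc d M x b a y =
      unit_vec N 0 $ x * (unit_vec 2 0 $ b * (\<psi> $ a * w $ y))"
    using enc_less[OF assms(3-6)] assms(3-6)
      tensor_vec_index_pair[of y w a \<psi>]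
      tensor_vec_index_pair[of "a * M + y" "\<psi> \<otimes>\<^sub>v w" b "unit_vec 2 0"]
      tensor_vec_index_pair[of "b * (d * M) + (a * M + y)" "unit_vec 2 0 \<otimes>\<^sub>v \<psi> \<otimes>\<^sub>v w" x "unit_vec N 0"]
    unfolding work_state_def enc_def by (simp only: tensor_vec_dim index_unit_vec dim_vec)
  then show ?thesis using assms by (auto simp: unit_vec_def)
qed

lemma work_state_eq_lincomb:
  assumes "\<psi> \<in> carrier_vec d" "w \<in> carrier_vec M" "0 < N"
  shows "work_state N \<psi> w = lincomb_vec (N * (2 * (d * M))) {..<d} (\<lambda>a. \<psi> $ a) (\<lambda>a. ket N d (unit_vec N 0) 0 a w)"
proof (intro eq_vecI)
  fix z assume "z < dim_vec (lincomb_vec (N * (2 * (d * M))) {..<d} (\<lambda>a. \<psi> $ a) (\<lambda>a. ket N d (unit_vec N 0) 0 a w))"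
  then have z: "z < N * (2 * (d * M))" by (simp add: lincomb_vec_def)
  then obtain x b a y where e: "x < N" "b < 2" "a < d" "y < M" "z = enc d M x b a y"
    using enc_cases by blast
  have "(\<Sum>k<d. \<psi> $ k * ket N d (unit_vec N 0) 0 k w $ z) =
      (\<Sum>k<d. if k = a then (if x = 0 \<and> b = 0 then \<psi> $ a * w $ y else 0) else 0)"
    unfolding e(5) using e assms
    by (intro sum.cong refl) (subst ket_index[of _ N _ M], auto simp: unit_vec_def)
  then show "work_state N \<psi> w $ z = lincomb_vec (N * (2 * (d * M))) {..<d} (\<lambda>a. \<psi> $ a) (\<lambda>a. ket N d (unit_vec N 0) 0 a w) $ z"
    using z e work_state_index[OF assms(1,2) e(1-4)] by (simp add: lincomb_vec_def)
qed (use work_state_carrier[OF assms(1,2), of N] in \<open>simp add: lincomb_vec_def\<close>)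

lemma free_unitary_query_gates: "(\<And>a. i a < m) \<Longrightarrow> free_unitary (N * (2 * (d * N ^ m))) (query_gates N m d i s)"
  by (auto simp: free_unitary_def query_gates_def intro!: unitary_copy_swap)

lemma run_query_gates_ket:
  assumes "spectral_decomp N U \<theta> u" "\<And>k. J k < N" "\<And>a. i a < m" "\<And>a. s a \<in> {-1, 0, 1}" "a < d"
  shows "run N (d * N ^ m) U (query_gates N m d i s) (ket N d (unit_vec N 0) 0 a (prod_vec N m (\<lambda>k. u (J k)))) =
    cis (of_int (s a) * \<theta> (J (i a))) \<cdot>\<^sub>v ket N d (unit_vec N 0) 0 a (prod_vec N m (\<lambda>k. u (J k)))"
proof -
  let ?D = "N * (2 * (d * N ^ m))"
  let ?f = "ket N d (unit_vec N 0) 0 a (prod_vec N m (\<lambda>k. u (J k)))"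
  let ?P = "\<lambda>t. perm_mat ?D (copy_swap N m d i (\<lambda>a. s a = t))"
  have N: "0 < N" using assms(2)[of 0] by simp
  have u: "u (J k) \<in> carrier_vec N" for k using assms(1,2) by (auto simp: spectral_decomp_def)
  have U: "U \<in> carrier_mat N N" "U *\<^sub>v u (J k) = cis (\<theta> (J k)) \<cdot>\<^sub>v u (J k)"
    "mat_adjoint U *\<^sub>v u (J k) = cis (- \<theta> (J k)) \<cdot>\<^sub>v u (J k)" for k
    using spectral_decomp_eigen[OF assms(1,2)] by auto
  have C: "controlled N (d * N ^ m) (mat_adjoint U) \<in> carrier_mat ?D ?D"
    using U(1) by (intro controlled_carrier) auto
  have f: "?f \<in> carrier_vec ?D" by (intro ket_carrier) auto
  have Pf: "?P t *\<^sub>v ?f \<in> carrier_vec ?D" for t using f by (meson mult_mat_vec_carrier perm_mat_carrier)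
  have CPf: "controlled N (d * N ^ m) (mat_adjoint U) *\<^sub>v (?P t *\<^sub>v ?f) \<in> carrier_vec ?D" for t
    using C Pf by (meson mult_mat_vec_carrier)
  have 1: "?P 1 *\<^sub>v (controlled N (d * N ^ m) U *\<^sub>v (?P 1 *\<^sub>v ?f)) =
      (if s a = 1 then cis (\<theta> (J (i a))) else 1) \<cdot>\<^sub>v ?f"
    using run_controlled_copy_swap[OF N assms(3) u assms(5) U(1,2), where s = "\<lambda>a. s a = 1"] .
  have 2: "?P (-1) *\<^sub>v (controlled N (d * N ^ m) (mat_adjoint U) *\<^sub>v (?P (-1) *\<^sub>v ?f)) =
      (if s a = -1 then cis (- \<theta> (J (i a))) else 1) \<cdot>\<^sub>v ?f"
    using run_controlled_copy_swap[OF N assms(3) u assms(5) mat_adjoint_carrier[OF U(1)] U(3), where s = "\<lambda>a. s a = -1"] .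
  have "run N (d * N ^ m) U (query_gates N m d i s) ?f =
      ?P (-1) *\<^sub>v (controlled N (d * N ^ m) (mat_adjoint U) *\<^sub>v (?P (-1) *\<^sub>v
        ((if s a = 1 then cis (\<theta> (J (i a))) else 1) \<cdot>\<^sub>v ?f)))"
    unfolding query_gates_def run_simps gate_op.simps 1 ..
  also have "\<dots> = (if s a = 1 then cis (\<theta> (J (i a))) else 1) \<cdot>\<^sub>v
      ((if s a = -1 then cis (- \<theta> (J (i a))) else 1) \<cdot>\<^sub>v ?f)"
    unfolding mult_mat_vec[OF perm_mat_carrier f] mult_mat_vec[OF C Pf]
      mult_mat_vec[OF perm_mat_carrier CPf] 2 ..
  also have "\<dots> = cis (of_int (s a) * \<theta> (J (i a))) \<cdot>\<^sub>v ?f"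
    using assms(4)[of a] by (auto simp: smult_smult_assoc)
  finally show ?thesis .
qed

text \<open>The gate list is fixed before \<open>U\<close>, its eigenbasis and the product of
  eigenvectors are given, so one algorithm serves all inputs. On a fixed product the queries only
  multiply ancilla basis states by phases. The copies thus stay a tensor factor, and the ancilla
  undergoes the phase circuit whose \<open>k\<close>-th phase belongs to copy
  \<open>k\<close>.\<close>

lemma phase_circuit_gates:
  assumes "phase_circuit m d T A" "0 < N"
  shows "\<exists>gs. free_unitary (N * (2 * (d * N ^ m))) gs \<and> length (filter is_query gs) = 2 * T \<and>
    (\<forall>U \<theta> u J \<psi>. spectral_decomp N U \<theta> u \<longrightarrow> (\<forall>k. J k < N) \<longrightarrow> \<psi> \<in> carrier_vec d \<longrightarrow>
       run N (d * N ^ m) U gs (work_state N \<psi> (prod_vec N m (\<lambda>k. u (J k)))) =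
       work_state N (A (\<lambda>k. \<theta> (J k)) *\<^sub>v \<psi>) (prod_vec N m (\<lambda>k. u (J k))))"
proof -
  let ?D = "N * (2 * (d * N ^ m))"
  define lift where "lift V = 1\<^sub>m N \<otimes>\<^sub>m 1\<^sub>m 2 \<otimes>\<^sub>m V \<otimes>\<^sub>m 1\<^sub>m (N ^ m)" for V
  have lift_unitary: "unitary_mat ?D (lift V)" if "unitary_mat d V" for V
    unfolding lift_def by (intro unitary_mat_tensor unitary_mat_one that)
  have lift_mult: "lift V *\<^sub>v work_state N \<psi> (prod_vec N m v) = work_state N (V *\<^sub>v \<psi>) (prod_vec N m v)"
    if "V \<in> carrier_mat d d" "\<psi> \<in> carrier_vec d" for V \<psi> v
    using that unfolding lift_def work_state_def
    by (simp add: tensor_mat_vec_mult[of _ N N _ "2 * (d * N ^ m)" "2 * (d * N ^ m)"]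
        tensor_mat_vec_mult[of _ 2 2 _ "d * N ^ m" "d * N ^ m"]
        tensor_mat_vec_mult[of _ d d _ "N ^ m" "N ^ m"] tensor_mat_carrier tensor_vec_carrier)
  show ?thesis
    using assms(1)
  proof (induction rule: phase_circuit.induct)
    case (Free V)
    have "V \<in> carrier_mat d d" using Free by simp
    then show ?case
      using lift_unitary[OF Free] lift_mult
      by (intro exI[of _ "[Free (lift V)]"]) (auto simp: free_unitary_def)
  next
    case (Query T A V i s)
    from Query.IH obtain gs where gs: "free_unitary ?D gs" "length (filter is_query gs) = 2 * T"
      "\<And>U \<theta> u J \<psi>. spectral_decomp N U \<theta> u \<Longrightarrow> \<forall>k. J k < N \<Longrightarrow> \<psi> \<in> carrier_vec d \<Longrightarrow>
         run N (d * N ^ m) U gs (work_state N \<psi> (prod_vec N m (\<lambda>k. u (J k)))) =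
         work_state N (A (\<lambda>k. \<theta> (J k)) *\<^sub>v \<psi>) (prod_vec N m (\<lambda>k. u (J k)))" by blast
    have V: "V \<in> carrier_mat d d" using Query by simp
    show ?case
    proof (intro exI[of _ "gs @ query_gates N m d i s @ [Free (lift V)]"] conjI allI impI)
      show "free_unitary ?D (gs @ query_gates N m d i s @ [Free (lift V)])"
        using gs(1) free_unitary_query_gates[of i m N d s] Query(3) lift_unitary[OF Query(2)]
        by (auto simp: free_unitary_def)
      show "length (filter is_query (gs @ query_gates N m d i s @ [Free (lift V)])) = 2 * Suc T"
        using gs(2) by (simp add: query_gates_def)
      fix U \<theta> u and J :: "nat \<Rightarrow> nat" and \<psi> :: "complex vec"
      assume sp: "spectral_decomp N U \<theta> u" and J: "\<forall>k. J k < N" and \<psi>: "\<psi> \<in> carrier_vec d"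
      define w where "w = prod_vec N m (\<lambda>k. u (J k))"
      define \<psi>1 where "\<psi>1 = A (\<lambda>k. \<theta> (J k)) *\<^sub>v \<psi>"
      have w: "w \<in> carrier_vec (N ^ m)" by (simp add: w_def)
      have A: "A (\<lambda>k. \<theta> (J k)) \<in> carrier_mat d d" using phase_circuit_carrier Query(1) by blast
      then have \<psi>1: "\<psi>1 \<in> carrier_vec d" unfolding \<psi>1_def using \<psi> by (meson mult_mat_vec_carrier)
      let ?Q = "phase_diag d i s (\<lambda>k. \<theta> (J k))"
      have Q\<psi>1: "?Q *\<^sub>v \<psi>1 \<in> carrier_vec d" using \<psi>1 by (meson mult_mat_vec_carrier phase_diag_carrier)
      have idx: "(?Q *\<^sub>v \<psi>1) $ a = \<psi>1 $ a * cis (of_int (s a) * \<theta> (J (i a)))" if "a < d" for a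
      proof -
        have "(?Q *\<^sub>v \<psi>1) $ a = (\<Sum>k<d. ?Q $$ (a, k) * \<psi>1 $ k)"
          using that carrier_vecD[OF \<psi>1] by (subst mult_mat_vec_index_sum) (auto simp: phase_diag_def)
        also have "\<dots> = (\<Sum>k<d. if k = a then \<psi>1 $ a * cis (of_int (s a) * \<theta> (J (i a))) else 0)"
          using that by (intro sum.cong refl) (auto simp: phase_diag_def cdiag_index)
        finally have "(?Q *\<^sub>v \<psi>1) $ a = \<dots>" .
        then show ?thesis using that by simp
      qed
      have U: "U \<in> carrier_mat N N" using spectral_decomp_eigen(1)[OF sp assms(2)] .
      \<comment> \<open>The index and the sign of a query depend on the ancilla basis state, so the
        ancilla is expanded in this basis.\<close>
      have "run N (d * N ^ m) U (query_gates N m d i s) (work_state N \<psi>1 w) =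
          lincomb_vec ?D {..<d} (\<lambda>a. \<psi>1 $ a)
            (\<lambda>a. run N (d * N ^ m) U (query_gates N m d i s) (ket N d (unit_vec N 0) 0 a w))"
        unfolding work_state_eq_lincomb[OF \<psi>1 w assms(2)]
        using w by (intro run_lincomb_vec[OF U] free_unitary_query_gates Query(3) ket_carrier) auto
      also have "\<dots> = work_state N (?Q *\<^sub>v \<psi>1) w"
        unfolding work_state_eq_lincomb[OF Q\<psi>1 w assms(2)] lincomb_vec_def
      proof (intro eq_vecI)
        fix z assume "z < dim_vec (vec ?D (\<lambda>z. \<Sum>k<d. (?Q *\<^sub>v \<psi>1) $ k * ket N d (unit_vec N 0) 0 k w $ z))"
        then have z: "z < ?D" by simp
        have dim: "dim_vec (ket N d (unit_vec N 0) 0 a w) = ?D" for a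
          using carrier_vecD[OF ket_carrier[of "unit_vec N 0" N w "N ^ m" d 0 a]] w by simp
        have "(\<Sum>a<d. \<psi>1 $ a * run N (d * N ^ m) U (query_gates N m d i s) (ket N d (unit_vec N 0) 0 a w) $ z) =
            (\<Sum>a<d. (?Q *\<^sub>v \<psi>1) $ a * ket N d (unit_vec N 0) 0 a w $ z)"
        proof (intro sum.cong refl)
          fix a assume "a \<in> {..<d}"
          then have a: "a < d" by simp
          show "\<psi>1 $ a * run N (d * N ^ m) U (query_gates N m d i s) (ket N d (unit_vec N 0) 0 a w) $ z =
              (?Q *\<^sub>v \<psi>1) $ a * ket N d (unit_vec N 0) 0 a w $ z"
            unfolding idx[OF a] using run_query_gates_ket[OF sp J[rule_format] Query(3,4) a] z dim
            by (simp add: w_def)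
        qed
        then show "vec ?D (\<lambda>z. \<Sum>a<d. \<psi>1 $ a * run N (d * N ^ m) U (query_gates N m d i s) (ket N d (unit_vec N 0) 0 a w) $ z) $ z =
            vec ?D (\<lambda>z. \<Sum>a<d. (?Q *\<^sub>v \<psi>1) $ a * ket N d (unit_vec N 0) 0 a w $ z) $ z" using z by simp
      qed simp
      finally have q: "run N (d * N ^ m) U (query_gates N m d i s) (work_state N \<psi>1 w) = work_state N (?Q *\<^sub>v \<psi>1) w" .
      have "V *\<^sub>v (?Q *\<^sub>v \<psi>1) = V * (?Q * A (\<lambda>k. \<theta> (J k))) *\<^sub>v \<psi>"
      proof -
        have QA: "?Q * A (\<lambda>k. \<theta> (J k)) \<in> carrier_mat d d" using A by (meson mult_carrier_mat phase_diag_carrier)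
        show ?thesis unfolding \<psi>1_def assoc_mult_mat_vec[OF V QA \<psi>] assoc_mult_mat_vec[OF phase_diag_carrier A \<psi>] ..
      qed
      moreover have "run N (d * N ^ m) U gs (work_state N \<psi> w) = work_state N \<psi>1 w"
        unfolding w_def \<psi>1_def by (rule gs(3)[OF sp J \<psi>])
      moreover have "lift V *\<^sub>v work_state N (?Q *\<^sub>v \<psi>1) w = work_state N (V *\<^sub>v (?Q *\<^sub>v \<psi>1)) w"
        unfolding w_def by (rule lift_mult[OF V Q\<psi>1])
      ultimately show "run N (d * N ^ m) U (gs @ query_gates N m d i s @ [Free (lift V)])
          (work_state N \<psi> (prod_vec N m (\<lambda>k. u (J k)))) =
        work_state N (V * (?Q * A (\<lambda>k. \<theta> (J k))) *\<^sub>v \<psi>) (prod_vec N m (\<lambda>k. u (J k)))"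
        by (simp add: q flip: w_def)
    qed
  qed
qed

section \<open>Measurement of the ancilla\<close>

definition basis_proj :: "nat \<Rightarrow> nat \<Rightarrow> complex mat" where
  "basis_proj D z = mat D D (\<lambda>(i, j). if i = z \<and> j = z then 1 else 0)"

lemma basis_proj_inner:
  assumes "v \<in> carrier_vec D" "z < D"
  shows "(basis_proj D z *\<^sub>v v) \<bullet>c v = complex_of_real ((cmod (v $ z))\<^sup>2)"
proof -
  have dim: "dim_vec v = D" using assms(1) by auto
  have "(basis_proj D z *\<^sub>v v) $ i = (if i = z then v $ z else 0)" if "i < D" for i
  proof -
    have "(basis_proj D z *\<^sub>v v) $ i = (\<Sum>k<D. basis_proj D z $$ (i, k) * v $ k)"
      using that dim by (subst mult_mat_vec_index_sum) (auto simp: basis_proj_def)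
    also have "\<dots> = (\<Sum>k<D. if k = z then (if i = z then v $ z else 0) else 0)"
      using that by (intro sum.cong refl) (auto simp: basis_proj_def)
    finally show ?thesis using assms(2) by simp
  qed
  note idx = this
  have "(basis_proj D z *\<^sub>v v) \<bullet>c v = (\<Sum>i<D. (basis_proj D z *\<^sub>v v) $ i * cnj (v $ i))"
    using dim by (intro cscalar_prod_sum) (auto simp: basis_proj_def)
  also have "\<dots> = (\<Sum>i<D. if i = z then v $ z * cnj (v $ z) else 0)"
    by (intro sum.cong refl) (auto simp: idx simp del: index_mult_mat_vec)
  finally have "(basis_proj D z *\<^sub>v v) \<bullet>c v = (\<Sum>i<D. if i = z then v $ z * cnj (v $ z) else 0)" .
  then show ?thesis using assms(2) by (simp add: complex_norm_square del: of_real_power)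
qed

lemma foldr_basis_proj:
  "distinct zs \<Longrightarrow> foldr (\<lambda>(x, E) M. E + M) (map (\<lambda>z. (f z, basis_proj D z)) zs) (0\<^sub>m D D) =
    mat D D (\<lambda>(i, j). if i = j \<and> i \<in> set zs then 1 else 0)"
proof (induction zs)
  case (Cons z zs)
  then show ?case by (auto simp: basis_proj_def intro!: eq_matI)
qed (auto intro!: eq_matI)

lemma valid_povm_basis_proj: "valid_povm D (map (\<lambda>z. (f z, basis_proj D z)) [0..<D])"
proof -
  have "psd_mat D (basis_proj D z)" if "z < D" for z
    using that basis_proj_inner[of _ D z]
    by (simp add: psd_mat_def less_eq_complex_def) (simp add: basis_proj_def)
  moreover have "mat D D (\<lambda>(i, j). if i = j \<and> i \<in> set [0..<D] then 1 else 0) = (1\<^sub>m D :: complex mat)"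
    by (intro eq_matI) auto
  ultimately show ?thesis by (auto simp: valid_povm_def foldr_basis_proj)
qed

lemma povm_prob_basis_proj:
  assumes "v \<in> carrier_vec D"
  shows "povm_prob (map (\<lambda>z. (f z, basis_proj D z)) [0..<D]) v G = (\<Sum>z<D. if f z \<in> G then (cmod (v $ z))\<^sup>2 else 0)"
proof -
  have "povm_prob (map (\<lambda>z. (f z, basis_proj D z)) [0..<D]) v G =
      (\<Sum>z\<leftarrow>[0..<D]. if f z \<in> G then Re ((basis_proj D z *\<^sub>v v) \<bullet>c v) else 0)"
    by (simp add: povm_prob_def comp_def)
  also have "\<dots> = (\<Sum>z\<in>set [0..<D]. if f z \<in> G then Re ((basis_proj D z *\<^sub>v v) \<bullet>c v) else 0)"
    by (rule sum_list_distinct_conv_sum_set) simp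
  also have "\<dots> = (\<Sum>z<D. if f z \<in> G then (cmod (v $ z))\<^sup>2 else 0)"
    by (intro sum.cong) (auto simp: basis_proj_inner[OF assms])
  finally show ?thesis .
qed

text \<open>The inner product factorises over the copies, and numbers below \<open>N ^ m\<close>
  with the same digits coincide.\<close>

lemma prod_vec_orthonormal:
  assumes "\<And>j. j < N \<Longrightarrow> u j \<in> carrier_vec N" "\<And>j k. j < N \<Longrightarrow> k < N \<Longrightarrow> u j \<bullet>c u k = (if j = k then 1 else 0)"
    "J < N ^ m" "K < N ^ m" "0 < N"
  shows "(\<Sum>y<N ^ m. cnj (prod_vec N m (\<lambda>k. u (dig N k J)) $ y) * prod_vec N m (\<lambda>k. u (dig N k K)) $ y) =
    (if J = K then 1 else 0)"
proof -
  have inner: "(\<Sum>x<N. cnj (u j $ x) * u k $ x) = (if k = j then 1 else 0)" if "j < N" "k < N" for j k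
    using assms(2)[OF that(2,1)] cscalar_prod_sum[of "u k" N "u j"] assms(1) that by (simp add: mult.commute)
  have "(\<Sum>y<N ^ m. cnj (prod_vec N m (\<lambda>k. u (dig N k J)) $ y) * prod_vec N m (\<lambda>k. u (dig N k K)) $ y) =
      (\<Sum>y<N ^ m. \<Prod>i<m. cnj (u (dig N i J) $ dig N i y) * u (dig N i K) $ dig N i y)"
    by (intro sum.cong refl) (simp add: prod_vec_def prod.distrib)
  also have "\<dots> = (\<Prod>i<m. \<Sum>x<N. cnj (u (dig N i J) $ x) * u (dig N i K) $ x)"
    by (rule sum_prod_dig)
  also have "\<dots> = (\<Prod>i<m. if dig N i K = dig N i J then 1 else 0)"
    by (intro prod.cong refl) (simp add: inner dig_less assms(5))
  also have "\<dots> = (if J = K then 1 else 0)"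
  proof (cases "\<forall>i<m. dig N i K = dig N i J")
    case True
    then have "undig N m (\<lambda>i. dig N i K) = undig N m (\<lambda>i. dig N i J)" by (simp add: undig_def)
    then have "J = K" using undig_dig[OF assms(3)] undig_dig[OF assms(4)] by simp
    then show ?thesis by simp
  next
    case False
    then obtain i where "i < m" "dig N i K \<noteq> dig N i J" by blast
    then have "(\<Prod>i<m. if dig N i K = dig N i J then 1 else 0) = (0 :: complex)"
      by (intro prod_zero) auto
    then show ?thesis using False by auto
  qed
  finally show ?thesis .
qed

text \<open>The branches of the expansion into products of eigenvectors keep orthonormal copy
  registers, so they do not interfere. The output is distributed as if each copy had drawn an
  eigenvector independently, with probability the squared modulus of its coefficient, and the phase
  circuit had run on the drawn phases.\<close>

lemma samples_qalg:
  assumes "samples m T P" "0 < N"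
  obtains A where "valid_qalg N A" "copies A = m" "cost A = 2 * T"
    "\<And>U \<theta> u \<alpha> c G. spectral_decomp N U \<theta> u \<Longrightarrow> \<alpha> \<in> carrier_vec N \<Longrightarrow>
      (\<And>x. x < N \<Longrightarrow> \<alpha> $ x = (\<Sum>j<N. c j * u j $ x)) \<Longrightarrow>
      output_prob N A U \<alpha> G = (\<Sum>J<N ^ m. (\<Prod>i<m. (cmod (c (dig N i J)))\<^sup>2) * P (\<lambda>i. \<theta> (dig N i J)) G)"
proof -
  obtain d B val where B: "0 < d" "phase_circuit m d T B"
    "\<And>\<phi> S. P \<phi> S = weight d (B \<phi>) (\<lambda>a. val a \<in> S)"
    using assms(1) unfolding samples_def by blast
  define M where "M = N ^ m"
  define D where "D = N * (2 * (d * M))"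
  obtain gs where gs: "free_unitary D gs" "length (filter is_query gs) = 2 * T"
    "\<And>U \<theta> u J \<psi>. spectral_decomp N U \<theta> u \<Longrightarrow> \<forall>k. J k < N \<Longrightarrow> \<psi> \<in> carrier_vec d \<Longrightarrow>
       run N (d * M) U gs (work_state N \<psi> (prod_vec N m (\<lambda>k. u (J k)))) =
       work_state N (B (\<lambda>k. \<theta> (J k)) *\<^sub>v \<psi>) (prod_vec N m (\<lambda>k. u (J k)))"
    using phase_circuit_gates[OF B(2) assms(2)] unfolding M_def D_def by blast
  \<comment> \<open>The whole space is measured, but the output is read from the ancilla component
    alone.\<close>
  define f where "f z = val (fst (snd (snd (dec d M z))))" for z
  define A where "A = \<lparr>copies = m, ancilla = d, gates = gs, measurement = map (\<lambda>z. (f z, basis_proj D z)) [0..<D]\<rparr>"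
  have dims: "rest_dim N A = d * M" "total_dim N A = D"
    by (simp_all add: rest_dim_def total_dim_def A_def D_def M_def)
  show thesis
  proof
    show "valid_qalg N A"
      using B(1) gs(1) valid_povm_basis_proj[of D f] unfolding valid_qalg_def dims
      by (simp add: A_def free_unitary_def)
    show "copies A = m" "cost A = 2 * T" using gs(2) by (simp_all add: A_def cost_def)
    fix U \<theta> u \<alpha> c G
    assume sp: "spectral_decomp N U \<theta> u" and \<alpha>: "\<alpha> \<in> carrier_vec N"
      and c: "\<And>x. x < N \<Longrightarrow> \<alpha> $ x = (\<Sum>j<N. c j * u j $ x)"
    define w where "w J = prod_vec N m (\<lambda>k. u (dig N k J))" for J
    define C where "C J = (\<Prod>i<m. c (dig N i J))" for J
    define \<phi> where "\<phi> J = (\<lambda>k. \<theta> (dig N k J))" for J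
    define \<psi> where "\<psi> J = B (\<phi> J) *\<^sub>v unit_vec d 0" for J
    have w: "w J \<in> carrier_vec M" for J by (simp add: w_def M_def)
    have e0: "unit_vec d 0 \<in> carrier_vec d" by simp
    have Bc: "B (\<phi> J) \<in> carrier_mat d d" for J using phase_circuit_carrier B(2) by blast
    then have \<psi>: "\<psi> J \<in> carrier_vec d" for J unfolding \<psi>_def using e0 by (meson mult_mat_vec_carrier)
    have \<psi>_index: "\<psi> J $ a = B (\<phi> J) $$ (a, 0)" if "a < d" for J a
    proof -
      have "\<psi> J $ a = (\<Sum>k<d. B (\<phi> J) $$ (a, k) * unit_vec d 0 $ k)"
        unfolding \<psi>_def using that Bc[of J] by (subst mult_mat_vec_index_sum) auto
      also have "\<dots> = (\<Sum>k<d. if k = 0 then B (\<phi> J) $$ (a, 0) else 0)"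
        by (intro sum.cong refl) (auto simp: unit_vec_def)
      finally show ?thesis using B(1) by simp
    qed
    have U: "U \<in> carrier_mat N N" using spectral_decomp_eigen(1)[OF sp assms(2)] .
    have \<alpha>_index: "tensor_power \<alpha> m $ y = (\<Sum>J<M. C J * w J $ y)" if "y < M" for y
    proof -
      have "tensor_power \<alpha> m $ y = (\<Prod>i<m. \<Sum>j<N. c j * u j $ dig N i y)"
        using that c dig_less[OF assms(2)] by (simp add: tensor_power_eq_prod_vec[OF \<alpha>] prod_vec_def M_def)
      also have "\<dots> = (\<Sum>J<M. \<Prod>i<m. c (dig N i J) * u (dig N i J) $ dig N i y)"
        unfolding M_def by (rule sum_prod_dig[symmetric])
      also have "\<dots> = (\<Sum>J<M. C J * w J $ y)"
        using that by (intro sum.cong refl) (simp add: C_def w_def prod_vec_def M_def prod.distrib)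
      finally show ?thesis .
    qed
    have \<alpha>m: "tensor_power \<alpha> m \<in> carrier_vec M"
      by (simp add: tensor_power_eq_prod_vec[OF \<alpha>] M_def)
    have start: "start_state N A \<alpha> = lincomb_vec D {..<M} C (\<lambda>J. work_state N (unit_vec d 0) (w J))"
    proof -
      have "start_state N A \<alpha> = work_state N (unit_vec d 0) (tensor_power \<alpha> m)"
        by (simp add: start_state_def work_state_def A_def)
      also have "\<dots> = lincomb_vec D {..<M} C (\<lambda>J. work_state N (unit_vec d 0) (w J))"
      proof (intro eq_vecI)
        fix z assume "z < dim_vec (lincomb_vec D {..<M} C (\<lambda>J. work_state N (unit_vec d 0) (w J)))"
        then have z: "z < D" by (simp add: lincomb_vec_def)
        then obtain x b a y where e: "x < N" "b < 2" "a < d" "y < M" "z = enc d M x b a y"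
          unfolding D_def using enc_cases by blast
        show "work_state N (unit_vec d 0) (tensor_power \<alpha> m) $ z =
            lincomb_vec D {..<M} C (\<lambda>J. work_state N (unit_vec d 0) (w J)) $ z"
          using z \<alpha>_index[OF e(4)] unfolding lincomb_vec_def e(5)
          by (simp add: work_state_index[OF e0 \<alpha>m e(1-4)] work_state_index[OF e0 w e(1-4)]
              sum_distrib_left ac_simps)
      qed (use work_state_carrier[OF e0 \<alpha>m, of N] in \<open>simp add: lincomb_vec_def D_def\<close>)
      finally show ?thesis .
    qed
    have "final_state N A U \<alpha> = run N (d * M) U gs (lincomb_vec D {..<M} C (\<lambda>J. work_state N (unit_vec d 0) (w J)))"
      unfolding final_state_def start dims(1) run_def by (simp add: A_def)
    also have "\<dots> = lincomb_vec D {..<M} C (\<lambda>J. run N (d * M) U gs (work_state N (unit_vec d 0) (w J)))"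
      unfolding D_def using gs(1) w
      by (intro run_lincomb_vec[OF U]) (auto simp: D_def intro!: work_state_carrier)
    also have "\<dots> = lincomb_vec D {..<M} C (\<lambda>J. work_state N (\<psi> J) (w J))"
      unfolding w_def \<psi>_def \<phi>_def by (subst gs(3)[OF sp _ e0]) (auto simp: dig_less assms(2))
    finally have final: "final_state N A U \<alpha> = lincomb_vec D {..<M} C (\<lambda>J. work_state N (\<psi> J) (w J))" .
    have final_index: "final_state N A U \<alpha> $ enc d M x b a y =
        (if x = 0 \<and> b = 0 then \<Sum>J<M. C J * \<psi> J $ a * w J $ y else 0)"
      if "x < N" "b < 2" "a < d" "y < M" for x b a y
      unfolding final lincomb_vec_def using enc_less(1)[OF that]
      by (simp add: work_state_index[OF \<psi> w that] D_def mult.assoc)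
    have "output_prob N A U \<alpha> G = (\<Sum>z<D. if f z \<in> G then (cmod (final_state N A U \<alpha> $ z))\<^sup>2 else 0)"
      unfolding output_prob_def using povm_prob_basis_proj[of "final_state N A U \<alpha>" D f G]
      by (simp add: A_def final[unfolded A_def])
    also have "\<dots> = (\<Sum>x<N. \<Sum>b<(2 :: nat). \<Sum>a<d. \<Sum>y<M. if x = 0 then if b = 0 then
        (if val a \<in> G then (cmod (\<Sum>J<M. C J * \<psi> J $ a * w J $ y))\<^sup>2 else 0) else 0 else 0)"
      unfolding D_def sum_lessThan_times enc_def[symmetric]
      by (intro sum.cong refl) (simp add: f_def dec_enc final_index)
    also have "\<dots> = (\<Sum>a<d. \<Sum>y<M. if val a \<in> G then (cmod (\<Sum>J<M. C J * \<psi> J $ a * w J $ y))\<^sup>2 else 0)"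
    proof -
      define S where "S = (\<Sum>a<d. \<Sum>y<M. if val a \<in> G then (cmod (\<Sum>J<M. C J * \<psi> J $ a * w J $ y))\<^sup>2 else 0)"
      have "(\<Sum>a<d. \<Sum>y<M. if x = 0 then if b = 0 then
          (if val a \<in> G then (cmod (\<Sum>J<M. C J * \<psi> J $ a * w J $ y))\<^sup>2 else 0) else 0 else 0) =
        (if b = 0 then if x = 0 then S else 0 else 0)" for x b :: nat
        by (simp add: S_def)
      then show ?thesis using assms(2) by (simp flip: S_def)
    qed
    also have "\<dots> = (\<Sum>a<d. if val a \<in> G then (\<Sum>J<M. (cmod (C J * \<psi> J $ a))\<^sup>2) else 0)"
    proof (intro sum.cong refl)
      fix a
      \<comment> \<open>Summation over the copies register removes the cross terms between different
        \<open>J\<close>.\<close>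
      have on: "(\<Sum>y<M. (cmod (\<Sum>J<M. C J * \<psi> J $ a * w J $ y))\<^sup>2) = (\<Sum>J<M. (cmod (C J * \<psi> J $ a))\<^sup>2)"
        unfolding w_def M_def using sp assms(2)
        by (intro sum_cmod_sq_orthonormal prod_vec_orthonormal) (auto simp: spectral_decomp_def)
      show "(\<Sum>y<M. if val a \<in> G then (cmod (\<Sum>J<M. C J * \<psi> J $ a * w J $ y))\<^sup>2 else 0) =
          (if val a \<in> G then (\<Sum>J<M. (cmod (C J * \<psi> J $ a))\<^sup>2) else 0)"
        using on by simp
    qed
    also have "\<dots> = (\<Sum>J<M. \<Sum>a<d. (cmod (C J))\<^sup>2 * (if val a \<in> G then (cmod (B (\<phi> J) $$ (a, 0)))\<^sup>2 else 0))"
    proof -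
      have "(if val a \<in> G then (\<Sum>J<M. (cmod (C J * \<psi> J $ a))\<^sup>2) else 0) =
          (\<Sum>J<M. (cmod (C J))\<^sup>2 * (if val a \<in> G then (cmod (B (\<phi> J) $$ (a, 0)))\<^sup>2 else 0))" if "a < d" for a
        using that by (simp add: \<psi>_index norm_mult power_mult_distrib)
      then show ?thesis by (subst sum.swap) (auto intro: sum.cong)
    qed
    also have "\<dots> = (\<Sum>J<M. (\<Prod>i<m. (cmod (c (dig N i J)))\<^sup>2) * P (\<phi> J) G)"
      unfolding B(3) sum_distrib_left by (simp add: C_def prod_norm prod_power_distrib flip: prod_norm)
    finally show "output_prob N A U \<alpha> G = (\<Sum>J<N ^ m. (\<Prod>i<m. (cmod (c (dig N i J)))\<^sup>2) * P (\<lambda>i. \<theta> (dig N i J)) G)"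
      by (simp add: M_def \<phi>_def)
  qed
qed

section \<open>The weight of the advice state\<close>

lemma sq_norm_cvec_eq:
  assumes "v \<in> carrier_vec N"
  shows "sq_norm_cvec v = (\<Sum>x<N. (cmod (v $ x))\<^sup>2)"
  using carrier_vecD[OF assms]
  by (simp add: sq_norm_cvec_def cscalar_prod_sum[of _ N] flip: complex_norm_square del: of_real_power)

text \<open>The conjugated eigenvectors are the rows of a unitary matrix. Its orthonormal columns
  give completeness, and its preservation of norms gives the sum of the squared
  coefficients.\<close>

lemma spectral_decomp_expansion:
  assumes "spectral_decomp N U \<theta> u" "\<alpha> \<in> carrier_vec N" "sq_norm_cvec \<alpha> = 1"
  obtains c where "\<And>x. x < N \<Longrightarrow> \<alpha> $ x = (\<Sum>j<N. c j * u j $ x)" "(\<Sum>j<N. (cmod (c j))\<^sup>2) = 1"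
proof
  have u: "u j \<in> carrier_vec N" "dim_vec (u j) = N" if "j < N" for j
    using assms(1) that by (auto simp: spectral_decomp_def)
  define W where "W = mat N N (\<lambda>(j, x). cnj (u j $ x))"
  have W: "unitary_mat N W"
  proof (rule unitary_matI)
    fix i j assume ij: "i < N" "j < N"
    have "(\<Sum>k<N. W $$ (i, k) * cnj (W $$ (j, k))) = u j \<bullet>c u i"
      using ij by (simp add: W_def cscalar_prod_sum[OF u(2) u(2)] mult.commute)
    then show "(\<Sum>k<N. W $$ (i, k) * cnj (W $$ (j, k))) = (if i = j then 1 else 0)"
      using assms(1) ij by (auto simp: spectral_decomp_def)
  qed (simp add: W_def)
  define c where "c j = (\<Sum>y<N. W $$ (j, y) * \<alpha> $ y)" for j
  show "\<alpha> $ x = (\<Sum>j<N. c j * u j $ x)" if x: "x < N" for x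
  proof -
    have "(\<Sum>j<N. c j * u j $ x) = (\<Sum>y<N. (\<Sum>j<N. cnj (W $$ (j, x)) * W $$ (j, y)) * \<alpha> $ y)"
      unfolding c_def sum_distrib_right
      by (subst sum.swap) (use x in \<open>auto intro!: sum.cong simp: W_def\<close>)
    also have "\<dots> = (\<Sum>y<N. if y = x then \<alpha> $ x else 0)"
      using x by (intro sum.cong refl) (auto simp: unitary_mat_cols[OF W])
    finally show ?thesis using x by simp
  qed
  have "(\<Sum>j<N. (cmod (c j))\<^sup>2) = (\<Sum>y<N. (cmod (\<alpha> $ y))\<^sup>2)"
    unfolding c_def by (rule unitary_mat_norm[OF W])
  also have "\<dots> = sq_norm_cvec \<alpha>" by (rule sq_norm_cvec_eq[OF assms(2), symmetric])
  finally show "(\<Sum>j<N. (cmod (c j))\<^sup>2) = 1" using assms(3) by simp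
qed

text \<open>Allows orthogonality to be checked on generators and extended to their span.\<close>

lemma submodule_orthogonal:
  "submodule class_ring {s \<in> carrier_vec N. q \<bullet>c s = 0} (module_vec TYPE(complex) N)"
  if q: "q \<in> carrier_vec N"
proof -
  interpret vec_module "TYPE(complex)" N .
  have sum: "q \<bullet>c s = (\<Sum>i<N. q $ i * cnj (s $ i))" if "s \<in> carrier_vec N" for s
    using q that by (intro cscalar_prod_sum) auto
  show ?thesis
  proof (unfold_locales, goal_cases)
    case 2
    then show ?case by (auto simp: sum module_vec_simps distrib_left sum.distrib)
  next
    case (4 c v)
    then have "(\<Sum>i<N. q $ i * cnj ((c \<cdot>\<^sub>v v) $ i)) = cnj c * (\<Sum>i<N. q $ i * cnj (v $ i))"
      by (auto simp: sum_distrib_left module_vec_simps intro!: sum.cong)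
    then show ?case using 4 by (auto simp: sum module_vec_simps)
  qed (use q in \<open>auto simp: module_vec_simps\<close>)
qed

text \<open>The definite description in \<open>orth_proj\<close> demands existence and uniqueness.
  Keeping the terms with index in \<open>T\<close> leaves a remainder orthogonal to the
  generators.\<close>

lemma orth_proj_span:
  fixes u :: "nat \<Rightarrow> complex vec" and N :: nat and c :: "nat \<Rightarrow> complex"
  assumes u: "\<And>j. j < N \<Longrightarrow> u j \<in> carrier_vec N" "\<And>j k. j < N \<Longrightarrow> k < N \<Longrightarrow> u j \<bullet>c u k = (if j = k then 1 else 0)"
    and \<alpha>: "\<alpha> \<in> carrier_vec N" "\<And>x. x < N \<Longrightarrow> \<alpha> $ x = (\<Sum>j<N. c j * u j $ x)"
    and T: "T \<subseteq> {..<N}"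
  shows "orth_proj (LinearCombinations.module.span class_ring (module_vec TYPE(complex) N) (u ` T)) \<alpha> =
    lincomb_vec N T c u"
proof -
  interpret vec_module "TYPE(complex)" N .
  define S where "S = span (u ` T)"
  have uT: "u ` T \<subseteq> carrier_vec N" using u(1) T by auto
  have finT: "finite T" using T finite_subset by blast
  have S_carrier: "S \<subseteq> carrier_vec N" unfolding S_def using span_is_subset2[OF uT] .
  interpret S: submodule class_ring S V unfolding S_def by (rule span_is_submodule[OF uT])
  have add: "v + w \<in> S" if "v \<in> S" "w \<in> S" for v w
    using S.m_closed[OF that] by (simp add: module_vec_simps)
  have smult: "k \<cdot>\<^sub>v v \<in> S" if "v \<in> S" for k v
    using S.smult_closed[of k v] that by (simp add: module_vec_simps)
  have zero: "0\<^sub>v N \<in> S" using S.zero_closed by (simp add: module_vec_simps)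
  have mem: "lincomb_vec N F c u \<in> S" if "F \<subseteq> T" for F
    using finite_subset[OF that finT] that
  proof (induction F rule: finite_induct)
    case empty
    have "lincomb_vec N {} c u = 0\<^sub>v N" by (intro eq_vecI) (auto simp: lincomb_vec_def)
    then show ?case using zero by simp
  next
    case (insert j F)
    have j: "u j \<in> S" using insert.prems in_own_span[OF uT] by (auto simp: S_def)
    have "lincomb_vec N (insert j F) c u = c j \<cdot>\<^sub>v u j + lincomb_vec N F c u"
      using insert j S_carrier by (intro eq_vecI) (auto simp: lincomb_vec_def)
    then show ?case using add smult j insert by simp
  qed
  define p where "p = lincomb_vec N T c u"
  have p: "p \<in> S" "p \<in> carrier_vec N" using mem[of T] by (auto simp: p_def)
  have orth: "(\<alpha> - p) \<bullet>c s = 0" if "s \<in> S" for s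
  proof -
    have ap: "\<alpha> - p \<in> carrier_vec N" using \<alpha>(1) p(2) by simp
    have ap_index: "(\<alpha> - p) $ x = (\<Sum>j\<in>{..<N} - T. c j * u j $ x)" if "x < N" for x
      using that \<alpha> p(2) T by (simp add: p_def lincomb_vec_def sum_diff)
    have "(\<alpha> - p) \<bullet>c u k = 0" if k: "k \<in> T" for k
    proof -
      have kN: "k < N" using k T by auto
      have "(\<alpha> - p) \<bullet>c u k = (\<Sum>x<N. (\<Sum>j\<in>{..<N} - T. c j * u j $ x) * cnj (u k $ x))"
        using ap u(1)[OF kN] by (subst cscalar_prod_sum[of _ N]) (auto intro!: sum.cong simp: ap_index simp del: index_minus_vec)
      also have "\<dots> = (\<Sum>j\<in>{..<N} - T. c j * (u j \<bullet>c u k))"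
        unfolding sum_distrib_right
        by (subst sum.swap) (use u(1) kN in \<open>auto intro!: sum.cong simp: cscalar_prod_sum[of _ N] sum_distrib_left mult.assoc\<close>)
      also have "\<dots> = 0" using k kN u(2) by (intro sum.neutral) auto
      finally show ?thesis .
    qed
    then have "u ` T \<subseteq> {s \<in> carrier_vec N. (\<alpha> - p) \<bullet>c s = 0}" using uT by auto
    then have "S \<subseteq> {s \<in> carrier_vec N. (\<alpha> - p) \<bullet>c s = 0}"
      unfolding S_def by (rule span_is_subset[OF _ submodule_orthogonal[OF ap]])
    then show ?thesis using that by auto
  qed
  have "orth_proj S \<alpha> = p"
    unfolding orth_proj_def
  proof (rule the_equality)
    show "p \<in> S \<and> (\<forall>s\<in>S. (\<alpha> - p) \<bullet>c s = 0)" using p orth by blast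
    fix q assume q: "q \<in> S \<and> (\<forall>s\<in>S. (\<alpha> - q) \<bullet>c s = 0)"
    then have qc: "q \<in> carrier_vec N" using S_carrier by auto
    \<comment> \<open>The difference of two candidates lies in \<open>S\<close>. It is also the
      difference of their residuals, which are orthogonal to \<open>S\<close>, hence it is
      orthogonal to itself.\<close>
    define e where "e = q + (-1) \<cdot>\<^sub>v p"
    have e: "e \<in> S" "e \<in> carrier_vec N" unfolding e_def using add smult q p S_carrier by auto
    have "e \<bullet>c e = (\<alpha> - p) \<bullet>c e - (\<alpha> - q) \<bullet>c e"
    proof -
      have "e \<bullet>c e = (\<Sum>i<N. e $ i * cnj (e $ i))" using e(2) by (intro cscalar_prod_sum) auto
      also have "\<dots> = (\<Sum>i<N. (\<alpha> - p) $ i * cnj (e $ i) - (\<alpha> - q) $ i * cnj (e $ i))"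
        using \<alpha>(1) p(2) qc by (intro sum.cong refl) (auto simp: e_def algebra_simps)
      also have "\<dots> = (\<alpha> - p) \<bullet>c e - (\<alpha> - q) \<bullet>c e"
        using \<alpha>(1) p(2) qc e(2) by (simp add: cscalar_prod_sum[of _ N] sum_subtractf)
      finally show ?thesis .
    qed
    then have "e \<bullet>c e = 0" using orth[OF e(1)] q e(1) by simp
    then have "e = 0\<^sub>v N" using conjugate_square_eq_0_vec[OF e(2)] by simp
    then have "q $ i = p $ i" if "i < N" for i
    proof -
      have "e $ i = q $ i - p $ i" using that qc p(2) by (simp add: e_def)
      then show ?thesis using \<open>e = 0\<^sub>v N\<close> that by simp
    qed
    then show "q = p" using qc p(2) by (intro eq_vecI) auto
  qed
  then show ?thesis by (simp add: S_def p_def)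
qed

lemma sq_norm_lincomb_vec:
  assumes u: "\<And>j. j < N \<Longrightarrow> u j \<in> carrier_vec N" "\<And>j k. j < N \<Longrightarrow> k < N \<Longrightarrow> u j \<bullet>c u k = (if j = k then 1 else 0)"
    and T: "T \<subseteq> {..<N}"
  shows "sq_norm_cvec (lincomb_vec N T c u) = (\<Sum>j\<in>T. (cmod (c j))\<^sup>2)"
proof -
  have fin: "finite T" using T finite_subset by blast
  have "sq_norm_cvec (lincomb_vec N T c u) = (\<Sum>x<N. (cmod (\<Sum>j\<in>T. c j * u j $ x))\<^sup>2)"
    unfolding sq_norm_cvec_eq[OF lincomb_vec_carrier] by (simp add: lincomb_vec_def)
  also have "\<dots> = (\<Sum>j\<in>T. (cmod (c j))\<^sup>2)"
  proof (rule sum_cmod_sq_orthonormal[OF finite_lessThan fin])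
    fix j k assume "j \<in> T" "k \<in> T"
    then have jk: "j < N" "k < N" using T by auto
    then have "(\<Sum>x<N. cnj (u j $ x) * u k $ x) = u k \<bullet>c u j"
      using u(1) by (subst cscalar_prod_sum[of _ N]) (auto simp: mult.commute)
    then show "(\<Sum>x<N. cnj (u j $ x) * u k $ x) = (if j = k then 1 else 0)" using u(2)[OF jk(2,1)] by auto
  qed
  finally show ?thesis .
qed

lemma advice_state_weight:
  assumes "spectral_decomp N U \<theta> u" "advice_state N \<gamma> \<theta> u \<alpha>"
    "\<And>x. x < N \<Longrightarrow> \<alpha> $ x = (\<Sum>j<N. c j * u j $ x)"
  shows "\<gamma>\<^sup>2 \<le> (\<Sum>j | j < N \<and> \<theta> j = theta_max N \<theta>. (cmod (c j))\<^sup>2)"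
proof -
  define T where "T = {j. j < N \<and> \<theta> j = theta_max N \<theta>}"
  have T: "T \<subseteq> {..<N}" by (auto simp: T_def)
  have u: "\<And>j. j < N \<Longrightarrow> u j \<in> carrier_vec N" "\<And>j k. j < N \<Longrightarrow> k < N \<Longrightarrow> u j \<bullet>c u k = (if j = k then 1 else 0)"
    using assms(1) by (auto simp: spectral_decomp_def)
  have \<alpha>: "\<alpha> \<in> carrier_vec N" "\<gamma>\<^sup>2 \<le> sq_norm_cvec (orth_proj (top_space N \<theta> u) \<alpha>)"
    using assms(2) by (auto simp: advice_state_def)
  have "{u j |j. j < N \<and> \<theta> j = theta_max N \<theta>} = u ` T" by (auto simp: T_def)
  then have "orth_proj (top_space N \<theta> u) \<alpha> = lincomb_vec N T c u"
    unfolding top_space_def using orth_proj_span[OF u \<alpha>(1) assms(3) T] by simp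
  then show ?thesis using \<alpha>(2) sq_norm_lincomb_vec[OF u T] by (simp add: T_def)
qed

text \<open>Passage to the complement: setting \<open>q\<close> to zero on \<open>T\<close> leaves
  the tuples that miss \<open>T\<close>, and both sums over tuples factorise.\<close>

lemma prob_some_copy_in:
  fixes q :: "nat \<Rightarrow> real"
  assumes "\<And>j. 0 \<le> q j" "(\<Sum>j<N. q j) = 1"
  shows "(\<Sum>J<N ^ m. if \<exists>i<m. dig N i J \<in> T then \<Prod>i<m. q (dig N i J) else 0) =
    1 - (1 - (\<Sum>j\<in>{..<N} \<inter> T. q j)) ^ m"
proof -
  have "(\<Sum>J<N ^ m. if \<exists>i<m. dig N i J \<in> T then \<Prod>i<m. q (dig N i J) else 0) =
      (\<Sum>J<N ^ m. (\<Prod>i<m. q (dig N i J)) - (\<Prod>i<m. if dig N i J \<in> T then 0 else q (dig N i J)))"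
  proof (intro sum.cong refl)
    fix J
    show "(if \<exists>i<m. dig N i J \<in> T then \<Prod>i<m. q (dig N i J) else 0) =
        (\<Prod>i<m. q (dig N i J)) - (\<Prod>i<m. if dig N i J \<in> T then 0 else q (dig N i J))"
    proof (cases "\<exists>i<m. dig N i J \<in> T")
      case True
      then have "(\<Prod>i<m. if dig N i J \<in> T then 0 else q (dig N i J)) = 0"
        by (intro prod_zero) auto
      then show ?thesis using True by simp
    next
      case False
      then have "(\<Prod>i<m. if dig N i J \<in> T then 0 else q (dig N i J)) = (\<Prod>i<m. q (dig N i J))"
        by (intro prod.cong) auto
      then show ?thesis by (simp only: if_not_P[OF False] diff_self)
    qed
  qed
  also have "\<dots> = (\<Prod>i<m. \<Sum>j<N. q j) - (\<Prod>i<m. \<Sum>j<N. if j \<in> T then 0 else q j)"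
    unfolding sum_subtractf sum_prod_dig[where g = "\<lambda>_ j. q j"]
      sum_prod_dig[where g = "\<lambda>_ j. if j \<in> T then 0 else q j"] ..
  also have "(\<Sum>j<N. if j \<in> T then 0 else q j) = (\<Sum>j<N. q j) - (\<Sum>j\<in>{..<N} \<inter> T. q j)"
    by (subst sum.inter_restrict) (auto simp flip: sum_subtractf intro!: sum.cong)
  finally show ?thesis by (simp add: assms(2))
qed

section \<open>Assembly and choice of parameters\<close>

lemma samples_mono_event:
  assumes "samples m T P" "S \<subseteq> S'"
  shows "P \<phi> S \<le> P \<phi> S'"
proof -
  obtain d A val where P: "\<And>\<phi> S. P \<phi> S = weight d (A \<phi>) (\<lambda>a. val a \<in> S)"
    using assms(1) unfolding samples_def by blast
  show ?thesis unfolding P using assms(2) by (intro sum_mono) auto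
qed

text \<open>No sampled phase exceeds \<open>theta_max\<close>, so one copy in the top eigenspace
  makes the maximum of the samples exact. With \<open>m \<ge> 2 / \<gamma>\<^sup>2\<close> all
  copies miss it with probability at most \<open>exp (- 2) \<le> 1 / 5\<close>, and
  \<open>4 / 5 * 7 / 8 = 7 / 10\<close> exceeds \<open>2 / 3\<close>.\<close>

lemma solves_maxQPE_of_estimator:
  assumes N: "0 < N" and m: "0 < m" "2 / \<gamma>\<^sup>2 \<le> real m" and \<gamma>: "0 < \<gamma>" "\<gamma> \<le> 1" and \<delta>: "0 < \<delta>"
    and est: "estimates_max m \<delta> B (1 / 8) (phases_below m (2 * pi - 2 * \<delta>))"
  shows "\<exists>A. valid_qalg N A \<and> copies A = m \<and> real (cost A) \<le> 2 * B \<and> (\<forall>promise. solves_maxQPE_for promise N \<delta> \<gamma> A)"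
proof -
  obtain T P where T: "real T \<le> B" "samples m T P"
    "\<forall>\<phi>\<in>phases_below m (2 * pi - 2 * \<delta>). 1 - 1 / 8 \<le> P \<phi> (near_max m \<delta> \<phi>)"
    using est unfolding estimates_max_def by blast
  obtain A where A: "valid_qalg N A" "copies A = m" "cost A = 2 * T"
    "\<And>U \<theta> u \<alpha> c G. spectral_decomp N U \<theta> u \<Longrightarrow> \<alpha> \<in> carrier_vec N \<Longrightarrow>
      (\<And>x. x < N \<Longrightarrow> \<alpha> $ x = (\<Sum>j<N. c j * u j $ x)) \<Longrightarrow>
      output_prob N A U \<alpha> G = (\<Sum>J<N ^ m. (\<Prod>i<m. (cmod (c (dig N i J)))\<^sup>2) * P (\<lambda>i. \<theta> (dig N i J)) G)"
    using samples_qalg[OF T(2) N] by blast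
  have "solves_maxQPE_for promise N \<delta> \<gamma> A" for promise
    unfolding solves_maxQPE_for_def
  proof (intro allI impI)
    fix U \<theta> u \<alpha>
    assume sp: "spectral_decomp N U \<theta> u" and lt: "theta_max N \<theta> < 2 * pi - 2 * \<delta>" and ad: "advice_state N \<gamma> \<theta> u \<alpha>"
    define \<tau> where "\<tau> = theta_max N \<theta>"
    define G where "G = within_mod_2pi \<tau> \<delta>"
    define Top where "Top = {j. \<theta> j = \<tau>}"
    have \<theta>: "0 \<le> \<theta> j" "\<theta> j \<le> \<tau>" if "j < N" for j
      using sp that by (auto simp: spectral_decomp_def \<tau>_def theta_max_def)
    obtain c where c: "\<And>x. x < N \<Longrightarrow> \<alpha> $ x = (\<Sum>j<N. c j * u j $ x)" "(\<Sum>j<N. (cmod (c j))\<^sup>2) = 1"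
      using spectral_decomp_expansion[OF sp] ad by (auto simp: advice_state_def)
    define q where "q j = (cmod (c j))\<^sup>2" for j
    have "{..<N} \<inter> Top = {j. j < N \<and> \<theta> j = theta_max N \<theta>}" by (auto simp: Top_def \<tau>_def)
    then have w: "\<gamma>\<^sup>2 \<le> (\<Sum>j\<in>{..<N} \<inter> Top. q j)"
      using advice_state_weight[OF sp ad c(1)] by (simp add: q_def)
    have w1: "(\<Sum>j\<in>{..<N} \<inter> Top. q j) \<le> 1"
      unfolding c(2)[symmetric] q_def by (intro sum_mono2) auto
    have "(1 - (\<Sum>j\<in>{..<N} \<inter> Top. q j)) ^ m \<le> exp (- \<gamma>\<^sup>2) ^ m"
      using w w1 exp_ge_add_one_self[of "- \<gamma>\<^sup>2"] by (intro power_mono) linarith+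
    also have "\<dots> = exp (- (real m * \<gamma>\<^sup>2))" by (simp flip: exp_of_nat_mult)
    also have "\<dots> \<le> exp (- 2)"
    proof -
      have "2 = 2 / \<gamma>\<^sup>2 * \<gamma>\<^sup>2" using \<gamma> by simp
      also have "\<dots> \<le> real m * \<gamma>\<^sup>2" using m by (intro mult_right_mono) auto
      finally show ?thesis by simp
    qed
    \<comment> \<open>The quadratic Taylor bound gives \<open>exp 2 \<ge> 1 + 2 + 2\<close>.\<close>
    also have "\<dots> \<le> 1 / 5"
      using exp_lower_Taylor_quadratic[of 2] by (simp add: exp_minus field_simps)
    finally have tail: "(1 - (\<Sum>j\<in>{..<N} \<inter> Top. q j)) ^ m \<le> 1 / 5" .
    have good: "7 / 8 \<le> P (\<lambda>i. \<theta> (dig N i J)) G" if J: "\<exists>i<m. dig N i J \<in> Top" for J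
    proof -
      let ?\<phi> = "\<lambda>i. \<theta> (dig N i J)"
      have "Max (?\<phi> ` {..<m}) = \<tau>"
      proof (rule Max_eqI)
        show "\<tau> \<in> ?\<phi> ` {..<m}" using J by (auto simp: Top_def)
      qed (use \<theta> dig_less[OF N] in auto)
      then have "near_max m \<delta> ?\<phi> \<subseteq> G"
        by (auto simp: G_def within_mod_2pi_def abs_le_iff intro!: exI[of _ 0])
      then have "P ?\<phi> (near_max m \<delta> ?\<phi>) \<le> P ?\<phi> G" by (rule samples_mono_event[OF T(2)])
      moreover have "0 \<le> ?\<phi> i \<and> ?\<phi> i \<le> 2 * pi - 2 * \<delta>" for i
        using \<theta>[OF dig_less[OF N, of i J]] lt unfolding \<tau>_def by linarith
      then have "1 - 1 / 8 \<le> P ?\<phi> (near_max m \<delta> ?\<phi>)"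
        using bspec[OF T(3), of ?\<phi>] by simp
      ultimately show ?thesis by linarith
    qed
    have "2 / 3 \<le> 7 / 8 * (1 - (1 - (\<Sum>j\<in>{..<N} \<inter> Top. q j)) ^ m)" using tail by simp
    also have "\<dots> = (\<Sum>J<N ^ m. 7 / 8 * (if \<exists>i<m. dig N i J \<in> Top then \<Prod>i<m. q (dig N i J) else 0))"
    proof -
      have "(\<Sum>J<N ^ m. if \<exists>i<m. dig N i J \<in> Top then \<Prod>i<m. q (dig N i J) else 0) =
          1 - (1 - (\<Sum>j\<in>{..<N} \<inter> Top. q j)) ^ m"
        by (rule prob_some_copy_in) (simp_all add: q_def c(2))
      then show ?thesis by (simp only: sum_distrib_left[symmetric])
    qed
    also have "\<dots> \<le> (\<Sum>J<N ^ m. (\<Prod>i<m. q (dig N i J)) * P (\<lambda>i. \<theta> (dig N i J)) G)"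
    proof (rule sum_mono)
      fix J
      have "0 \<le> (\<Prod>i<m. q (dig N i J))" by (intro prod_nonneg) (simp add: q_def)
      then show "7 / 8 * (if \<exists>i<m. dig N i J \<in> Top then \<Prod>i<m. q (dig N i J) else 0) \<le>
          (\<Prod>i<m. q (dig N i J)) * P (\<lambda>i. \<theta> (dig N i J)) G"
        using good[of J] samples_range(1)[OF T(2)] mult_left_mono[of "7 / 8" _ "\<Prod>i<m. q (dig N i J)"]
        by (auto simp: mult.commute)
    qed
    also have "\<dots> = output_prob N A U \<alpha> G"
      using A(4)[OF sp _ c(1)] ad by (simp add: q_def advice_state_def)
    finally show "2 / 3 \<le> output_prob N A U \<alpha> (within_mod_2pi (theta_max N \<theta>) \<delta>)"
      by (simp add: G_def \<tau>_def)
  qed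
  then show ?thesis using A(1,2,3) T(1) by (intro exI[of _ A]) simp
qed

theorem lemma4p6:
  shows "\<exists>C :: real. C > 0 \<and>
    (\<forall>(N :: nat) (\<gamma> :: real) (\<delta> :: real).
       N \<ge> 2 \<longrightarrow> 1 / sqrt (real N) \<le> \<gamma> \<longrightarrow> \<gamma> \<le> 1 \<longrightarrow> \<delta> > 0 \<longrightarrow>
       (\<exists>A :: qalg.
          valid_qalg N A \<and>
          real (copies A) \<le> C / \<gamma>\<^sup>2 \<and>
          real (cost A) \<le> C * (max 1 (log 2 (1 / \<gamma>)) / (\<gamma> * \<delta>)) \<and>
          solves_maxQPE_unknown_basis N \<delta> \<gamma> A \<and>
          solves_maxQPE_known_basis N \<delta> \<gamma> A))"
proof -
  obtain C0 where C0: "C0 > 0" "\<And>m l \<delta>. 0 < m \<Longrightarrow> m \<le> 2 ^ l \<Longrightarrow> 0 < \<delta> \<Longrightarrow> \<delta> \<le> 4 \<Longrightarrow>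
    estimates_max m \<delta> (C0 * sqrt (real m) * real (l + 1) / \<delta>) (1 / 8) (phases_below m (2 * pi - 2 * \<delta>))"
    using max_estimation by blast
  \<comment> \<open>The \<open>3\<close> bounds the copies, as
    \<open>2 / \<gamma>\<^sup>2 + 1 \<le> 3 / \<gamma>\<^sup>2\<close>. The \<open>24 * C0\<close>
    is \<open>2 * C0\<close> times the bounds \<open>2 / \<gamma>\<close> on \<open>sqrt m\<close>
    and \<open>6 * Lg\<close> on \<open>l + 1\<close>.\<close>
  define C where "C = 3 + 24 * C0"
  show ?thesis
  proof (intro exI[of _ C] conjI allI impI)
    show "C > 0" using C0(1) by (simp add: C_def)
    fix N :: nat and \<gamma> \<delta> :: real
    assume N: "2 \<le> N" and \<gamma>_ge: "1 / sqrt (real N) \<le> \<gamma>" and \<gamma>1: "\<gamma> \<le> 1" and \<delta>: "0 < \<delta>"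
    have "0 < 1 / sqrt (real N)" using N by simp
    then have \<gamma>: "0 < \<gamma>" using \<gamma>_ge by linarith
    have \<gamma>2: "\<gamma>\<^sup>2 \<le> 1" "0 < \<gamma>\<^sup>2" using \<gamma> \<gamma>1 by (auto intro: power_le_one)
    define Lg where "Lg = max 1 (log 2 (1 / \<gamma>))"
    have Lg: "1 \<le> Lg" "log 2 (1 / \<gamma>) \<le> Lg" by (auto simp: Lg_def)
    define m where "m = nat \<lceil>2 / \<gamma>\<^sup>2\<rceil>"
    have two: "2 \<le> 2 / \<gamma>\<^sup>2" using \<gamma>2 by (simp add: field_simps)
    then have m: "2 / \<gamma>\<^sup>2 \<le> real m" "real m \<le> 2 / \<gamma>\<^sup>2 + 1" unfolding m_def by linarith+
    have m0: "0 < m" using m(1) two by (intro Nat.gr0I) simp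
    have "1 \<le> 1 / \<gamma>\<^sup>2" using \<gamma>2 by (simp add: field_simps)
    then have m3: "real m \<le> 3 / \<gamma>\<^sup>2" using m(2) by simp
    have "\<exists>A. valid_qalg N A \<and> copies A = m \<and> real (cost A) \<le> 24 * C0 * (Lg / (\<gamma> * \<delta>)) \<and>
        (\<forall>promise. solves_maxQPE_for promise N \<delta> \<gamma> A)"
    \<comment> \<open>The bound \<open>4\<close> exceeds \<open>pi\<close>, so that
      \<open>2 * pi - 2 * \<delta>\<close> is negative in the other case.\<close>
    proof (cases "\<delta> \<le> 4")
      case True
      \<comment> \<open>Chosen so that \<open>2 ^ l \<ge> 4 / \<gamma>\<^sup>2 \<ge> m\<close>,
        while \<open>l\<close> stays linear in \<open>log 2 (1 / \<gamma>)\<close>.\<close>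
      define l where "l = nat \<lceil>2 + 2 * log 2 (1 / \<gamma>)\<rceil>"
      have "0 \<le> log 2 (1 / \<gamma>)" using \<gamma> \<gamma>1 by simp
      then have l: "2 + 2 * log 2 (1 / \<gamma>) \<le> real l" "real l \<le> 3 + 2 * log 2 (1 / \<gamma>)"
        unfolding l_def by linarith+
      have "real m \<le> 4 * (1 / \<gamma>)\<^sup>2" using m3 \<gamma>2(2) by (simp add: power_divide field_simps)
      also have "\<dots> = 2 powr 2 * (2 powr log 2 (1 / \<gamma>)) powr 2"
        using \<gamma> by (simp add: powr_numeral)
      also have "\<dots> = 2 powr (2 + 2 * log 2 (1 / \<gamma>))" by (simp add: powr_add powr_powr mult.commute)
      also have "\<dots> \<le> 2 powr real l" using l(1) by (intro powr_mono) auto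
      also have "\<dots> = real (2 ^ l)" by (simp add: powr_realpow)
      finally have ml: "m \<le> 2 ^ l" by (simp only: of_nat_le_iff)
      obtain A where A: "valid_qalg N A" "copies A = m" "real (cost A) \<le> 2 * (C0 * sqrt (real m) * real (l + 1) / \<delta>)"
        "\<forall>promise. solves_maxQPE_for promise N \<delta> \<gamma> A"
        using solves_maxQPE_of_estimator[OF _ m0 m(1) \<gamma> \<gamma>1 \<delta> C0(2)[OF m0 ml \<delta> True], of N] N by auto
      have "sqrt (real m) \<le> 2 / \<gamma>"
      proof (rule real_le_lsqrt)
        have "3 / \<gamma>\<^sup>2 \<le> 4 / \<gamma>\<^sup>2" using \<gamma>2 by (intro divide_right_mono) auto
        then show "real m \<le> (2 / \<gamma>)\<^sup>2" using m3 by (simp add: power_divide)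
      qed (use \<gamma> in auto)
      \<comment> \<open>From \<open>l + 1 \<le> 4 + 2 * log 2 (1 / \<gamma>)\<close>; the maximum
        with \<open>1\<close> in \<open>Lg\<close> absorbs the constant.\<close>
      moreover have "real (l + 1) \<le> 6 * Lg" using l(2) Lg by simp
      ultimately have "C0 * (sqrt (real m) * real (l + 1)) \<le> C0 * (2 / \<gamma> * (6 * Lg))"
        using C0(1) \<gamma> by (intro mult_left_mono mult_mono) auto
      then have "2 * (C0 * sqrt (real m) * real (l + 1) / \<delta>) \<le> 2 * (C0 * (2 / \<gamma> * (6 * Lg)) / \<delta>)"
        using \<delta> by (intro mult_left_mono divide_right_mono) (auto simp: mult.assoc)
      also have "\<dots> = 24 * C0 * (Lg / (\<gamma> * \<delta>))" by simp
      finally show ?thesis using A by (intro exI[of _ A]) auto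
    next
      case False
      text \<open>No input satisfies the promise.\<close>
      obtain A where A: "valid_qalg N A" "copies A = m" "cost A = 2 * 0"
      proof -
        have "0 < N" using N by simp
        show ?thesis
          by (rule samples_qalg[OF samples_const[OF m0, of 0 "0 :: real"] \<open>0 < N\<close>]) (rule that; assumption)
      qed
      have "solves_maxQPE_for promise N \<delta> \<gamma> A" for promise
        using False pi_less_4 by (auto simp: solves_maxQPE_for_def)
      moreover have "0 \<le> 24 * C0 * (Lg / (\<gamma> * \<delta>))" using C0(1) Lg \<gamma> \<delta> by simp
      ultimately show ?thesis using A by (intro exI[of _ A]) simp
    qed
    then obtain A where A: "valid_qalg N A" "copies A = m" "real (cost A) \<le> 24 * C0 * (Lg / (\<gamma> * \<delta>))"
      "\<forall>promise. solves_maxQPE_for promise N \<delta> \<gamma> A" by blast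
    have "0 \<le> Lg / (\<gamma> * \<delta>)" using Lg \<gamma> \<delta> by simp
    then have "24 * C0 * (Lg / (\<gamma> * \<delta>)) \<le> C * (Lg / (\<gamma> * \<delta>))"
      by (intro mult_right_mono) (simp_all add: C_def)
    moreover have "3 / \<gamma>\<^sup>2 \<le> C / \<gamma>\<^sup>2" using C0(1) \<gamma>2 by (intro divide_right_mono) (auto simp: C_def)
    ultimately show "\<exists>A. valid_qalg N A \<and> real (copies A) \<le> C / \<gamma>\<^sup>2 \<and>
        real (cost A) \<le> C * (max 1 (log 2 (1 / \<gamma>)) / (\<gamma> * \<delta>)) \<and>
        solves_maxQPE_unknown_basis N \<delta> \<gamma> A \<and> solves_maxQPE_known_basis N \<delta> \<gamma> A"
      using A m3 unfolding solves_maxQPE_unknown_basis_def solves_maxQPE_known_basis_def Lg_def[symmetric]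
      by (intro exI[of _ A]) auto
  qed
qed

end
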